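(* Let $\sigma:M\to N$ be a fibration of monoids whose kernel $A=\mathrm{Ker}(\sigma)$ is commutative, let $\kappa$ be a cleavage of $\sigma$, and let $\phi$ (the action of $N$ on $A$) and $\gamma:N\times N\to A^\times$ be the associated functions. With the notation of the context: (i) For any 1-cocycle $\xi\in Z^1(N,A^\times)$, the map $x\mapsto x\,\xi(\sigma(x))$ is an automorphism of $M$ which belongs to $\mathrm{Aut}^{A,N}(M)$. In this way one obtains an isomorphism of groups $Z^1(N,A^\times)\to\mathrm{Aut}^{A,N}(M)$. (ii) For any $\theta\in C_1$, the map $(m,n)\mapsto\gamma_{m,n}\,\theta(\gamma_{m,n})^{-1}$ is a (regular) 2-cocycle. The induced map $\lambda_1:C_1\to H^2(N,A^\times)$ is independent of the chosen cleavage $\kappa$. (iii) The sequence $$1\to\mathrm{Aut}^{A,N}(M)\to\mathrm{Aut}^N_A(M)\xrightarrow{\rho_1}C_1\xrightarrow{\lambda_1}H^2(N,A^\times)$$ is exact. (iv) For any $\eta\in C_2$, the map $(m,n)\mapsto\gamma_{\eta(m),\eta(n)}\gamma_{m,n}^{-1}$ is a (regular) 2-cocycle, and the induced map $\lambda_2:C_2\to H^2(N,A^\times)$ is independent of the choice of the cleavage $\kappa$. (v) The sequence $$1\to\mathrm{Aut}^{A,N}(M)\to\mathrm{Aut}^A(M)\xrightarrow{\rho_2}C_2\xrightarrow{\lambda_2}H^2(N,A^\times)$$ is exact. Here the first nontrivial maps in (iii) and (v) are inclusions, and exactness at $C_1$, $C_2$ means that the image of $\rho_i$ is the set of elements sent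 by $\lambda_i$ to the trivial class.
   Context: $A^\times$ is the group of invertible elements of $A$; $\mathrm{Ker}(\sigma)=\sigma^{-1}(1)$; monoids are written multiplicatively. For a monoid homomorphism $\sigma:M\to N$, an element $x\in M$ is $\sigma$-precartesian if for every $z\in M$ with $\sigma(z)=\sigma(x)$ there is a unique $y\in\mathrm{Ker}(\sigma)$ with $z=xy$; $\mathrm{Pcar}(\sigma)$ is the set of these. $x$ is $\sigma$-cartesian if (i) for every $z\in M$, $v\in N$ with $\sigma(z)=\sigma(x)v$ there is $y\in M$ with $z=xy$, $\sigma(y)=v$; and (ii) $xy_1=xy_2$, $\sigma(y_1)=\sigma(y_2)$ imply $y_1=y_2$. $\sigma$ is a fibration if above every element of $N$ there is a $\sigma$-cartesian element. A cleavage of $\sigma$ is a map $\kappa:N\to M$ with $\kappa(1)=1$ such that $\kappa(n)$ is $\sigma$-precartesian and $\sigma(\kappa(n))=n$ for all $n$. Given $\kappa$, the functions $\phi:A\times N\to A$, $(a,n)\mapsto \phi_n(a)$, and $\gamma:N\times N\to A$ are uniquely determined by $a\kappa(n)=\kappa(n)\phi_n(a)$ and $\kappa(m)\kappa(n)=\kappa(mn)\gamma_{m,n}$. Since $\sigma$ is a fibration and $A$ is commutative, $\gamma$ takes values in $A^\times$ and $\phi$ is a right action of $N$ on $A$ by monoid endomorphisms: $\phi_{mn}=\phi_n\phi_m$, $\phi_1=\mathrm{id}$. Automorphisms: $\mathrm{Aut}_A(M)$ is the group of automorphisms $\psi$ of the monoid $M$ with $\psi(A)=A$ and $\psi(\mathrm{Pcar}(\sigma))\subseteq\mathrm{Pcar}(\sigma)$.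 For $\psi\in\mathrm{Aut}_A(M)$, $\theta_\psi\in\mathrm{Aut}(A)$ is the restriction of $\psi$ to $A$ and $\eta_\psi\in\mathrm{Aut}(N)$ is the unique automorphism with $\eta_\psi\sigma=\sigma\psi$. Set $\mathrm{Aut}^{A,N}(M)=\{\psi\in\mathrm{Aut}_A(M):\theta_\psi=\mathrm{id}_A,\ \eta_\psi=\mathrm{id}_N\}$, $\mathrm{Aut}^A(M)=\{\psi\in\mathrm{Aut}_A(M):\theta_\psi=\mathrm{id}_A\}$, $\mathrm{Aut}^N_A(M)=\{\psi\in\mathrm{Aut}_A(M):\eta_\psi=\mathrm{id}_N\}$. $C\subseteq\mathrm{Aut}(A)\times\mathrm{Aut}(N)$ is the subgroup of pairs $(\theta,\eta)$ for which there is a map $\alpha:N\to A^\times$ with $\phi_{\eta(n)}(\theta(a))\alpha(n)=\alpha(n)\theta(\phi_n(a))$ for all $a\in A,n\in N$. $C_1=\{\theta\in\mathrm{Aut}(A):(\theta,\mathrm{id}_N)\in C\}$ (equivalently $\theta\phi_n=\phi_n\theta$ for all $n$), $C_2=\{\eta\in\mathrm{Aut}(N):(\mathrm{id}_A,\eta)\in C\}$ (equivalently $\phi_{\eta(n)}=\phi_n$ for all $n$). The homomorphisms $\rho_1:\mathrm{Aut}^N_A(M)\to C_1$, $\rho_2:\mathrm{Aut}^A(M)\to C_2$ are $\rho_1(\psi)=\theta_\psi$, $\rho_2(\psi)=\eta_\psi$. Cocycles: $Z^1(N,A^\times)$ is the group (under pointwise multiplication) of maps $\xi:N\to A^\times$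 with $\xi(mn)=\phi_n(\xi(m))\xi(n)$. A regular 2-cocycle is a map $f:N\times N\to A^\times$ with $f_{mn,k}\phi_k(f_{m,n})=f_{m,nk}f_{n,k}$ and $f_{n,1}=1=f_{1,n}$. Two such cocycles satisfy $f\sim f'$ if there is $\tau:N\to A^\times$ with $\tau(1)=1$ and $f_{m,n}\tau(mn)=f'_{m,n}\tau(n)\phi_n(\tau(m))$ for all $m,n$. $H^2(N,A^\times)$ is the set (an abelian group under pointwise multiplication) of equivalence classes of regular 2-cocycles; its trivial class is that of the constant cocycle $1$. *)

theory Defs
  imports "HOL-Algebra.Coset" "HOL-Algebra.Bij"
begin

text \<open>
  Maps that have to be compared for equality (automorphisms, cocycles) are taken extensional
  on the carriers, as in \<^const>\<open>auto\<close> and \<^const>\<open>AutoGroup\<close>. The multiplication of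
  \<^term>\<open>AutoGroup M\<close> is composition, the right factor being applied first.
\<close>

section \<open>Fibrations of monoids and cleavages\<close>

definition ker_monoid ::
    "('a, 'c) monoid_scheme \<Rightarrow> ('b, 'd) monoid_scheme \<Rightarrow> ('a \<Rightarrow> 'b) \<Rightarrow> ('a, 'c) monoid_scheme" where
  "ker_monoid M N \<sigma> = M\<lparr>carrier := kernel M N \<sigma>\<rparr>"

definition precartesian ::
    "('a, 'c) monoid_scheme \<Rightarrow> ('b, 'd) monoid_scheme \<Rightarrow> ('a \<Rightarrow> 'b) \<Rightarrow> 'a \<Rightarrow> bool" where
  "precartesian M N \<sigma> x \<longleftrightarrow> x \<in> carrier M \<and>
     (\<forall>z\<in>carrier M. \<sigma> z = \<sigma> x \<longrightarrow> (\<exists>!y. y \<in> kernel M N \<sigma> \<and> z = x \<otimes>\<^bsub>M\<^esub> y))"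

definition Pcar ::
    "('a, 'c) monoid_scheme \<Rightarrow> ('b, 'd) monoid_scheme \<Rightarrow> ('a \<Rightarrow> 'b) \<Rightarrow> 'a set" where
  "Pcar M N \<sigma> = {x. precartesian M N \<sigma> x}"

definition cartesian ::
    "('a, 'c) monoid_scheme \<Rightarrow> ('b, 'd) monoid_scheme \<Rightarrow> ('a \<Rightarrow> 'b) \<Rightarrow> 'a \<Rightarrow> bool" where
  "cartesian M N \<sigma> x \<longleftrightarrow> x \<in> carrier M \<and>
     (\<forall>z\<in>carrier M. \<forall>v\<in>carrier N. \<sigma> z = \<sigma> x \<otimes>\<^bsub>N\<^esub> v \<longrightarrow>
        (\<exists>y\<in>carrier M. z = x \<otimes>\<^bsub>M\<^esub> y \<and> \<sigma> y = v)) \<and>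
     (\<forall>y1\<in>carrier M. \<forall>y2\<in>carrier M.
        x \<otimes>\<^bsub>M\<^esub> y1 = x \<otimes>\<^bsub>M\<^esub> y2 \<and> \<sigma> y1 = \<sigma> y2 \<longrightarrow> y1 = y2)"

text \<open>\<^const>\<open>hom\<close> does not require preservation of the unit, so this is demanded separately.\<close>

definition monoid_fibration ::
    "('a, 'c) monoid_scheme \<Rightarrow> ('b, 'd) monoid_scheme \<Rightarrow> ('a \<Rightarrow> 'b) \<Rightarrow> bool" where
  "monoid_fibration M N \<sigma> \<longleftrightarrow>
     monoid M \<and> monoid N \<and> \<sigma> \<in> hom M N \<and> \<sigma> \<one>\<^bsub>M\<^esub> = \<one>\<^bsub>N\<^esub> \<and>
     (\<forall>n\<in>carrier N. \<exists>x. cartesian M N \<sigma> x \<and> \<sigma> x = n)"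

definition cleavage ::
    "('a, 'c) monoid_scheme \<Rightarrow> ('b, 'd) monoid_scheme \<Rightarrow> ('a \<Rightarrow> 'b) \<Rightarrow> ('b \<Rightarrow> 'a) \<Rightarrow> bool" where
  "cleavage M N \<sigma> \<kappa> \<longleftrightarrow> \<kappa> \<one>\<^bsub>N\<^esub> = \<one>\<^bsub>M\<^esub> \<and>
     (\<forall>n\<in>carrier N. \<kappa> n \<in> Pcar M N \<sigma> \<and> \<sigma> (\<kappa> n) = n)"

text \<open>The functions \<open>\<phi>\<close> and \<open>\<gamma>\<close> determined by a cleavage; they are meaningful only on
  arguments from the carriers. The value \<open>\<phi>\<^sub>n(a)\<close> is written with the element of \<open>N\<close> first.\<close>

definition cleavage_action ::
    "('a, 'c) monoid_scheme \<Rightarrow> ('b, 'd) monoid_scheme \<Rightarrow> ('a \<Rightarrow> 'b) \<Rightarrow> ('b \<Rightarrow> 'a) \<Rightarrow> 'b \<Rightarrow> 'a \<Rightarrow> 'a" where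
  "cleavage_action M N \<sigma> \<kappa> n a =
     (THE b. b \<in> kernel M N \<sigma> \<and> a \<otimes>\<^bsub>M\<^esub> \<kappa> n = \<kappa> n \<otimes>\<^bsub>M\<^esub> b)"

definition cleavage_factor ::
    "('a, 'c) monoid_scheme \<Rightarrow> ('b, 'd) monoid_scheme \<Rightarrow> ('a \<Rightarrow> 'b) \<Rightarrow> ('b \<Rightarrow> 'a) \<Rightarrow> 'b \<Rightarrow> 'b \<Rightarrow> 'a" where
  "cleavage_factor M N \<sigma> \<kappa> m n =
     (THE c. c \<in> kernel M N \<sigma> \<and> \<kappa> m \<otimes>\<^bsub>M\<^esub> \<kappa> n = \<kappa> (m \<otimes>\<^bsub>N\<^esub> n) \<otimes>\<^bsub>M\<^esub> c)"

section \<open>Automorphisms\<close>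

text \<open>A bijective multiplicative map between monoids preserves the unit, so \<^term>\<open>auto M\<close> is
  the set of monoid automorphisms also when \<open>M\<close> is not a group.\<close>

definition ker_auto ::
    "('a, 'c) monoid_scheme \<Rightarrow> ('b, 'd) monoid_scheme \<Rightarrow> ('a \<Rightarrow> 'b) \<Rightarrow> ('a \<Rightarrow> 'a) set" where
  "ker_auto M N \<sigma> = {\<psi> \<in> auto M. \<psi> ` kernel M N \<sigma> = kernel M N \<sigma> \<and>
     \<psi> ` Pcar M N \<sigma> \<subseteq> Pcar M N \<sigma>}"

definition theta ::
    "('a, 'c) monoid_scheme \<Rightarrow> ('b, 'd) monoid_scheme \<Rightarrow> ('a \<Rightarrow> 'b) \<Rightarrow> ('a \<Rightarrow> 'a) \<Rightarrow> 'a \<Rightarrow> 'a" where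
  "theta M N \<sigma> \<psi> = restrict \<psi> (kernel M N \<sigma>)"

definition eta ::
    "('a, 'c) monoid_scheme \<Rightarrow> ('b, 'd) monoid_scheme \<Rightarrow> ('a \<Rightarrow> 'b) \<Rightarrow> ('a \<Rightarrow> 'a) \<Rightarrow> 'b \<Rightarrow> 'b" where
  "eta M N \<sigma> \<psi> = (THE \<eta>. \<eta> \<in> auto N \<and> (\<forall>x\<in>carrier M. \<eta> (\<sigma> x) = \<sigma> (\<psi> x)))"

text \<open>The groups \<open>Aut\<^sup>A\<^sup>,\<^sup>N(M)\<close>, \<open>Aut\<^sup>A(M)\<close> and \<open>Aut\<^sup>N\<^sub>A(M)\<close>: the automorphisms in
  \<^const>\<open>ker_auto\<close> inducing the identity on both \<open>A\<close> and \<open>N\<close>, on \<open>A\<close>, and on \<open>N\<close>, respectively.\<close>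

definition AutAN ::
    "('a, 'c) monoid_scheme \<Rightarrow> ('b, 'd) monoid_scheme \<Rightarrow> ('a \<Rightarrow> 'b) \<Rightarrow> ('a \<Rightarrow> 'a) monoid" where
  "AutAN M N \<sigma> = AutoGroup M \<lparr>carrier := {\<psi> \<in> ker_auto M N \<sigma>.
     theta M N \<sigma> \<psi> = (\<lambda>a\<in>kernel M N \<sigma>. a) \<and> eta M N \<sigma> \<psi> = (\<lambda>n\<in>carrier N. n)}\<rparr>"

definition AutA ::
    "('a, 'c) monoid_scheme \<Rightarrow> ('b, 'd) monoid_scheme \<Rightarrow> ('a \<Rightarrow> 'b) \<Rightarrow> ('a \<Rightarrow> 'a) monoid" where
  "AutA M N \<sigma> = AutoGroup M \<lparr>carrier := {\<psi> \<in> ker_auto M N \<sigma>.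
     theta M N \<sigma> \<psi> = (\<lambda>a\<in>kernel M N \<sigma>. a)}\<rparr>"

definition AutN ::
    "('a, 'c) monoid_scheme \<Rightarrow> ('b, 'd) monoid_scheme \<Rightarrow> ('a \<Rightarrow> 'b) \<Rightarrow> ('a \<Rightarrow> 'a) monoid" where
  "AutN M N \<sigma> = AutoGroup M \<lparr>carrier := {\<psi> \<in> ker_auto M N \<sigma>.
     eta M N \<sigma> \<psi> = (\<lambda>n\<in>carrier N. n)}\<rparr>"

section \<open>Compatible pairs\<close>

definition compat_pairs ::
    "('a, 'c) monoid_scheme \<Rightarrow> ('b, 'd) monoid_scheme \<Rightarrow> ('b \<Rightarrow> 'a \<Rightarrow> 'a) \<Rightarrow>
     (('a \<Rightarrow> 'a) \<times> ('b \<Rightarrow> 'b)) set" where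
  "compat_pairs A N \<phi> = {(\<theta>, \<eta>). \<theta> \<in> auto A \<and> \<eta> \<in> auto N \<and>
     (\<exists>\<alpha> \<in> carrier N \<rightarrow> Units A. \<forall>a\<in>carrier A. \<forall>n\<in>carrier N.
        \<phi> (\<eta> n) (\<theta> a) \<otimes>\<^bsub>A\<^esub> \<alpha> n = \<alpha> n \<otimes>\<^bsub>A\<^esub> \<theta> (\<phi> n a))}"

definition C1 ::
    "('a, 'c) monoid_scheme \<Rightarrow> ('b, 'd) monoid_scheme \<Rightarrow> ('b \<Rightarrow> 'a \<Rightarrow> 'a) \<Rightarrow> ('a \<Rightarrow> 'a) monoid" where
  "C1 A N \<phi> = AutoGroup A \<lparr>carrier :=
     {\<theta> \<in> auto A. (\<theta>, \<lambda>n\<in>carrier N. n) \<in> compat_pairs A N \<phi>}\<rparr>"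

definition C2 ::
    "('a, 'c) monoid_scheme \<Rightarrow> ('b, 'd) monoid_scheme \<Rightarrow> ('b \<Rightarrow> 'a \<Rightarrow> 'a) \<Rightarrow> ('b \<Rightarrow> 'b) monoid" where
  "C2 A N \<phi> = AutoGroup N \<lparr>carrier :=
     {\<eta> \<in> auto N. (\<lambda>a\<in>carrier A. a, \<eta>) \<in> compat_pairs A N \<phi>}\<rparr>"

section \<open>Cohomology in low degrees\<close>

definition Z1 ::
    "('a, 'c) monoid_scheme \<Rightarrow> ('b, 'd) monoid_scheme \<Rightarrow> ('b \<Rightarrow> 'a \<Rightarrow> 'a) \<Rightarrow> ('b \<Rightarrow> 'a) monoid" where
  "Z1 A N \<phi> =
     \<lparr>carrier = {\<xi> \<in> carrier N \<rightarrow>\<^sub>E Units A. \<forall>m\<in>carrier N. \<forall>n\<in>carrier N.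
        \<xi> (m \<otimes>\<^bsub>N\<^esub> n) = \<phi> n (\<xi> m) \<otimes>\<^bsub>A\<^esub> \<xi> n},
      mult = (\<lambda>\<xi> \<zeta>. \<lambda>n\<in>carrier N. \<xi> n \<otimes>\<^bsub>A\<^esub> \<zeta> n),
      one = (\<lambda>n\<in>carrier N. \<one>\<^bsub>A\<^esub>)\<rparr>"

definition reg_cocycles2 ::
    "('a, 'c) monoid_scheme \<Rightarrow> ('b, 'd) monoid_scheme \<Rightarrow> ('b \<Rightarrow> 'a \<Rightarrow> 'a) \<Rightarrow> ('b \<times> 'b \<Rightarrow> 'a) set" where
  "reg_cocycles2 A N \<phi> = {f \<in> carrier N \<times> carrier N \<rightarrow>\<^sub>E Units A.
     (\<forall>m\<in>carrier N. \<forall>n\<in>carrier N. \<forall>k\<in>carrier N.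
        f (m \<otimes>\<^bsub>N\<^esub> n, k) \<otimes>\<^bsub>A\<^esub> \<phi> k (f (m, n)) = f (m, n \<otimes>\<^bsub>N\<^esub> k) \<otimes>\<^bsub>A\<^esub> f (n, k)) \<and>
     (\<forall>n\<in>carrier N. f (n, \<one>\<^bsub>N\<^esub>) = \<one>\<^bsub>A\<^esub> \<and> f (\<one>\<^bsub>N\<^esub>, n) = \<one>\<^bsub>A\<^esub>)}"

definition cohomologous ::
    "('a, 'c) monoid_scheme \<Rightarrow> ('b, 'd) monoid_scheme \<Rightarrow> ('b \<Rightarrow> 'a \<Rightarrow> 'a) \<Rightarrow>
     (('b \<times> 'b \<Rightarrow> 'a) \<times> ('b \<times> 'b \<Rightarrow> 'a)) set" where
  "cohomologous A N \<phi> = {(f, f'). f \<in> reg_cocycles2 A N \<phi> \<and> f' \<in> reg_cocycles2 A N \<phi> \<and>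
     (\<exists>\<tau> \<in> carrier N \<rightarrow> Units A. \<tau> \<one>\<^bsub>N\<^esub> = \<one>\<^bsub>A\<^esub> \<and>
        (\<forall>m\<in>carrier N. \<forall>n\<in>carrier N.
           f (m, n) \<otimes>\<^bsub>A\<^esub> \<tau> (m \<otimes>\<^bsub>N\<^esub> n) = f' (m, n) \<otimes>\<^bsub>A\<^esub> \<tau> n \<otimes>\<^bsub>A\<^esub> \<phi> n (\<tau> m)))}"

definition H2 ::
    "('a, 'c) monoid_scheme \<Rightarrow> ('b, 'd) monoid_scheme \<Rightarrow> ('b \<Rightarrow> 'a \<Rightarrow> 'a) \<Rightarrow>
     ('b \<times> 'b \<Rightarrow> 'a) set monoid" where
  "H2 A N \<phi> =
     \<lparr>carrier = reg_cocycles2 A N \<phi> // cohomologous A N \<phi>,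
      mult = (\<lambda>X Y. \<Union>f\<in>X. \<Union>g\<in>Y. cohomologous A N \<phi> ``
                {\<lambda>p\<in>carrier N \<times> carrier N. f p \<otimes>\<^bsub>A\<^esub> g p}),
      one = cohomologous A N \<phi> `` {\<lambda>p\<in>carrier N \<times> carrier N. \<one>\<^bsub>A\<^esub>}\<rparr>"

section \<open>The maps \<open>\<lambda>\<^sub>1\<close> and \<open>\<lambda>\<^sub>2\<close>\<close>

definition cocycle1 ::
    "('a, 'c) monoid_scheme \<Rightarrow> ('b, 'd) monoid_scheme \<Rightarrow> ('b \<Rightarrow> 'b \<Rightarrow> 'a) \<Rightarrow> ('a \<Rightarrow> 'a) \<Rightarrow>
     'b \<times> 'b \<Rightarrow> 'a" where
  "cocycle1 A N \<gamma> \<theta> = (\<lambda>(m, n)\<in>carrier N \<times> carrier N. \<gamma> m n \<otimes>\<^bsub>A\<^esub> inv\<^bsub>A\<^esub> \<theta> (\<gamma> m n))"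

definition cocycle2 ::
    "('a, 'c) monoid_scheme \<Rightarrow> ('b, 'd) monoid_scheme \<Rightarrow> ('b \<Rightarrow> 'b \<Rightarrow> 'a) \<Rightarrow> ('b \<Rightarrow> 'b) \<Rightarrow>
     'b \<times> 'b \<Rightarrow> 'a" where
  "cocycle2 A N \<gamma> \<eta> = (\<lambda>(m, n)\<in>carrier N \<times> carrier N. \<gamma> (\<eta> m) (\<eta> n) \<otimes>\<^bsub>A\<^esub> inv\<^bsub>A\<^esub> \<gamma> m n)"

definition lambda1 ::
    "('a, 'c) monoid_scheme \<Rightarrow> ('b, 'd) monoid_scheme \<Rightarrow> ('b \<Rightarrow> 'a \<Rightarrow> 'a) \<Rightarrow> ('b \<Rightarrow> 'b \<Rightarrow> 'a) \<Rightarrow>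
     ('a \<Rightarrow> 'a) \<Rightarrow> ('b \<times> 'b \<Rightarrow> 'a) set" where
  "lambda1 A N \<phi> \<gamma> \<theta> = cohomologous A N \<phi> `` {cocycle1 A N \<gamma> \<theta>}"

definition lambda2 ::
    "('a, 'c) monoid_scheme \<Rightarrow> ('b, 'd) monoid_scheme \<Rightarrow> ('b \<Rightarrow> 'a \<Rightarrow> 'a) \<Rightarrow> ('b \<Rightarrow> 'b \<Rightarrow> 'a) \<Rightarrow>
     ('b \<Rightarrow> 'b) \<Rightarrow> ('b \<times> 'b \<Rightarrow> 'a) set" where
  "lambda2 A N \<phi> \<gamma> \<eta> = cohomologous A N \<phi> `` {cocycle2 A N \<gamma> \<eta>}"

section \<open>Exactness\<close>

text \<open>Exactness of \<open>1 \<rightarrow> K \<rightarrow> G \<rightarrow> L \<rightarrow> H\<close>, where \<open>\<iota>: K \<rightarrow> G\<close> and \<open>\<rho>: G \<rightarrow> L\<close> are group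
  homomorphisms, whereas \<open>l: L \<rightarrow> H\<close> is merely a map into a set with base point \<open>\<one>\<^bsub>H\<^esub>\<close>.\<close>

definition exact_pointed ::
    "('k, 'p) monoid_scheme \<Rightarrow> ('k \<Rightarrow> 'g) \<Rightarrow> ('g, 'q) monoid_scheme \<Rightarrow> ('g \<Rightarrow> 'l) \<Rightarrow>
     ('l, 'r) monoid_scheme \<Rightarrow> ('l \<Rightarrow> 'h) \<Rightarrow> ('h, 's) monoid_scheme \<Rightarrow> bool" where
  "exact_pointed K \<iota> G \<rho> L l H \<longleftrightarrow>
     group K \<and> group G \<and> group L \<and>
     \<iota> \<in> mon K G \<and>
     \<rho> \<in> hom G L \<and> kernel G L \<rho> = \<iota> ` carrier K \<and>
     l \<in> carrier L \<rightarrow> carrier H \<and> \<one>\<^bsub>H\<^esub> \<in> carrier H \<and>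
     \<rho> ` carrier G = {x \<in> carrier L. l x = \<one>\<^bsub>H\<^esub>}"

end

theory Submission
  imports Defs
begin

text \<open>
  A cleavage \<open>\<kappa>\<close> gives coordinates on \<open>M\<close>: every element is uniquely \<open>\<kappa>(n)a\<close> with \<open>a\<close> in the kernel
  \<open>A\<close>, and \<open>\<kappa>(m)a \<cdot> \<kappa>(n)b = \<kappa>(mn) \<gamma>\<^sub>m\<^sub>,\<^sub>n \<phi>\<^sub>n(a) b\<close> (\<open>normal_form_mult\<close>). In a fibration every precartesian
  element is cartesian (\<open>Pcar_imp_cartesian\<close>), so products \<open>\<kappa>(m)\<kappa>(n)\<close> are precartesian and \<open>\<gamma>\<close> has
  invertible values; associativity of \<open>M\<close> then says that \<open>\<phi>\<close> is an action and \<open>\<gamma>\<close> a regular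
  two-cocycle.

  The core of the proof is the description of automorphisms in these coordinates. An automorphism
  \<open>\<psi>\<close> preserving \<open>A\<close> and the precartesian elements induces \<open>\<theta>\<close> on \<open>A\<close> and \<open>\<eta>\<close> on \<open>N\<close>, and \<open>\<psi>(\<kappa>(n))\<close> differs
  from \<open>\<kappa>(\<eta>(n))\<close> by a unit \<open>\<beta>(n)\<close> of \<open>A\<close>, so that \<open>\<psi>(\<kappa>(n)a) = \<kappa>(\<eta>(n))\<beta>(n)\<theta>(a)\<close>
  (\<open>ker_auto_is_twist\<close>). Conversely, such a formula defines an automorphism (\<open>twist_in_ker_auto\<close>)
  as soon as \<open>(\<theta>, \<eta>)\<close> is compatible with \<open>\<phi>\<close>, \<open>\<beta>(1) = 1\<close> and
  \<open>\<beta>(mn) \<theta>(\<gamma>\<^sub>m\<^sub>,\<^sub>n) = \<gamma>\<^sub>\<eta>\<^sub>(\<^sub>m\<^sub>)\<^sub>,\<^sub>\<eta>\<^sub>(\<^sub>n\<^sub>) \<phi>\<^sub>\<eta>\<^sub>(\<^sub>n\<^sub>)(\<beta>(m)) \<beta>(n)\<close>.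

  All exactness statements are read off from this equation. For \<open>\<theta> = id\<close> and \<open>\<eta> = id\<close> it says that \<open>\<beta>\<close> is a
  one-cocycle (\<open>twist_data_id_iff\<close>); for \<open>\<eta> = id\<close> it says that \<open>\<beta>\<close> trivialises \<open>\<gamma> \<theta>(\<gamma>)\<^sup>-\<^sup>1\<close>, and for \<open>\<theta> = id\<close>
  that \<open>\<beta>\<close> trivialises the quotient of \<open>\<gamma> \<circ> (\<eta> \<times> \<eta>)\<close> by \<open>\<gamma>\<close> (\<open>lambda1_trivial_iff\<close>, \<open>lambda2_trivial_iff\<close>).

  Another cleavage has the same action and a cohomologous factor set
  (\<open>factor_sets_cohomologous\<close>). As the obstruction cocycles arise from the factor set by operations
  that respect cohomology, their classes do not depend on the cleavage.
\<close>

section \<open>Automorphism groups of monoids\<close>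

lemma autoI:
  assumes "\<psi> \<in> extensional (carrier G)" "bij_betw \<psi> (carrier G) (carrier G)"
    and "\<And>x y. x \<in> carrier G \<Longrightarrow> y \<in> carrier G \<Longrightarrow> \<psi> (x \<otimes>\<^bsub>G\<^esub> y) = \<psi> x \<otimes>\<^bsub>G\<^esub> \<psi> y"
  shows "\<psi> \<in> auto G"
  using assms by (auto simp: auto_def Bij_def hom_def bij_betw_def)

lemma autoD:
  assumes "\<psi> \<in> auto G"
  shows auto_extensional: "\<psi> \<in> extensional (carrier G)"
    and auto_bij: "bij_betw \<psi> (carrier G) (carrier G)"
    and auto_closed: "x \<in> carrier G \<Longrightarrow> \<psi> x \<in> carrier G"
    and auto_mult: "x \<in> carrier G \<Longrightarrow> y \<in> carrier G \<Longrightarrow> \<psi> (x \<otimes>\<^bsub>G\<^esub> y) = \<psi> x \<otimes>\<^bsub>G\<^esub> \<psi> y"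
    and auto_inj: "x \<in> carrier G \<Longrightarrow> y \<in> carrier G \<Longrightarrow> \<psi> x = \<psi> y \<longleftrightarrow> x = y"
    and auto_surj: "z \<in> carrier G \<Longrightarrow> \<exists>x\<in>carrier G. z = \<psi> x"
  using assms by (auto simp: auto_def Bij_def hom_def bij_betw_def inj_on_def)

text \<open>The image of the unit is neutral on the image of the map, which is everything by surjectivity.\<close>

lemma (in monoid) auto_one:
  assumes "\<psi> \<in> auto G"
  shows "\<psi> \<one> = \<one>"
proof (rule one_unique)
  show "\<psi> \<one> \<in> carrier G"
    using assms by (simp add: auto_closed)
  show "\<psi> \<one> \<otimes> z = z" if z: "z \<in> carrier G" for z
  proof -
    obtain x where "x \<in> carrier G" "z = \<psi> x"
      using auto_surj[OF assms z] by blast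
    then show ?thesis
      using auto_mult[OF assms one_closed, of x] by simp
  qed
qed

lemma (in monoid) auto_id: "(\<lambda>x\<in>carrier G. x) \<in> auto G"
  by (intro autoI) (auto simp: bij_betw_def inj_on_def)

lemma (in monoid) auto_compose:
  assumes "f \<in> auto G" "g \<in> auto G"
  shows "compose (carrier G) f g \<in> auto G"
  using assms
  by (intro autoI) (auto simp: compose_eq autoD intro: bij_betw_compose auto_bij)

text \<open>The inverse map, made extensional as the membership in \<^const>\<open>auto\<close> demands.\<close>

definition auto_inv :: "('a, 'c) monoid_scheme \<Rightarrow> ('a \<Rightarrow> 'a) \<Rightarrow> 'a \<Rightarrow> 'a" where
  "auto_inv G \<psi> = restrict (inv_into (carrier G) \<psi>) (carrier G)"

lemma auto_inv_apply:
  assumes "\<psi> \<in> auto G" "x \<in> carrier G"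
  shows auto_inv_closed: "auto_inv G \<psi> x \<in> carrier G"
    and auto_auto_inv: "\<psi> (auto_inv G \<psi> x) = x"
    and auto_inv_auto: "auto_inv G \<psi> (\<psi> x) = x"
  using assms auto_bij[OF assms(1)]
  by (auto simp: auto_inv_def auto_closed bij_betw_def inv_into_into f_inv_into_f inv_into_f_f)

lemma (in monoid) auto_inv_in_auto:
  assumes "\<psi> \<in> auto G"
  shows "auto_inv G \<psi> \<in> auto G"
proof (rule autoI)
  show "auto_inv G \<psi> \<in> extensional (carrier G)"
    by (simp add: auto_inv_def)
  show "bij_betw (auto_inv G \<psi>) (carrier G) (carrier G)"
    using assms by (intro bij_betwI[where g = \<psi>]) (auto simp: auto_inv_apply auto_closed)
  show "auto_inv G \<psi> (x \<otimes> y) = auto_inv G \<psi> x \<otimes> auto_inv G \<psi> y"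
    if "x \<in> carrier G" "y \<in> carrier G" for x y
    using that assms auto_inv_closed[OF assms]
    by (subst auto_inj[OF assms, symmetric]) (simp_all add: auto_auto_inv auto_mult)
qed

lemma AutoGroup_simps:
  shows one_AutoGroup: "\<one>\<^bsub>AutoGroup G\<^esub> = (\<lambda>x\<in>carrier G. x)"
    and mult_AutoGroup: "f \<in> auto G \<Longrightarrow> g \<in> auto G \<Longrightarrow>
      f \<otimes>\<^bsub>AutoGroup G\<^esub> g = compose (carrier G) f g"
  by (auto simp: AutoGroup_def BijGroup_def auto_def)

lemma auto_inv_compose:
  assumes "\<psi> \<in> auto G"
  shows "compose (carrier G) (auto_inv G \<psi>) \<psi> = (\<lambda>x\<in>carrier G. x)"
  using assms by (auto simp: compose_def fun_eq_iff auto_inv_apply)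

text \<open>Associativity and the unit law are inherited from composition of maps, so \<open>G\<close> may be any
  monoid. The statement is about sets of automorphisms because all automorphism groups below are
  cut out of \<^const>\<open>auto\<close> by conditions stable under the three operations.\<close>

lemma (in monoid) group_of_automorphisms:
  assumes "H \<subseteq> auto G" "(\<lambda>x\<in>carrier G. x) \<in> H"
    and "\<And>f g. f \<in> H \<Longrightarrow> g \<in> H \<Longrightarrow> compose (carrier G) f g \<in> H"
    and "\<And>f. f \<in> H \<Longrightarrow> auto_inv G f \<in> H"
  shows "group (AutoGroup G\<lparr>carrier := H\<rparr>)"
proof (rule groupI)
  have H: "f \<in> auto G" if "f \<in> H" for f
    using assms(1) that by blast
  show "f \<otimes>\<^bsub>AutoGroup G\<lparr>carrier := H\<rparr>\<^esub> g \<in> carrier (AutoGroup G\<lparr>carrier := H\<rparr>)"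
    if "f \<in> carrier (AutoGroup G\<lparr>carrier := H\<rparr>)" "g \<in> carrier (AutoGroup G\<lparr>carrier := H\<rparr>)" for f g
    using that assms(3) by (simp add: H mult_AutoGroup)
  show "\<one>\<^bsub>AutoGroup G\<lparr>carrier := H\<rparr>\<^esub> \<in> carrier (AutoGroup G\<lparr>carrier := H\<rparr>)"
    using assms(2) by (simp add: one_AutoGroup)
  show "f \<otimes>\<^bsub>AutoGroup G\<lparr>carrier := H\<rparr>\<^esub> g \<otimes>\<^bsub>AutoGroup G\<lparr>carrier := H\<rparr>\<^esub> h =
      f \<otimes>\<^bsub>AutoGroup G\<lparr>carrier := H\<rparr>\<^esub> (g \<otimes>\<^bsub>AutoGroup G\<lparr>carrier := H\<rparr>\<^esub> h)"
    if "f \<in> carrier (AutoGroup G\<lparr>carrier := H\<rparr>)" "g \<in> carrier (AutoGroup G\<lparr>carrier := H\<rparr>)"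
      "h \<in> carrier (AutoGroup G\<lparr>carrier := H\<rparr>)" for f g h
    using that
    by (simp add: H mult_AutoGroup auto_compose) (simp add: H compose_def fun_eq_iff auto_closed)
  show "\<one>\<^bsub>AutoGroup G\<lparr>carrier := H\<rparr>\<^esub> \<otimes>\<^bsub>AutoGroup G\<lparr>carrier := H\<rparr>\<^esub> f = f"
    if "f \<in> carrier (AutoGroup G\<lparr>carrier := H\<rparr>)" for f
    using that autoD(1)[OF H, of f]
    by (auto simp: one_AutoGroup mult_AutoGroup auto_id H compose_def fun_eq_iff auto_closed
        extensional_def)
  show "\<exists>g\<in>carrier (AutoGroup G\<lparr>carrier := H\<rparr>). g \<otimes>\<^bsub>AutoGroup G\<lparr>carrier := H\<rparr>\<^esub> f =
      \<one>\<^bsub>AutoGroup G\<lparr>carrier := H\<rparr>\<^esub>"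
    if "f \<in> carrier (AutoGroup G\<lparr>carrier := H\<rparr>)" for f
    using that assms(4)[of f]
    by (intro bexI[of _ "auto_inv G f"])
      (simp_all add: one_AutoGroup mult_AutoGroup H auto_inv_in_auto auto_inv_compose)
qed

section \<open>Units of commutative monoids\<close>

lemma (in comm_monoid) Units_m_inv:
  assumes "a \<in> Units G" "b \<in> Units G"
  shows "inv (a \<otimes> b) = inv a \<otimes> inv b"
  using assms comm_group.inv_mult[OF units_comm_group, of a b]
  by (simp add: units_of_inv units_of_carrier units_of_mult)

lemma (in comm_monoid) divide_eq_divide_iff:
  assumes "a \<in> carrier G" "c \<in> carrier G" "b \<in> Units G" "d \<in> Units G"
  shows "a \<otimes> inv b = c \<otimes> inv d \<longleftrightarrow> a \<otimes> d = c \<otimes> b"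
proof -
  have bd: "b \<in> carrier G" "d \<in> carrier G" "inv b \<in> carrier G" "inv d \<in> carrier G"
    using assms by auto
  have "a \<otimes> inv b = c \<otimes> inv d \<longleftrightarrow> (b \<otimes> d) \<otimes> (a \<otimes> inv b) = (b \<otimes> d) \<otimes> (c \<otimes> inv d)"
    using assms bd by (intro Units_l_cancel[symmetric]) auto
  also have "(b \<otimes> d) \<otimes> (a \<otimes> inv b) = a \<otimes> d \<otimes> (b \<otimes> inv b)"
    using assms(1-2) bd by (simp only: m_ac m_closed)
  also have "(b \<otimes> d) \<otimes> (c \<otimes> inv d) = c \<otimes> b \<otimes> (d \<otimes> inv d)"
    using assms(1-2) bd by (simp only: m_ac m_closed)
  finally show ?thesis
    using assms bd by simp
qed

lemma (in comm_monoid) eq_divide_iff: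
  assumes "a \<in> carrier G" "c \<in> carrier G" "d \<in> Units G"
  shows "a = c \<otimes> inv d \<longleftrightarrow> a \<otimes> d = c"
  using divide_eq_divide_iff[of a c \<one> d] assms by simp

lemma (in comm_monoid) divide_mult_divide:
  assumes "a \<in> carrier G" "c \<in> carrier G" "b \<in> Units G" "d \<in> Units G"
  shows "(a \<otimes> inv b) \<otimes> (c \<otimes> inv d) = (a \<otimes> c) \<otimes> inv (b \<otimes> d)"
  using assms by (simp add: Units_m_inv m_ac Units_closed)

section \<open>Cocycles for a monoid acting on a commutative monoid\<close>

text \<open>The action is a right action, \<open>\<phi>\<^sub>m\<^sub>n = \<phi>\<^sub>n \<phi>\<^sub>m\<close>, by monoid endomorphisms, although the acting element
  is written first.\<close>

locale monoid_action = A: comm_monoid A + N: monoid N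
  for A :: "('a, 'c) monoid_scheme" and N :: "('b, 'd) monoid_scheme" +
  fixes \<phi> :: "'b \<Rightarrow> 'a \<Rightarrow> 'a"
  assumes act_closed: "n \<in> carrier N \<Longrightarrow> a \<in> carrier A \<Longrightarrow> \<phi> n a \<in> carrier A"
    and act_mult: "n \<in> carrier N \<Longrightarrow> a \<in> carrier A \<Longrightarrow> b \<in> carrier A \<Longrightarrow>
      \<phi> n (a \<otimes>\<^bsub>A\<^esub> b) = \<phi> n a \<otimes>\<^bsub>A\<^esub> \<phi> n b"
    and act_one: "n \<in> carrier N \<Longrightarrow> \<phi> n \<one>\<^bsub>A\<^esub> = \<one>\<^bsub>A\<^esub>"
    and act_comp: "m \<in> carrier N \<Longrightarrow> n \<in> carrier N \<Longrightarrow> a \<in> carrier A \<Longrightarrow>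
      \<phi> (m \<otimes>\<^bsub>N\<^esub> n) a = \<phi> n (\<phi> m a)"
    and one_act: "a \<in> carrier A \<Longrightarrow> \<phi> \<one>\<^bsub>N\<^esub> a = a"
begin

lemma act_Units:
  assumes "n \<in> carrier N" "a \<in> Units A"
  shows "\<phi> n a \<in> Units A" and "\<phi> n (inv\<^bsub>A\<^esub> a) = inv\<^bsub>A\<^esub> \<phi> n a"
proof -
  have c: "a \<in> carrier A" "inv\<^bsub>A\<^esub> a \<in> carrier A"
    using assms by auto
  have *: "\<phi> n (inv\<^bsub>A\<^esub> a) \<otimes>\<^bsub>A\<^esub> \<phi> n a = \<one>\<^bsub>A\<^esub>"
    using assms c by (simp flip: act_mult add: act_one)
  then show u: "\<phi> n a \<in> Units A"
    using assms c A.m_comm[of "\<phi> n (inv\<^bsub>A\<^esub> a)" "\<phi> n a"]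
    unfolding Units_def by (auto simp: act_closed intro!: bexI[of _ "\<phi> n (inv\<^bsub>A\<^esub> a)"])
  show "\<phi> n (inv\<^bsub>A\<^esub> a) = inv\<^bsub>A\<^esub> \<phi> n a"
    by (rule A.inv_unique[OF *]) (use assms c u in \<open>auto simp: act_closed\<close>)
qed

subsection \<open>One-cocycles\<close>

lemma mem_Z1:
  "\<xi> \<in> carrier (Z1 A N \<phi>) \<longleftrightarrow> \<xi> \<in> extensional (carrier N) \<and>
     (\<forall>n\<in>carrier N. \<xi> n \<in> Units A) \<and>
     (\<forall>m\<in>carrier N. \<forall>n\<in>carrier N. \<xi> (m \<otimes>\<^bsub>N\<^esub> n) = \<phi> n (\<xi> m) \<otimes>\<^bsub>A\<^esub> \<xi> n)"
  by (auto simp: Z1_def PiE_def)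

text \<open>The cocycle identity at \<open>m = n = 1\<close> makes \<open>\<xi>(1)\<close> an idempotent, and it is a unit.\<close>

lemma Z1_one:
  assumes "\<xi> \<in> carrier (Z1 A N \<phi>)"
  shows "\<xi> \<one>\<^bsub>N\<^esub> = \<one>\<^bsub>A\<^esub>"
proof -
  have u: "\<xi> \<one>\<^bsub>N\<^esub> \<in> Units A"
    using assms by (simp add: mem_Z1)
  then have c: "\<xi> \<one>\<^bsub>N\<^esub> \<in> carrier A"
    by (rule A.Units_closed)
  have "\<xi> (\<one>\<^bsub>N\<^esub> \<otimes>\<^bsub>N\<^esub> \<one>\<^bsub>N\<^esub>) = \<phi> \<one>\<^bsub>N\<^esub> (\<xi> \<one>\<^bsub>N\<^esub>) \<otimes>\<^bsub>A\<^esub> \<xi> \<one>\<^bsub>N\<^esub>"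
    using assms N.one_closed unfolding mem_Z1 by blast
  then have "\<xi> \<one>\<^bsub>N\<^esub> \<otimes>\<^bsub>A\<^esub> \<xi> \<one>\<^bsub>N\<^esub> = \<xi> \<one>\<^bsub>N\<^esub> \<otimes>\<^bsub>A\<^esub> \<one>\<^bsub>A\<^esub>"
    using c by (simp add: one_act)
  then show ?thesis
    using u c A.Units_l_cancel by blast
qed

lemma group_Z1: "group (Z1 A N \<phi>)"
proof (rule groupI)
  note Z1_carrier = A.Units_closed
  show "\<xi> \<otimes>\<^bsub>Z1 A N \<phi>\<^esub> \<zeta> \<in> carrier (Z1 A N \<phi>)"
    if "\<xi> \<in> carrier (Z1 A N \<phi>)" "\<zeta> \<in> carrier (Z1 A N \<phi>)" for \<xi> \<zeta>
    using that unfolding mem_Z1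
    by (simp add: Z1_def act_mult act_closed Z1_carrier A.m_ac)
  show "\<one>\<^bsub>Z1 A N \<phi>\<^esub> \<in> carrier (Z1 A N \<phi>)"
    unfolding mem_Z1 by (simp add: Z1_def act_one)
  show "\<xi> \<otimes>\<^bsub>Z1 A N \<phi>\<^esub> \<zeta> \<otimes>\<^bsub>Z1 A N \<phi>\<^esub> \<omega> = \<xi> \<otimes>\<^bsub>Z1 A N \<phi>\<^esub> (\<zeta> \<otimes>\<^bsub>Z1 A N \<phi>\<^esub> \<omega>)"
    if "\<xi> \<in> carrier (Z1 A N \<phi>)" "\<zeta> \<in> carrier (Z1 A N \<phi>)" "\<omega> \<in> carrier (Z1 A N \<phi>)" for \<xi> \<zeta> \<omega>
    using that unfolding mem_Z1
    by (auto simp: Z1_def Z1_carrier A.m_assoc fun_eq_iff)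
  show "\<one>\<^bsub>Z1 A N \<phi>\<^esub> \<otimes>\<^bsub>Z1 A N \<phi>\<^esub> \<xi> = \<xi>" if "\<xi> \<in> carrier (Z1 A N \<phi>)" for \<xi>
    using that unfolding mem_Z1
    by (auto simp: Z1_def Z1_carrier fun_eq_iff extensional_def)
  show "\<exists>\<zeta>\<in>carrier (Z1 A N \<phi>). \<zeta> \<otimes>\<^bsub>Z1 A N \<phi>\<^esub> \<xi> = \<one>\<^bsub>Z1 A N \<phi>\<^esub>"
    if "\<xi> \<in> carrier (Z1 A N \<phi>)" for \<xi>
  proof (rule bexI)
    show "(\<lambda>n\<in>carrier N. inv\<^bsub>A\<^esub> \<xi> n) \<in> carrier (Z1 A N \<phi>)"
      using that unfolding mem_Z1 by (simp add: act_Units A.Units_m_inv)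
    show "(\<lambda>n\<in>carrier N. inv\<^bsub>A\<^esub> \<xi> n) \<otimes>\<^bsub>Z1 A N \<phi>\<^esub> \<xi> = \<one>\<^bsub>Z1 A N \<phi>\<^esub>"
      using that unfolding mem_Z1 by (auto simp: Z1_def fun_eq_iff)
  qed
qed

subsection \<open>Regular two-cocycles and their equivalence\<close>

lemma mem_reg_cocycles2:
  "f \<in> reg_cocycles2 A N \<phi> \<longleftrightarrow> f \<in> extensional (carrier N \<times> carrier N) \<and>
     (\<forall>m\<in>carrier N. \<forall>n\<in>carrier N. f (m, n) \<in> Units A) \<and>
     (\<forall>m\<in>carrier N. \<forall>n\<in>carrier N. \<forall>k\<in>carrier N.
        f (m \<otimes>\<^bsub>N\<^esub> n, k) \<otimes>\<^bsub>A\<^esub> \<phi> k (f (m, n)) = f (m, n \<otimes>\<^bsub>N\<^esub> k) \<otimes>\<^bsub>A\<^esub> f (n, k)) \<and>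
     (\<forall>n\<in>carrier N. f (n, \<one>\<^bsub>N\<^esub>) = \<one>\<^bsub>A\<^esub> \<and> f (\<one>\<^bsub>N\<^esub>, n) = \<one>\<^bsub>A\<^esub>)"
  by (auto simp: reg_cocycles2_def PiE_def)

text \<open>Each of the two obstruction cocycles is a quotient of the factor set and a transport of it; this
  lemma reduces their cocycle identities to that of the factor set.\<close>

lemma reg_cocycles2_divide:
  assumes "f \<in> reg_cocycles2 A N \<phi>" "g \<in> reg_cocycles2 A N \<phi>"
  shows "(\<lambda>p\<in>carrier N \<times> carrier N. f p \<otimes>\<^bsub>A\<^esub> inv\<^bsub>A\<^esub> g p) \<in> reg_cocycles2 A N \<phi>"
  unfolding mem_reg_cocycles2
proof (intro conjI ballI)
  fix m n k
  assume mnk: "m \<in> carrier N" "n \<in> carrier N" "k \<in> carrier N"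
  let ?q = "\<lambda>p\<in>carrier N \<times> carrier N. f p \<otimes>\<^bsub>A\<^esub> inv\<^bsub>A\<^esub> g p"
  have u: "f (i, j) \<in> Units A" "g (i, j) \<in> Units A"
    "f (i, j) \<in> carrier A" "g (i, j) \<in> carrier A"
    if "i \<in> carrier N" "j \<in> carrier N" for i j
    using assms that by (simp_all add: mem_reg_cocycles2 A.Units_closed)
  have "?q (m \<otimes>\<^bsub>N\<^esub> n, k) \<otimes>\<^bsub>A\<^esub> \<phi> k (?q (m, n)) =
      (f (m \<otimes>\<^bsub>N\<^esub> n, k) \<otimes>\<^bsub>A\<^esub> \<phi> k (f (m, n))) \<otimes>\<^bsub>A\<^esub> inv\<^bsub>A\<^esub> (g (m \<otimes>\<^bsub>N\<^esub> n, k) \<otimes>\<^bsub>A\<^esub> \<phi> k (g (m, n)))"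
    using mnk u by (simp add: act_mult act_Units act_closed A.divide_mult_divide)
  also have "\<dots> = (f (m, n \<otimes>\<^bsub>N\<^esub> k) \<otimes>\<^bsub>A\<^esub> f (n, k)) \<otimes>\<^bsub>A\<^esub> inv\<^bsub>A\<^esub> (g (m, n \<otimes>\<^bsub>N\<^esub> k) \<otimes>\<^bsub>A\<^esub> g (n, k))"
    using assms mnk by (simp add: mem_reg_cocycles2)
  also have "\<dots> = ?q (m, n \<otimes>\<^bsub>N\<^esub> k) \<otimes>\<^bsub>A\<^esub> ?q (n, k)"
    using mnk u by (simp add: A.divide_mult_divide)
  finally show "?q (m \<otimes>\<^bsub>N\<^esub> n, k) \<otimes>\<^bsub>A\<^esub> \<phi> k (?q (m, n)) = ?q (m, n \<otimes>\<^bsub>N\<^esub> k) \<otimes>\<^bsub>A\<^esub> ?q (n, k)" .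
qed (use assms in \<open>simp_all add: mem_reg_cocycles2\<close>)

lemma trivial_reg_cocycle2:
  "(\<lambda>p\<in>carrier N \<times> carrier N. \<one>\<^bsub>A\<^esub>) \<in> reg_cocycles2 A N \<phi>"
  by (simp add: mem_reg_cocycles2 act_one)

lemma cohomologousI:
  assumes "f \<in> reg_cocycles2 A N \<phi>" "g \<in> reg_cocycles2 A N \<phi>"
    and "\<And>n. n \<in> carrier N \<Longrightarrow> \<tau> n \<in> Units A" "\<tau> \<one>\<^bsub>N\<^esub> = \<one>\<^bsub>A\<^esub>"
    and "\<And>m n. m \<in> carrier N \<Longrightarrow> n \<in> carrier N \<Longrightarrow>
      f (m, n) \<otimes>\<^bsub>A\<^esub> \<tau> (m \<otimes>\<^bsub>N\<^esub> n) = g (m, n) \<otimes>\<^bsub>A\<^esub> \<tau> n \<otimes>\<^bsub>A\<^esub> \<phi> n (\<tau> m)"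
  shows "(f, g) \<in> cohomologous A N \<phi>"
  unfolding cohomologous_def using assms by (intro CollectI case_prodI conjI bexI[of _ \<tau>]) auto

lemma cohomologousE:
  assumes "(f, g) \<in> cohomologous A N \<phi>"
  obtains \<tau> where "f \<in> reg_cocycles2 A N \<phi>" "g \<in> reg_cocycles2 A N \<phi>"
    and "\<And>n. n \<in> carrier N \<Longrightarrow> \<tau> n \<in> Units A" "\<tau> \<one>\<^bsub>N\<^esub> = \<one>\<^bsub>A\<^esub>"
    and "\<And>m n. m \<in> carrier N \<Longrightarrow> n \<in> carrier N \<Longrightarrow>
      f (m, n) \<otimes>\<^bsub>A\<^esub> \<tau> (m \<otimes>\<^bsub>N\<^esub> n) = g (m, n) \<otimes>\<^bsub>A\<^esub> \<tau> n \<otimes>\<^bsub>A\<^esub> \<phi> n (\<tau> m)"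
  using assms unfolding cohomologous_def by auto

lemma equiv_cohomologous: "equiv (reg_cocycles2 A N \<phi>) (cohomologous A N \<phi>)"
proof (rule equivI)
  note reg = mem_reg_cocycles2
  show "cohomologous A N \<phi> \<subseteq> reg_cocycles2 A N \<phi> \<times> reg_cocycles2 A N \<phi>"
    by (auto simp: cohomologous_def)
  show "refl_on (reg_cocycles2 A N \<phi>) (cohomologous A N \<phi>)"
  proof (rule refl_onI)
    fix f
    assume "f \<in> reg_cocycles2 A N \<phi>"
    then show "(f, f) \<in> cohomologous A N \<phi>"
      by (intro cohomologousI[where \<tau> = "\<lambda>_. \<one>\<^bsub>A\<^esub>"])
        (auto simp: act_one reg A.Units_closed)
  qed
  show "sym (cohomologous A N \<phi>)"
  proof (rule symI)
    fix f g
    assume "(f, g) \<in> cohomologous A N \<phi>"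
    then obtain \<tau> where fg: "f \<in> reg_cocycles2 A N \<phi>" "g \<in> reg_cocycles2 A N \<phi>"
      and \<tau>: "\<And>n. n \<in> carrier N \<Longrightarrow> \<tau> n \<in> Units A" "\<tau> \<one>\<^bsub>N\<^esub> = \<one>\<^bsub>A\<^esub>"
      and eq: "\<And>m n. m \<in> carrier N \<Longrightarrow> n \<in> carrier N \<Longrightarrow>
        f (m, n) \<otimes>\<^bsub>A\<^esub> \<tau> (m \<otimes>\<^bsub>N\<^esub> n) = g (m, n) \<otimes>\<^bsub>A\<^esub> \<tau> n \<otimes>\<^bsub>A\<^esub> \<phi> n (\<tau> m)"
      by (rule cohomologousE) blast
    show "(g, f) \<in> cohomologous A N \<phi>"
    proof (rule cohomologousI[where \<tau> = "\<lambda>n. inv\<^bsub>A\<^esub> \<tau> n"])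
      fix m n
      assume mn: "m \<in> carrier N" "n \<in> carrier N"
      then have c: "f (m, n) \<in> carrier A" "g (m, n) \<in> carrier A" "\<tau> m \<in> carrier A" "\<tau> n \<in> carrier A"
        "\<phi> n (\<tau> m) \<in> carrier A"
        using fg \<tau> by (auto simp: reg act_closed A.Units_closed)
      have "g (m, n) \<otimes>\<^bsub>A\<^esub> inv\<^bsub>A\<^esub> \<tau> (m \<otimes>\<^bsub>N\<^esub> n) = f (m, n) \<otimes>\<^bsub>A\<^esub> inv\<^bsub>A\<^esub> (\<tau> n \<otimes>\<^bsub>A\<^esub> \<phi> n (\<tau> m))"
        using mn c \<tau> by (subst A.divide_eq_divide_iff) (simp_all add: act_Units eq A.m_assoc)
      then show "g (m, n) \<otimes>\<^bsub>A\<^esub> inv\<^bsub>A\<^esub> \<tau> (m \<otimes>\<^bsub>N\<^esub> n) =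
          f (m, n) \<otimes>\<^bsub>A\<^esub> inv\<^bsub>A\<^esub> \<tau> n \<otimes>\<^bsub>A\<^esub> \<phi> n (inv\<^bsub>A\<^esub> \<tau> m)"
        using mn c \<tau> by (simp add: act_Units A.Units_m_inv A.m_assoc)
    qed (use fg \<tau> in auto)
  qed
  show "trans (cohomologous A N \<phi>)"
  proof (rule transI)
    fix f g h
    assume "(f, g) \<in> cohomologous A N \<phi>"
    then obtain \<tau> where fg: "f \<in> reg_cocycles2 A N \<phi>" "g \<in> reg_cocycles2 A N \<phi>"
      and \<tau>: "\<And>n. n \<in> carrier N \<Longrightarrow> \<tau> n \<in> Units A" "\<tau> \<one>\<^bsub>N\<^esub> = \<one>\<^bsub>A\<^esub>"
      and eq: "\<And>m n. m \<in> carrier N \<Longrightarrow> n \<in> carrier N \<Longrightarrow>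
        f (m, n) \<otimes>\<^bsub>A\<^esub> \<tau> (m \<otimes>\<^bsub>N\<^esub> n) = g (m, n) \<otimes>\<^bsub>A\<^esub> \<tau> n \<otimes>\<^bsub>A\<^esub> \<phi> n (\<tau> m)"
      by (rule cohomologousE) blast
    assume "(g, h) \<in> cohomologous A N \<phi>"
    then obtain \<tau>' where h: "h \<in> reg_cocycles2 A N \<phi>"
      and \<tau>': "\<And>n. n \<in> carrier N \<Longrightarrow> \<tau>' n \<in> Units A" "\<tau>' \<one>\<^bsub>N\<^esub> = \<one>\<^bsub>A\<^esub>"
      and eq': "\<And>m n. m \<in> carrier N \<Longrightarrow> n \<in> carrier N \<Longrightarrow>
        g (m, n) \<otimes>\<^bsub>A\<^esub> \<tau>' (m \<otimes>\<^bsub>N\<^esub> n) = h (m, n) \<otimes>\<^bsub>A\<^esub> \<tau>' n \<otimes>\<^bsub>A\<^esub> \<phi> n (\<tau>' m)"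
      by (rule cohomologousE) blast
    show "(f, h) \<in> cohomologous A N \<phi>"
    proof (rule cohomologousI[where \<tau> = "\<lambda>n. \<tau> n \<otimes>\<^bsub>A\<^esub> \<tau>' n"])
      fix m n
      assume mn: "m \<in> carrier N" "n \<in> carrier N"
      have c: "f (m, n) \<in> carrier A" "g (m, n) \<in> carrier A" "h (m, n) \<in> carrier A"
        "\<tau> m \<in> carrier A" "\<tau> n \<in> carrier A" "\<phi> n (\<tau> m) \<in> carrier A" "\<tau> (m \<otimes>\<^bsub>N\<^esub> n) \<in> carrier A"
        "\<tau>' m \<in> carrier A" "\<tau>' n \<in> carrier A" "\<phi> n (\<tau>' m) \<in> carrier A" "\<tau>' (m \<otimes>\<^bsub>N\<^esub> n) \<in> carrier A"
        using fg h \<tau> \<tau>' mn by (auto simp: reg act_closed A.Units_closed)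
      have "f (m, n) \<otimes>\<^bsub>A\<^esub> (\<tau> (m \<otimes>\<^bsub>N\<^esub> n) \<otimes>\<^bsub>A\<^esub> \<tau>' (m \<otimes>\<^bsub>N\<^esub> n)) =
          (f (m, n) \<otimes>\<^bsub>A\<^esub> \<tau> (m \<otimes>\<^bsub>N\<^esub> n)) \<otimes>\<^bsub>A\<^esub> \<tau>' (m \<otimes>\<^bsub>N\<^esub> n)"
        using c by (simp add: A.m_assoc)
      also have "\<dots> = (g (m, n) \<otimes>\<^bsub>A\<^esub> \<tau>' (m \<otimes>\<^bsub>N\<^esub> n)) \<otimes>\<^bsub>A\<^esub> (\<tau> n \<otimes>\<^bsub>A\<^esub> \<phi> n (\<tau> m))"
        using c by (simp add: eq[OF mn] A.m_ac)
      finally show "f (m, n) \<otimes>\<^bsub>A\<^esub> (\<tau> (m \<otimes>\<^bsub>N\<^esub> n) \<otimes>\<^bsub>A\<^esub> \<tau>' (m \<otimes>\<^bsub>N\<^esub> n)) =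
          h (m, n) \<otimes>\<^bsub>A\<^esub> (\<tau> n \<otimes>\<^bsub>A\<^esub> \<tau>' n) \<otimes>\<^bsub>A\<^esub> \<phi> n (\<tau> m \<otimes>\<^bsub>A\<^esub> \<tau>' m)"
        using c mn by (simp add: eq' act_mult A.m_ac)
    qed (use fg h \<tau> \<tau>' in auto)
  qed
qed

lemma one_H2_closed: "\<one>\<^bsub>H2 A N \<phi>\<^esub> \<in> carrier (H2 A N \<phi>)"
  unfolding H2_def using trivial_reg_cocycle2 by (simp add: quotientI)

text \<open>The relation is read from the constant cocycle to \<open>f\<close>, not the other way round: in this
  direction the equation for \<open>\<tau>\<close> is the one that the unit \<open>\<beta>(n)\<close> in the normal form of an
  automorphism satisfies.\<close>

lemma class_eq_one_H2_iff:
  assumes "f \<in> reg_cocycles2 A N \<phi>"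
  shows "cohomologous A N \<phi> `` {f} = \<one>\<^bsub>H2 A N \<phi>\<^esub> \<longleftrightarrow>
    (\<exists>\<tau>. (\<forall>n\<in>carrier N. \<tau> n \<in> Units A) \<and> \<tau> \<one>\<^bsub>N\<^esub> = \<one>\<^bsub>A\<^esub> \<and>
      (\<forall>m\<in>carrier N. \<forall>n\<in>carrier N. \<tau> (m \<otimes>\<^bsub>N\<^esub> n) = f (m, n) \<otimes>\<^bsub>A\<^esub> \<tau> n \<otimes>\<^bsub>A\<^esub> \<phi> n (\<tau> m)))"
    (is "?l \<longleftrightarrow> ?r")
proof -
  let ?e = "\<lambda>p\<in>carrier N \<times> carrier N. \<one>\<^bsub>A\<^esub>"
  have "?l \<longleftrightarrow> (?e, f) \<in> cohomologous A N \<phi>"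
    using eq_equiv_class_iff[OF equiv_cohomologous trivial_reg_cocycle2 assms]
    by (auto simp: H2_def)
  also have "\<dots> \<longleftrightarrow> ?r"
  proof
    assume "(?e, f) \<in> cohomologous A N \<phi>"
    then show ?r
    proof (rule cohomologousE)
      fix \<tau>
      assume \<tau>: "\<And>n. n \<in> carrier N \<Longrightarrow> \<tau> n \<in> Units A" "\<tau> \<one>\<^bsub>N\<^esub> = \<one>\<^bsub>A\<^esub>"
        and "\<And>m n. m \<in> carrier N \<Longrightarrow> n \<in> carrier N \<Longrightarrow>
          ?e (m, n) \<otimes>\<^bsub>A\<^esub> \<tau> (m \<otimes>\<^bsub>N\<^esub> n) = f (m, n) \<otimes>\<^bsub>A\<^esub> \<tau> n \<otimes>\<^bsub>A\<^esub> \<phi> n (\<tau> m)"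
      then show ?r
        by (intro exI[of _ \<tau>]) (simp add: A.Units_closed)
    qed
  next
    assume ?r
    then obtain \<tau> where "\<forall>n\<in>carrier N. \<tau> n \<in> Units A" "\<tau> \<one>\<^bsub>N\<^esub> = \<one>\<^bsub>A\<^esub>"
      "\<forall>m\<in>carrier N. \<forall>n\<in>carrier N. \<tau> (m \<otimes>\<^bsub>N\<^esub> n) = f (m, n) \<otimes>\<^bsub>A\<^esub> \<tau> n \<otimes>\<^bsub>A\<^esub> \<phi> n (\<tau> m)"
      by blast
    then show "(?e, f) \<in> cohomologous A N \<phi>"
      using trivial_reg_cocycle2 assms
      by (intro cohomologousI[where \<tau> = \<tau>])
        (auto simp: mem_reg_cocycles2 A.Units_closed act_closed)
  qed
  finally show ?thesis .
qed

subsection \<open>Compatible automorphisms\<close>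

text \<open>For commutative \<open>A\<close> the unit \<open>\<alpha>(n)\<close> occurring in the definition of a compatible pair
  cancels, so that only equivariance is left.\<close>

lemma compat_pairs_iff:
  "(\<theta>, \<eta>) \<in> compat_pairs A N \<phi> \<longleftrightarrow> \<theta> \<in> auto A \<and> \<eta> \<in> auto N \<and>
     (\<forall>n\<in>carrier N. \<forall>a\<in>carrier A. \<phi> (\<eta> n) (\<theta> a) = \<theta> (\<phi> n a))"
proof (cases "\<theta> \<in> auto A \<and> \<eta> \<in> auto N")
  case True
  then have c: "\<phi> (\<eta> n) (\<theta> a) \<in> carrier A" "\<theta> (\<phi> n a) \<in> carrier A"
    if "n \<in> carrier N" "a \<in> carrier A" for n a
    using that by (auto simp: auto_closed act_closed)
  have "\<phi> (\<eta> n) (\<theta> a) \<otimes>\<^bsub>A\<^esub> u = u \<otimes>\<^bsub>A\<^esub> \<theta> (\<phi> n a) \<longleftrightarrow> \<phi> (\<eta> n) (\<theta> a) = \<theta> (\<phi> n a)"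
    if "n \<in> carrier N" "a \<in> carrier A" "u \<in> Units A" for n a u
    using c[OF that(1,2)] that(3) by (simp add: A.m_comm[of _ u] A.Units_closed)
  then show ?thesis
    using True unfolding compat_pairs_def
    by (auto simp: Pi_iff intro!: bexI[of _ "\<lambda>_. \<one>\<^bsub>A\<^esub>"])
qed (auto simp: compat_pairs_def)

lemma mem_C1:
  "\<theta> \<in> carrier (C1 A N \<phi>) \<longleftrightarrow> \<theta> \<in> auto A \<and>
     (\<forall>n\<in>carrier N. \<forall>a\<in>carrier A. \<phi> n (\<theta> a) = \<theta> (\<phi> n a))"
  by (auto simp: C1_def compat_pairs_iff N.auto_id)

lemma mem_C2:
  "\<eta> \<in> carrier (C2 A N \<phi>) \<longleftrightarrow> \<eta> \<in> auto N \<and>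
     (\<forall>n\<in>carrier N. \<forall>a\<in>carrier A. \<phi> (\<eta> n) a = \<phi> n a)"
  by (auto simp: C2_def compat_pairs_iff A.auto_id act_closed)

lemma group_C1: "group (C1 A N \<phi>)"
proof -
  have "group (AutoGroup A\<lparr>carrier := carrier (C1 A N \<phi>)\<rparr>)"
  proof (rule A.group_of_automorphisms)
    show "auto_inv A \<theta> \<in> carrier (C1 A N \<phi>)" if "\<theta> \<in> carrier (C1 A N \<phi>)" for \<theta>
    proof -
      have \<theta>: "\<theta> \<in> auto A" and comm: "\<And>n a. n \<in> carrier N \<Longrightarrow> a \<in> carrier A \<Longrightarrow> \<theta> (\<phi> n a) = \<phi> n (\<theta> a)"
        using that by (auto simp: mem_C1)
      have "\<phi> n (auto_inv A \<theta> a) = auto_inv A \<theta> (\<phi> n a)" if "n \<in> carrier N" "a \<in> carrier A" for n a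
        using that \<theta> auto_inv_closed[OF \<theta>]
        by (subst auto_inj[OF \<theta>, symmetric]) (simp_all add: auto_auto_inv act_closed comm)
      with \<theta> show ?thesis
        by (simp add: mem_C1 A.auto_inv_in_auto)
    qed
  qed (auto simp: mem_C1 A.auto_id A.auto_compose compose_eq act_closed auto_closed)
  then show ?thesis
    by (simp add: C1_def)
qed

lemma group_C2: "group (C2 A N \<phi>)"
proof -
  have "group (AutoGroup N\<lparr>carrier := carrier (C2 A N \<phi>)\<rparr>)"
  proof (rule N.group_of_automorphisms)
    show "auto_inv N \<eta> \<in> carrier (C2 A N \<phi>)" if "\<eta> \<in> carrier (C2 A N \<phi>)" for \<eta>
    proof -
      have \<eta>: "\<eta> \<in> auto N" and inv: "\<And>n a. n \<in> carrier N \<Longrightarrow> a \<in> carrier A \<Longrightarrow> \<phi> (\<eta> n) a = \<phi> n a"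
        using that by (auto simp: mem_C2)
      have "\<phi> (auto_inv N \<eta> n) a = \<phi> n a" if "n \<in> carrier N" "a \<in> carrier A" for n a
        using inv[of "auto_inv N \<eta> n" a] that \<eta> by (simp add: auto_inv_apply)
      with \<eta> show ?thesis
        by (simp add: mem_C2 N.auto_inv_in_auto)
    qed
  qed (auto simp: mem_C2 N.auto_id N.auto_compose compose_eq act_closed auto_closed)
  then show ?thesis
    by (simp add: C2_def)
qed

subsection \<open>Functoriality of two-cocycles\<close>

text \<open>The quotient of the cochains relates the quotients of the cocycles. Together with the next lemmas
  this makes the classes of the obstruction cocycles depend only on the class of the factor set.\<close>

lemma cohomologous_divide:
  assumes "(f, f') \<in> cohomologous A N \<phi>" "(g, g') \<in> cohomologous A N \<phi>"
  shows "(\<lambda>p\<in>carrier N \<times> carrier N. f p \<otimes>\<^bsub>A\<^esub> inv\<^bsub>A\<^esub> g p,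
      \<lambda>p\<in>carrier N \<times> carrier N. f' p \<otimes>\<^bsub>A\<^esub> inv\<^bsub>A\<^esub> g' p) \<in> cohomologous A N \<phi>"
proof -
  note reg = mem_reg_cocycles2
  obtain \<tau> where f: "f \<in> reg_cocycles2 A N \<phi>" "f' \<in> reg_cocycles2 A N \<phi>"
    and \<tau>: "\<And>n. n \<in> carrier N \<Longrightarrow> \<tau> n \<in> Units A" "\<tau> \<one>\<^bsub>N\<^esub> = \<one>\<^bsub>A\<^esub>"
    and f_eq: "\<And>m n. m \<in> carrier N \<Longrightarrow> n \<in> carrier N \<Longrightarrow>
      f (m, n) \<otimes>\<^bsub>A\<^esub> \<tau> (m \<otimes>\<^bsub>N\<^esub> n) = f' (m, n) \<otimes>\<^bsub>A\<^esub> \<tau> n \<otimes>\<^bsub>A\<^esub> \<phi> n (\<tau> m)"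
    using assms(1) by (rule cohomologousE) blast
  obtain \<upsilon> where g: "g \<in> reg_cocycles2 A N \<phi>" "g' \<in> reg_cocycles2 A N \<phi>"
    and \<upsilon>: "\<And>n. n \<in> carrier N \<Longrightarrow> \<upsilon> n \<in> Units A" "\<upsilon> \<one>\<^bsub>N\<^esub> = \<one>\<^bsub>A\<^esub>"
    and g_eq: "\<And>m n. m \<in> carrier N \<Longrightarrow> n \<in> carrier N \<Longrightarrow>
      g (m, n) \<otimes>\<^bsub>A\<^esub> \<upsilon> (m \<otimes>\<^bsub>N\<^esub> n) = g' (m, n) \<otimes>\<^bsub>A\<^esub> \<upsilon> n \<otimes>\<^bsub>A\<^esub> \<phi> n (\<upsilon> m)"
    using assms(2) by (rule cohomologousE) blast
  show ?thesis
  proof (rule cohomologousI[where \<tau> = "\<lambda>n. \<tau> n \<otimes>\<^bsub>A\<^esub> inv\<^bsub>A\<^esub> \<upsilon> n"])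
    fix m n
    assume mn: "m \<in> carrier N" "n \<in> carrier N"
    have u: "f (m, n) \<in> Units A" "f' (m, n) \<in> Units A" "g (m, n) \<in> Units A" "g' (m, n) \<in> Units A"
      "\<tau> m \<in> Units A" "\<tau> n \<in> Units A" "\<phi> n (\<tau> m) \<in> Units A" "\<tau> (m \<otimes>\<^bsub>N\<^esub> n) \<in> Units A"
      "\<upsilon> m \<in> Units A" "\<upsilon> n \<in> Units A" "\<phi> n (\<upsilon> m) \<in> Units A" "\<upsilon> (m \<otimes>\<^bsub>N\<^esub> n) \<in> Units A"
      using f g \<tau> \<upsilon> mn by (simp_all add: reg act_Units)
    have "(f (m, n) \<otimes>\<^bsub>A\<^esub> inv\<^bsub>A\<^esub> g (m, n)) \<otimes>\<^bsub>A\<^esub> (\<tau> (m \<otimes>\<^bsub>N\<^esub> n) \<otimes>\<^bsub>A\<^esub> inv\<^bsub>A\<^esub> \<upsilon> (m \<otimes>\<^bsub>N\<^esub> n)) =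
        (f' (m, n) \<otimes>\<^bsub>A\<^esub> \<tau> n \<otimes>\<^bsub>A\<^esub> \<phi> n (\<tau> m)) \<otimes>\<^bsub>A\<^esub> inv\<^bsub>A\<^esub> (g' (m, n) \<otimes>\<^bsub>A\<^esub> \<upsilon> n \<otimes>\<^bsub>A\<^esub> \<phi> n (\<upsilon> m))"
      using u by (simp add: A.divide_mult_divide A.Units_closed f_eq[OF mn] g_eq[OF mn])
    also have "\<dots> = (f' (m, n) \<otimes>\<^bsub>A\<^esub> inv\<^bsub>A\<^esub> g' (m, n)) \<otimes>\<^bsub>A\<^esub> (\<tau> n \<otimes>\<^bsub>A\<^esub> inv\<^bsub>A\<^esub> \<upsilon> n) \<otimes>\<^bsub>A\<^esub>
        \<phi> n (\<tau> m \<otimes>\<^bsub>A\<^esub> inv\<^bsub>A\<^esub> \<upsilon> m)"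
      using u mn by (simp add: A.divide_mult_divide A.Units_closed act_mult act_Units)
    finally show "(\<lambda>p\<in>carrier N \<times> carrier N. f p \<otimes>\<^bsub>A\<^esub> inv\<^bsub>A\<^esub> g p) (m, n) \<otimes>\<^bsub>A\<^esub>
        (\<tau> (m \<otimes>\<^bsub>N\<^esub> n) \<otimes>\<^bsub>A\<^esub> inv\<^bsub>A\<^esub> \<upsilon> (m \<otimes>\<^bsub>N\<^esub> n)) =
        (\<lambda>p\<in>carrier N \<times> carrier N. f' p \<otimes>\<^bsub>A\<^esub> inv\<^bsub>A\<^esub> g' p) (m, n) \<otimes>\<^bsub>A\<^esub>
        (\<tau> n \<otimes>\<^bsub>A\<^esub> inv\<^bsub>A\<^esub> \<upsilon> n) \<otimes>\<^bsub>A\<^esub> \<phi> n (\<tau> m \<otimes>\<^bsub>A\<^esub> inv\<^bsub>A\<^esub> \<upsilon> m)"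
      using mn by simp
  qed (use f g \<tau> \<upsilon> in \<open>auto intro: reg_cocycles2_divide\<close>)
qed

lemma auto_Units:
  assumes "\<theta> \<in> auto A" "a \<in> Units A"
  shows "\<theta> a \<in> Units A"
proof -
  obtain b where "b \<in> carrier A" "b \<otimes>\<^bsub>A\<^esub> a = \<one>\<^bsub>A\<^esub>" "a \<otimes>\<^bsub>A\<^esub> b = \<one>\<^bsub>A\<^esub>"
    using assms(2) unfolding Units_def by blast
  then show ?thesis
    using assms A.auto_one[OF assms(1)]
    unfolding Units_def by (auto simp: auto_closed simp flip: auto_mult intro!: bexI[of _ "\<theta> b"])
qed

text \<open>An equivariant automorphism of \<open>A\<close> acts on cocycles through their values, and an automorphism of \<open>N\<close>
  that fixes the action acts through their arguments; both are compatible with the passage to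
  classes.\<close>

lemma reg_cocycles2_push:
  assumes "\<theta> \<in> carrier (C1 A N \<phi>)" "f \<in> reg_cocycles2 A N \<phi>"
  shows "(\<lambda>p\<in>carrier N \<times> carrier N. \<theta> (f p)) \<in> reg_cocycles2 A N \<phi>"
proof -
  have \<theta>: "\<theta> \<in> auto A" "\<And>n a. n \<in> carrier N \<Longrightarrow> a \<in> carrier A \<Longrightarrow> \<phi> n (\<theta> a) = \<theta> (\<phi> n a)"
    using assms(1) by (auto simp: mem_C1)
  then show ?thesis
    using assms(2) unfolding mem_reg_cocycles2
    by (simp add: auto_Units A.Units_closed act_closed A.auto_one flip: auto_mult)
qed

lemma cohomologous_push:
  assumes "\<theta> \<in> carrier (C1 A N \<phi>)" "(f, g) \<in> cohomologous A N \<phi>"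
  shows "(\<lambda>p\<in>carrier N \<times> carrier N. \<theta> (f p), \<lambda>p\<in>carrier N \<times> carrier N. \<theta> (g p)) \<in> cohomologous A N \<phi>"
proof -
  have \<theta>: "\<theta> \<in> auto A" "\<And>n a. n \<in> carrier N \<Longrightarrow> a \<in> carrier A \<Longrightarrow> \<phi> n (\<theta> a) = \<theta> (\<phi> n a)"
    using assms(1) by (auto simp: mem_C1)
  obtain \<tau> where fg: "f \<in> reg_cocycles2 A N \<phi>" "g \<in> reg_cocycles2 A N \<phi>"
    and \<tau>: "\<And>n. n \<in> carrier N \<Longrightarrow> \<tau> n \<in> Units A" "\<tau> \<one>\<^bsub>N\<^esub> = \<one>\<^bsub>A\<^esub>"
    and eq: "\<And>m n. m \<in> carrier N \<Longrightarrow> n \<in> carrier N \<Longrightarrow>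
      f (m, n) \<otimes>\<^bsub>A\<^esub> \<tau> (m \<otimes>\<^bsub>N\<^esub> n) = g (m, n) \<otimes>\<^bsub>A\<^esub> \<tau> n \<otimes>\<^bsub>A\<^esub> \<phi> n (\<tau> m)"
    using assms(2) by (rule cohomologousE) blast
  have c: "f (m, n) \<in> carrier A" "g (m, n) \<in> carrier A" if "m \<in> carrier N" "n \<in> carrier N" for m n
    using fg that by (simp_all add: mem_reg_cocycles2 A.Units_closed)
  show ?thesis
    by (rule cohomologousI[where \<tau> = "\<lambda>n. \<theta> (\<tau> n)"])
      (use assms(1) fg \<tau> \<theta> c in \<open>simp_all add: reg_cocycles2_push auto_Units A.auto_one
        A.Units_closed act_closed eq flip: auto_mult\<close>)
qed

lemma reg_cocycles2_pull:
  assumes "\<eta> \<in> carrier (C2 A N \<phi>)" "f \<in> reg_cocycles2 A N \<phi>"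
  shows "(\<lambda>(m, n)\<in>carrier N \<times> carrier N. f (\<eta> m, \<eta> n)) \<in> reg_cocycles2 A N \<phi>"
proof -
  have \<eta>: "\<eta> \<in> auto N" "\<And>n a. n \<in> carrier N \<Longrightarrow> a \<in> carrier A \<Longrightarrow> \<phi> (\<eta> n) a = \<phi> n a"
    using assms(1) by (auto simp: mem_C2)
  have "f (\<eta> (m \<otimes>\<^bsub>N\<^esub> n), \<eta> k) \<otimes>\<^bsub>A\<^esub> \<phi> k (f (\<eta> m, \<eta> n)) =
      f (\<eta> m, \<eta> (n \<otimes>\<^bsub>N\<^esub> k)) \<otimes>\<^bsub>A\<^esub> f (\<eta> n, \<eta> k)"
    if "m \<in> carrier N" "n \<in> carrier N" "k \<in> carrier N" for m n k
  proof -
    have "\<phi> k (f (\<eta> m, \<eta> n)) = \<phi> (\<eta> k) (f (\<eta> m, \<eta> n))"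
      using assms(2) that by (subst \<eta>(2)) (simp_all add: mem_reg_cocycles2 A.Units_closed auto_closed[OF \<eta>(1)])
    then show ?thesis
      using assms(2) that \<eta>(1) by (simp add: mem_reg_cocycles2 auto_mult auto_closed)
  qed
  then show ?thesis
    using \<eta>(1) assms(2) unfolding mem_reg_cocycles2
    by (simp add: auto_closed N.auto_one)
qed

lemma cohomologous_pull:
  assumes "\<eta> \<in> carrier (C2 A N \<phi>)" "(f, g) \<in> cohomologous A N \<phi>"
  shows "(\<lambda>(m, n)\<in>carrier N \<times> carrier N. f (\<eta> m, \<eta> n),
      \<lambda>(m, n)\<in>carrier N \<times> carrier N. g (\<eta> m, \<eta> n)) \<in> cohomologous A N \<phi>"
proof -
  have \<eta>: "\<eta> \<in> auto N" "\<And>n a. n \<in> carrier N \<Longrightarrow> a \<in> carrier A \<Longrightarrow> \<phi> (\<eta> n) a = \<phi> n a"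
    using assms(1) by (auto simp: mem_C2)
  obtain \<tau> where fg: "f \<in> reg_cocycles2 A N \<phi>" "g \<in> reg_cocycles2 A N \<phi>"
    and \<tau>: "\<And>n. n \<in> carrier N \<Longrightarrow> \<tau> n \<in> Units A" "\<tau> \<one>\<^bsub>N\<^esub> = \<one>\<^bsub>A\<^esub>"
    and eq: "\<And>m n. m \<in> carrier N \<Longrightarrow> n \<in> carrier N \<Longrightarrow>
      f (m, n) \<otimes>\<^bsub>A\<^esub> \<tau> (m \<otimes>\<^bsub>N\<^esub> n) = g (m, n) \<otimes>\<^bsub>A\<^esub> \<tau> n \<otimes>\<^bsub>A\<^esub> \<phi> n (\<tau> m)"
    using assms(2) by (rule cohomologousE) blast
  have "f (\<eta> m, \<eta> n) \<otimes>\<^bsub>A\<^esub> \<tau> (\<eta> (m \<otimes>\<^bsub>N\<^esub> n)) = g (\<eta> m, \<eta> n) \<otimes>\<^bsub>A\<^esub> \<tau> (\<eta> n) \<otimes>\<^bsub>A\<^esub> \<phi> n (\<tau> (\<eta> m))"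
    if "m \<in> carrier N" "n \<in> carrier N" for m n
  proof -
    have "\<phi> n (\<tau> (\<eta> m)) = \<phi> (\<eta> n) (\<tau> (\<eta> m))"
      using that by (subst \<eta>(2)) (simp_all add: \<tau> A.Units_closed auto_closed[OF \<eta>(1)])
    then show ?thesis
      using that \<eta>(1) by (simp add: auto_mult auto_closed eq)
  qed
  then show ?thesis
    by (intro cohomologousI[where \<tau> = "\<lambda>n. \<tau> (\<eta> n)"])
      (use assms(1) fg \<tau> \<eta>(1) in \<open>simp_all add: reg_cocycles2_pull N.auto_one auto_closed\<close>)
qed

end

subsection \<open>Dependence on the action\<close>

text \<open>The actions belonging to two cleavages agree on the carriers, but as functions they may differ
  outside, where the definite descriptions defining them have no meaning.\<close>

context
  fixes A :: "('a, 'c) monoid_scheme" and N :: "('b, 'd) monoid_scheme"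
    and \<phi> \<phi>' :: "'b \<Rightarrow> 'a \<Rightarrow> 'a"
  assumes act_eq: "\<And>n a. n \<in> carrier N \<Longrightarrow> a \<in> carrier A \<Longrightarrow> \<phi> n a = \<phi>' n a"
begin

lemma cohomologous_cong:
  "reg_cocycles2 A N \<phi> = reg_cocycles2 A N \<phi>' \<and> cohomologous A N \<phi> = cohomologous A N \<phi>'"
proof -
  have u: "\<phi> n a = \<phi>' n a" if "n \<in> carrier N" "a \<in> Units A" for n a
    using that by (intro act_eq) (auto simp: Units_def)
  have "f \<in> reg_cocycles2 A N \<phi> \<longleftrightarrow> f \<in> reg_cocycles2 A N \<phi>'" for f
    unfolding reg_cocycles2_def mem_Collect_eq
    by (rule conj_cong[OF refl]) (auto simp: u PiE_iff)
  then have reg: "reg_cocycles2 A N \<phi> = reg_cocycles2 A N \<phi>'"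
    by blast
  moreover have "cohomologous A N \<phi> = cohomologous A N \<phi>'"
    unfolding cohomologous_def reg
    by (simp add: u Pi_iff cong: bex_cong_simp ball_cong_simp conj_cong)
  ultimately show ?thesis ..
qed

lemma H2_cong: "H2 A N \<phi> = H2 A N \<phi>'"
  by (simp add: H2_def cohomologous_cong)

lemma compat_pairs_cong:
  assumes "\<And>n a. n \<in> carrier N \<Longrightarrow> a \<in> carrier A \<Longrightarrow> \<phi> n a \<in> carrier A"
  shows "compat_pairs A N \<phi> = compat_pairs A N \<phi>'"
proof -
  have "(\<theta>, \<eta>) \<in> compat_pairs A N \<phi> \<longleftrightarrow> (\<theta>, \<eta>) \<in> compat_pairs A N \<phi>'" for \<theta> \<eta>
  proof (cases "\<theta> \<in> auto A \<and> \<eta> \<in> auto N")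
    case True
    then have "\<phi> (\<eta> n) (\<theta> a) = \<phi>' (\<eta> n) (\<theta> a)" if "n \<in> carrier N" "a \<in> carrier A" for n a
      using that by (intro act_eq) (auto simp: auto_closed)
    then show ?thesis
      by (simp add: compat_pairs_def act_eq)
  qed (auto simp: compat_pairs_def)
  then show ?thesis
    by (auto simp: set_eq_iff)
qed

end

section \<open>Fibrations with commutative kernel\<close>

lemma carrier_ker_monoid: "carrier (ker_monoid M N \<sigma>) = kernel M N \<sigma>"
  and mult_ker_monoid: "x \<otimes>\<^bsub>ker_monoid M N \<sigma>\<^esub> y = x \<otimes>\<^bsub>M\<^esub> y"
  and one_ker_monoid: "\<one>\<^bsub>ker_monoid M N \<sigma>\<^esub> = \<one>\<^bsub>M\<^esub>"
  by (simp_all add: ker_monoid_def)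

lemmas ker_monoid_simps = carrier_ker_monoid mult_ker_monoid one_ker_monoid

locale comm_fibration =
  fixes M :: "('a, 'c) monoid_scheme" (structure) and N :: "('b, 'd) monoid_scheme"
    and \<sigma> :: "'a \<Rightarrow> 'b"
  assumes fibration: "monoid_fibration M N \<sigma>"
    and comm_ker: "comm_monoid (ker_monoid M N \<sigma>)"
begin

abbreviation "K \<equiv> kernel M N \<sigma>"
abbreviation "A \<equiv> ker_monoid M N \<sigma>"

sublocale M: monoid M
  using fibration by (simp add: monoid_fibration_def)

sublocale N: monoid N
  using fibration by (simp add: monoid_fibration_def)

sublocale A: comm_monoid A
  by (rule comm_ker)

lemma sigma_closed: "x \<in> carrier M \<Longrightarrow> \<sigma> x \<in> carrier N"
  and sigma_mult: "x \<in> carrier M \<Longrightarrow> y \<in> carrier M \<Longrightarrow> \<sigma> (x \<otimes> y) = \<sigma> x \<otimes>\<^bsub>N\<^esub> \<sigma> y"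
  and sigma_one: "\<sigma> \<one> = \<one>\<^bsub>N\<^esub>"
  using fibration by (auto simp: monoid_fibration_def hom_def)

lemma ker_iff: "a \<in> K \<longleftrightarrow> a \<in> carrier M \<and> \<sigma> a = \<one>\<^bsub>N\<^esub>"
  by (auto simp: kernel_def)

lemma ker_closed: "a \<in> K \<Longrightarrow> a \<in> carrier M"
  and sigma_ker: "a \<in> K \<Longrightarrow> \<sigma> a = \<one>\<^bsub>N\<^esub>"
  and ker_one: "\<one> \<in> K"
  and ker_mult: "a \<in> K \<Longrightarrow> b \<in> K \<Longrightarrow> a \<otimes> b \<in> K"
  by (simp_all add: ker_iff sigma_mult sigma_one)

lemma ker_comm: "a \<in> K \<Longrightarrow> b \<in> K \<Longrightarrow> a \<otimes> b = b \<otimes> a"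
  using A.m_comm by (simp add: ker_monoid_simps)

lemma ker_lcomm: "a \<in> K \<Longrightarrow> b \<in> K \<Longrightarrow> c \<in> K \<Longrightarrow> a \<otimes> (b \<otimes> c) = b \<otimes> (a \<otimes> c)"
  using A.m_lcomm by (simp add: ker_monoid_simps)

lemma mem_Units_ker: "u \<in> Units A \<longleftrightarrow> u \<in> K \<and> (\<exists>v\<in>K. v \<otimes> u = \<one> \<and> u \<otimes> v = \<one>)"
  by (simp add: Units_def ker_monoid_simps)

lemma Units_ker: "u \<in> Units A \<Longrightarrow> u \<in> K"
  by (simp add: mem_Units_ker)

lemma Units_ker_cancel:
  assumes "u \<in> Units A" "x \<in> carrier M" "y \<in> carrier M"
  shows "u \<otimes> x = u \<otimes> y \<longleftrightarrow> x = y"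
proof -
  have "u \<in> Units M"
    using assms(1) ker_closed unfolding mem_Units_ker by (auto simp: Units_def)
  then show ?thesis
    using assms by simp
qed

subsection \<open>Precartesian elements of a fibration are cartesian\<close>

lemma cartesianD:
  assumes "cartesian M N \<sigma> x"
  shows cartesian_closed: "x \<in> carrier M"
    and cartesian_ex: "z \<in> carrier M \<Longrightarrow> v \<in> carrier N \<Longrightarrow> \<sigma> z = \<sigma> x \<otimes>\<^bsub>N\<^esub> v \<Longrightarrow>
      \<exists>y\<in>carrier M. z = x \<otimes> y \<and> \<sigma> y = v"
    and cartesian_cancel: "y1 \<in> carrier M \<Longrightarrow> y2 \<in> carrier M \<Longrightarrow> x \<otimes> y1 = x \<otimes> y2 \<Longrightarrow>
      \<sigma> y1 = \<sigma> y2 \<Longrightarrow> y1 = y2"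
  using assms unfolding cartesian_def by blast+

lemma precartesianI:
  assumes "x \<in> carrier M"
    and "\<And>z. z \<in> carrier M \<Longrightarrow> \<sigma> z = \<sigma> x \<Longrightarrow> \<exists>y\<in>K. z = x \<otimes> y"
    and "\<And>y1 y2. y1 \<in> K \<Longrightarrow> y2 \<in> K \<Longrightarrow> x \<otimes> y1 = x \<otimes> y2 \<Longrightarrow> y1 = y2"
  shows "x \<in> Pcar M N \<sigma>"
  unfolding Pcar_def precartesian_def mem_Collect_eq using assms by (metis (no_types, lifting))

lemma PcarD:
  assumes "x \<in> Pcar M N \<sigma>"
  shows Pcar_closed: "x \<in> carrier M"
    and Pcar_ex: "z \<in> carrier M \<Longrightarrow> \<sigma> z = \<sigma> x \<Longrightarrow> \<exists>y\<in>K. z = x \<otimes> y"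
    and Pcar_cancel: "y1 \<in> K \<Longrightarrow> y2 \<in> K \<Longrightarrow> x \<otimes> y1 = x \<otimes> y2 \<Longrightarrow> y1 = y2"
proof -
  have x: "x \<in> carrier M" "\<And>z. z \<in> carrier M \<Longrightarrow> \<sigma> z = \<sigma> x \<Longrightarrow> \<exists>!y. y \<in> K \<and> z = x \<otimes> y"
    using assms by (auto simp: Pcar_def precartesian_def)
  show "x \<in> carrier M" by (rule x)
  show "\<exists>y\<in>K. z = x \<otimes> y" if "z \<in> carrier M" "\<sigma> z = \<sigma> x"
    using x(2)[OF that] by blast
  show "y1 = y2" if "y1 \<in> K" "y2 \<in> K" "x \<otimes> y1 = x \<otimes> y2"
  proof -
    have "x \<otimes> y1 \<in> carrier M" "\<sigma> (x \<otimes> y1) = \<sigma> x"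
      using x(1) that by (simp_all add: ker_closed sigma_mult sigma_ker sigma_closed)
    then show ?thesis
      using x(2)[of "x \<otimes> y1"] that by metis
  qed
qed

lemma cartesian_imp_Pcar:
  assumes "cartesian M N \<sigma> x"
  shows "x \<in> Pcar M N \<sigma>"
proof (rule precartesianI)
  note x = cartesian_closed[OF assms]
  show "x \<in> carrier M" by (rule x)
  show "\<exists>y\<in>K. z = x \<otimes> y" if "z \<in> carrier M" "\<sigma> z = \<sigma> x" for z
    using cartesian_ex[OF assms that(1) N.one_closed] that x by (auto simp: ker_iff sigma_closed)
  show "y1 = y2" if "y1 \<in> K" "y2 \<in> K" "x \<otimes> y1 = x \<otimes> y2" for y1 y2
    by (rule cartesian_cancel[OF assms]) (use that in \<open>simp_all add: ker_iff\<close>)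
qed

text \<open>Each of the two elements is a multiple of the other by an element of the kernel, and uniqueness of
  precartesian factorisations makes the two factors mutually inverse.\<close>

lemma Pcar_differ_by_unit:
  assumes "x \<in> Pcar M N \<sigma>" "y \<in> Pcar M N \<sigma>" "\<sigma> x = \<sigma> y"
  shows "\<exists>u\<in>Units A. y = x \<otimes> u"
proof -
  note c = Pcar_closed[OF assms(1)] Pcar_closed[OF assms(2)]
  obtain u where u: "u \<in> K" "y = x \<otimes> u"
    using Pcar_ex[OF assms(1) c(2)] assms(3) by auto
  obtain v where v: "v \<in> K" "x = y \<otimes> v"
    using Pcar_ex[OF assms(2) c(1)] assms(3) by auto
  have "x \<otimes> (u \<otimes> v) = x \<otimes> \<one>"
    using u v c by (simp add: ker_closed flip: M.m_assoc)
  then have "u \<otimes> v = \<one>"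
    by (rule Pcar_cancel[OF assms(1), rotated 2]) (use u v in \<open>simp_all add: ker_mult ker_one\<close>)
  then show ?thesis
    using u v ker_comm[of u v] by (intro bexI[of _ u]) (auto simp: mem_Units_ker)
qed

lemma Pcar_mult_unit:
  assumes "x \<in> Pcar M N \<sigma>" "u \<in> Units A"
  shows "x \<otimes> u \<in> Pcar M N \<sigma>"
proof (rule precartesianI)
  obtain v where v: "v \<in> K" "v \<otimes> u = \<one>" "u \<otimes> v = \<one>" and u: "u \<in> K"
    using assms(2) by (auto simp: mem_Units_ker)
  note x = Pcar_closed[OF assms(1)]
  show "x \<otimes> u \<in> carrier M"
    using x u by (simp add: ker_closed)
  show "\<exists>y\<in>K. z = x \<otimes> u \<otimes> y" if z: "z \<in> carrier M" "\<sigma> z = \<sigma> (x \<otimes> u)" for z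
  proof -
    obtain w where w: "w \<in> K" "z = x \<otimes> w"
      using Pcar_ex[OF assms(1), of z] z x u by (auto simp: sigma_mult sigma_ker ker_closed sigma_closed)
    have "u \<otimes> (v \<otimes> w) = w"
      using u v w by (simp add: ker_closed flip: M.m_assoc)
    then show ?thesis
      using u v w x by (intro bexI[of _ "v \<otimes> w"]) (simp_all add: ker_mult M.m_assoc ker_closed)
  qed
  show "y1 = y2" if "y1 \<in> K" "y2 \<in> K" "x \<otimes> u \<otimes> y1 = x \<otimes> u \<otimes> y2" for y1 y2
  proof -
    have "x \<otimes> (u \<otimes> y1) = x \<otimes> (u \<otimes> y2)"
      using that x u by (simp add: M.m_assoc ker_closed)
    then have "u \<otimes> y1 = u \<otimes> y2"
      by (rule Pcar_cancel[OF assms(1), rotated 2]) (use that u in \<open>simp_all add: ker_mult\<close>)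
    then show ?thesis
      using Units_ker_cancel[OF assms(2)] that by (simp add: ker_closed)
  qed
qed

text \<open>A precartesian element differs by a unit of the kernel from the cartesian element that a fibration
  provides over the same base point, and right multiplication by such a unit preserves cartesian
  elements. The gain is that cartesian elements, unlike precartesian ones, are stable under products
  for formal reasons.\<close>

lemma Pcar_imp_cartesian:
  assumes "x \<in> Pcar M N \<sigma>"
  shows "cartesian M N \<sigma> x"
proof -
  note x = Pcar_closed[OF assms]
  obtain c where c: "cartesian M N \<sigma> c" "\<sigma> c = \<sigma> x"
    using fibration sigma_closed[OF x] by (auto simp: monoid_fibration_def)
  note cM = cartesian_closed[OF c(1)]
  obtain v where v: "v \<in> Units A" "x = c \<otimes> v"
    using Pcar_differ_by_unit[OF cartesian_imp_Pcar[OF c(1)] assms c(2)] by blast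
  obtain u where u: "u \<in> K" "u \<otimes> v = \<one>" "v \<otimes> u = \<one>" and vK: "v \<in> K"
    using v(1) by (auto simp: mem_Units_ker)
  note closed = x cM ker_closed[OF vK] ker_closed[OF u(1)]
  show ?thesis
    unfolding cartesian_def
  proof (intro conjI ballI impI)
    show "x \<in> carrier M" by (rule x)
  next
    fix z w
    assume zw: "z \<in> carrier M" "w \<in> carrier N" "\<sigma> z = \<sigma> x \<otimes>\<^bsub>N\<^esub> w"
    then obtain y where y: "y \<in> carrier M" "z = c \<otimes> y" "\<sigma> y = w"
      using cartesian_ex[OF c(1)] c(2) by auto
    have "v \<otimes> (u \<otimes> y) = y"
      using closed y u by (simp flip: M.m_assoc)
    then have "z = x \<otimes> (u \<otimes> y)"
      using closed y v(2) by (simp add: M.m_assoc)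
    then show "\<exists>y\<in>carrier M. z = x \<otimes> y \<and> \<sigma> y = w"
      using closed y u zw by (intro bexI[of _ "u \<otimes> y"]) (auto simp: sigma_mult sigma_ker)
  next
    fix y1 y2
    assume y: "y1 \<in> carrier M" "y2 \<in> carrier M" and eq: "x \<otimes> y1 = x \<otimes> y2 \<and> \<sigma> y1 = \<sigma> y2"
    have "c \<otimes> (v \<otimes> y1) = c \<otimes> (v \<otimes> y2)"
      using eq closed y v(2) by (simp add: M.m_assoc)
    then have "v \<otimes> y1 = v \<otimes> y2"
      by (rule cartesian_cancel[OF c(1), rotated 2]) (use eq closed y in \<open>simp_all add: sigma_mult\<close>)
    then show "y1 = y2"
      using Units_ker_cancel[OF v(1)] y by simp
  qed
qed

lemma cartesian_mult:
  assumes "cartesian M N \<sigma> x" "cartesian M N \<sigma> y"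
  shows "cartesian M N \<sigma> (x \<otimes> y)"
proof -
  note c = cartesian_closed[OF assms(1)] cartesian_closed[OF assms(2)]
  show ?thesis
    unfolding cartesian_def
  proof (intro conjI ballI impI)
    show "x \<otimes> y \<in> carrier M"
      using c by simp
  next
    fix z v
    assume z: "z \<in> carrier M" and v: "v \<in> carrier N" and eq: "\<sigma> z = \<sigma> (x \<otimes> y) \<otimes>\<^bsub>N\<^esub> v"
    have "\<sigma> z = \<sigma> x \<otimes>\<^bsub>N\<^esub> (\<sigma> y \<otimes>\<^bsub>N\<^esub> v)"
      using eq c v by (simp add: sigma_mult sigma_closed N.m_assoc)
    then obtain w where w: "w \<in> carrier M" "z = x \<otimes> w" "\<sigma> w = \<sigma> y \<otimes>\<^bsub>N\<^esub> v"
      using cartesian_ex[OF assms(1) z, of "\<sigma> y \<otimes>\<^bsub>N\<^esub> v"] c v by (auto simp: sigma_closed)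
    obtain t where "t \<in> carrier M" "w = y \<otimes> t" "\<sigma> t = v"
      using cartesian_ex[OF assms(2) w(1) v w(3)] by blast
    then show "\<exists>t\<in>carrier M. z = x \<otimes> y \<otimes> t \<and> \<sigma> t = v"
      using w c by (intro bexI[of _ t]) (simp_all add: M.m_assoc)
  next
    fix t1 t2
    assume t: "t1 \<in> carrier M" "t2 \<in> carrier M" and eq: "x \<otimes> y \<otimes> t1 = x \<otimes> y \<otimes> t2 \<and> \<sigma> t1 = \<sigma> t2"
    have "y \<otimes> t1 = y \<otimes> t2"
      by (rule cartesian_cancel[OF assms(1)])
        (use c t eq in \<open>simp_all add: sigma_mult flip: M.m_assoc\<close>)
    then show "t1 = t2"
      using cartesian_cancel[OF assms(2)] t eq by blast
  qed
qed

lemma Pcar_mult: "x \<in> Pcar M N \<sigma> \<Longrightarrow> y \<in> Pcar M N \<sigma> \<Longrightarrow> x \<otimes> y \<in> Pcar M N \<sigma>"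
  using cartesian_imp_Pcar[OF cartesian_mult[OF Pcar_imp_cartesian Pcar_imp_cartesian]] .

end

section \<open>The action and the factor set of a cleavage\<close>

locale cleaved_fibration = comm_fibration M N \<sigma>
  for M :: "('a, 'c) monoid_scheme" (structure) and N :: "('b, 'd) monoid_scheme"
    and \<sigma> :: "'a \<Rightarrow> 'b" +
  fixes \<kappa> :: "'b \<Rightarrow> 'a"
  assumes cleavage: "cleavage M N \<sigma> \<kappa>"
begin

abbreviation "\<phi> \<equiv> cleavage_action M N \<sigma> \<kappa>"
abbreviation "\<gamma> \<equiv> cleavage_factor M N \<sigma> \<kappa>"

lemma kappa_Pcar: "n \<in> carrier N \<Longrightarrow> \<kappa> n \<in> Pcar M N \<sigma>"
  and sigma_kappa: "n \<in> carrier N \<Longrightarrow> \<sigma> (\<kappa> n) = n"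
  and kappa_one: "\<kappa> \<one>\<^bsub>N\<^esub> = \<one>"
  using cleavage by (auto simp: cleavage_def)

lemma kappa_closed: "n \<in> carrier N \<Longrightarrow> \<kappa> n \<in> carrier M"
  by (rule Pcar_closed[OF kappa_Pcar])

lemma normal_form:
  assumes "x \<in> carrier M"
  obtains a where "a \<in> K" "x = \<kappa> (\<sigma> x) \<otimes> a"
proof -
  have "\<sigma> x = \<sigma> (\<kappa> (\<sigma> x))"
    by (simp add: sigma_kappa sigma_closed assms)
  then show thesis
    using Pcar_ex[OF kappa_Pcar[OF sigma_closed[OF assms]] assms] that by blast
qed

lemma sigma_normal_form: "n \<in> carrier N \<Longrightarrow> a \<in> K \<Longrightarrow> \<sigma> (\<kappa> n \<otimes> a) = n"
  by (simp add: sigma_mult kappa_closed sigma_kappa ker_closed sigma_ker)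

lemma normal_form_closed: "n \<in> carrier N \<Longrightarrow> a \<in> K \<Longrightarrow> \<kappa> n \<otimes> a \<in> carrier M"
  by (simp add: kappa_closed ker_closed)

lemma normal_form_eq_iff:
  assumes "m \<in> carrier N" "n \<in> carrier N" "a \<in> K" "b \<in> K"
  shows "\<kappa> m \<otimes> a = \<kappa> n \<otimes> b \<longleftrightarrow> m = n \<and> a = b"
proof
  assume eq: "\<kappa> m \<otimes> a = \<kappa> n \<otimes> b"
  then have "m = n"
    using sigma_normal_form assms by metis
  with eq Pcar_cancel[OF kappa_Pcar] assms show "m = n \<and> a = b"
    by blast
qed simp

lemma Pcar_normal_form:
  assumes "x \<in> Pcar M N \<sigma>"
  obtains u where "u \<in> Units A" "x = \<kappa> (\<sigma> x) \<otimes> u"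
proof -
  have "\<sigma> x \<in> carrier N"
    by (rule sigma_closed[OF Pcar_closed[OF assms]])
  then have "\<exists>u\<in>Units A. x = \<kappa> (\<sigma> x) \<otimes> u"
    by (intro Pcar_differ_by_unit[OF kappa_Pcar assms]) (simp_all add: sigma_kappa)
  then show thesis
    using that by blast
qed

lemma act_unique:
  assumes "n \<in> carrier N" "a \<in> K" "b \<in> K" "a \<otimes> \<kappa> n = \<kappa> n \<otimes> b"
  shows "\<phi> n a = b"
  unfolding cleavage_action_def
proof (rule the_equality)
  show "c = b" if "c \<in> K \<and> a \<otimes> \<kappa> n = \<kappa> n \<otimes> c" for c
    using normal_form_eq_iff[OF assms(1) assms(1), of c b] that assms by simp
qed (use assms in simp)

lemma act_ker_and_commute:
  assumes "n \<in> carrier N" "a \<in> K"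
  shows "\<phi> n a \<in> K \<and> a \<otimes> \<kappa> n = \<kappa> n \<otimes> \<phi> n a"
proof -
  have "a \<otimes> \<kappa> n \<in> carrier M" "\<sigma> (a \<otimes> \<kappa> n) = n"
    using assms by (simp_all add: ker_closed kappa_closed sigma_mult sigma_ker sigma_kappa)
  then obtain b where "b \<in> K" "a \<otimes> \<kappa> n = \<kappa> n \<otimes> b"
    using normal_form by metis
  then show ?thesis
    using act_unique[OF assms] by simp
qed

lemma act_ker: "n \<in> carrier N \<Longrightarrow> a \<in> K \<Longrightarrow> \<phi> n a \<in> K"
  and ker_mult_kappa: "n \<in> carrier N \<Longrightarrow> a \<in> K \<Longrightarrow> a \<otimes> \<kappa> n = \<kappa> n \<otimes> \<phi> n a"
  using act_ker_and_commute by blast+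

lemma factor_unique:
  assumes "m \<in> carrier N" "n \<in> carrier N" "c \<in> K" "\<kappa> m \<otimes> \<kappa> n = \<kappa> (m \<otimes>\<^bsub>N\<^esub> n) \<otimes> c"
  shows "\<gamma> m n = c"
  unfolding cleavage_factor_def
proof (rule the_equality)
  show "b = c" if "b \<in> K \<and> \<kappa> m \<otimes> \<kappa> n = \<kappa> (m \<otimes>\<^bsub>N\<^esub> n) \<otimes> b" for b
    using normal_form_eq_iff[of "m \<otimes>\<^bsub>N\<^esub> n" "m \<otimes>\<^bsub>N\<^esub> n" b c] that assms by simp
qed (use assms in simp)

text \<open>The product \<open>\<kappa>(m)\<kappa>(n)\<close> is precartesian over the same element as \<open>\<kappa>(mn)\<close>; this is why the factor
  set has invertible values.\<close>

lemma factor_unit_and_mult: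
  assumes "m \<in> carrier N" "n \<in> carrier N"
  shows "\<gamma> m n \<in> Units A \<and> \<kappa> m \<otimes> \<kappa> n = \<kappa> (m \<otimes>\<^bsub>N\<^esub> n) \<otimes> \<gamma> m n"
proof -
  have "\<sigma> (\<kappa> m \<otimes> \<kappa> n) = m \<otimes>\<^bsub>N\<^esub> n"
    using assms by (simp add: sigma_mult sigma_kappa kappa_closed)
  then obtain c where c: "c \<in> Units A" "\<kappa> m \<otimes> \<kappa> n = \<kappa> (m \<otimes>\<^bsub>N\<^esub> n) \<otimes> c"
    using Pcar_normal_form[OF Pcar_mult[OF kappa_Pcar[OF assms(1)] kappa_Pcar[OF assms(2)]]] by metis
  then show ?thesis
    using factor_unique[OF assms Units_ker] by simp
qed

lemma factor_unit: "m \<in> carrier N \<Longrightarrow> n \<in> carrier N \<Longrightarrow> \<gamma> m n \<in> Units A"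
  and kappa_mult: "m \<in> carrier N \<Longrightarrow> n \<in> carrier N \<Longrightarrow>
    \<kappa> m \<otimes> \<kappa> n = \<kappa> (m \<otimes>\<^bsub>N\<^esub> n) \<otimes> \<gamma> m n"
  using factor_unit_and_mult by blast+

lemma factor_ker: "m \<in> carrier N \<Longrightarrow> n \<in> carrier N \<Longrightarrow> \<gamma> m n \<in> K"
  by (rule Units_ker[OF factor_unit])

text \<open>In the coordinates \<open>(n, a) \<leftrightarrow> \<kappa>(n)a\<close> the monoid \<open>M\<close> is the product set \<open>N \<times> A\<close> with a multiplication
  twisted by \<open>\<phi>\<close> and \<open>\<gamma>\<close>. All later computations compare such normal forms.\<close>

lemma normal_form_mult:
  assumes "m \<in> carrier N" "n \<in> carrier N" "a \<in> K" "b \<in> K"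
  shows "(\<kappa> m \<otimes> a) \<otimes> (\<kappa> n \<otimes> b) = \<kappa> (m \<otimes>\<^bsub>N\<^esub> n) \<otimes> (\<gamma> m n \<otimes> (\<phi> n a \<otimes> b))"
proof -
  have c: "\<kappa> m \<in> carrier M" "\<kappa> n \<in> carrier M" "\<kappa> (m \<otimes>\<^bsub>N\<^esub> n) \<in> carrier M" "a \<in> carrier M"
    "b \<in> carrier M" "\<phi> n a \<in> carrier M" "\<gamma> m n \<in> carrier M"
    using assms by (simp_all add: kappa_closed ker_closed act_ker factor_ker)
  have "(\<kappa> m \<otimes> a) \<otimes> (\<kappa> n \<otimes> b) = \<kappa> m \<otimes> (a \<otimes> \<kappa> n) \<otimes> b"
    using c by (simp add: M.m_assoc)
  also have "\<dots> = (\<kappa> m \<otimes> \<kappa> n) \<otimes> (\<phi> n a \<otimes> b)"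
    using c assms by (simp add: ker_mult_kappa M.m_assoc)
  also have "\<dots> = \<kappa> (m \<otimes>\<^bsub>N\<^esub> n) \<otimes> (\<gamma> m n \<otimes> (\<phi> n a \<otimes> b))"
    using c assms by (simp add: kappa_mult M.m_assoc)
  finally show ?thesis .
qed

text \<open>Moving \<open>a\<close> past \<open>\<kappa>(m)\<kappa>(n)\<close> in one and in two steps gives \<open>\<gamma>\<^sub>m\<^sub>,\<^sub>n \<phi>\<^sub>m\<^sub>n(a) = \<gamma>\<^sub>m\<^sub>,\<^sub>n \<phi>\<^sub>n(\<phi>\<^sub>m(a))\<close>; here
  commutativity of \<open>A\<close> and invertibility of \<open>\<gamma>\<^sub>m\<^sub>,\<^sub>n\<close> are essential.\<close>

sublocale monoid_action A N \<phi>
proof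
  fix n a b
  assume n: "n \<in> carrier N" and "a \<in> carrier A" "b \<in> carrier A"
  then have ab: "a \<in> K" "b \<in> K"
    by (simp_all add: ker_monoid_simps)
  then show "\<phi> n a \<in> carrier A"
    using n by (simp add: ker_monoid_simps act_ker)
  have c: "\<kappa> n \<in> carrier M" "a \<in> carrier M" "b \<in> carrier M" "\<phi> n a \<in> carrier M" "\<phi> n b \<in> carrier M"
    using n ab by (simp_all add: kappa_closed ker_closed act_ker)
  have "a \<otimes> b \<otimes> \<kappa> n = a \<otimes> (\<kappa> n \<otimes> \<phi> n b)"
    using c n ab by (simp add: M.m_assoc ker_mult_kappa)
  also have "\<dots> = a \<otimes> \<kappa> n \<otimes> \<phi> n b"
    using c by (simp add: M.m_assoc)
  also have "\<dots> = \<kappa> n \<otimes> (\<phi> n a \<otimes> \<phi> n b)"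
    using c n ab by (subst ker_mult_kappa) (simp_all add: M.m_assoc)
  finally show "\<phi> n (a \<otimes>\<^bsub>A\<^esub> b) = \<phi> n a \<otimes>\<^bsub>A\<^esub> \<phi> n b"
    using n ab by (auto simp: ker_monoid_simps ker_mult act_ker intro!: act_unique)
next
  fix n
  assume "n \<in> carrier N"
  then show "\<phi> n \<one>\<^bsub>A\<^esub> = \<one>\<^bsub>A\<^esub>"
    by (auto simp: ker_monoid_simps ker_one kappa_closed intro!: act_unique)
next
  fix m n a
  assume mn: "m \<in> carrier N" "n \<in> carrier N" and "a \<in> carrier A"
  then have a: "a \<in> K"
    by (simp add: ker_monoid_simps)
  have k: "\<phi> m a \<in> K" "\<phi> n (\<phi> m a) \<in> K" "\<phi> (m \<otimes>\<^bsub>N\<^esub> n) a \<in> K" "\<gamma> m n \<in> K"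
    using mn a by (simp_all add: act_ker factor_ker)
  have c: "\<kappa> m \<in> carrier M" "\<kappa> n \<in> carrier M" "\<kappa> (m \<otimes>\<^bsub>N\<^esub> n) \<in> carrier M" "a \<in> carrier M"
    "\<gamma> m n \<in> carrier M" "\<phi> m a \<in> carrier M" "\<phi> n (\<phi> m a) \<in> carrier M"
    "\<phi> (m \<otimes>\<^bsub>N\<^esub> n) a \<in> carrier M"
    using mn a k by (simp_all add: kappa_closed ker_closed)
  have "\<kappa> (m \<otimes>\<^bsub>N\<^esub> n) \<otimes> (\<phi> (m \<otimes>\<^bsub>N\<^esub> n) a \<otimes> \<gamma> m n) = a \<otimes> \<kappa> (m \<otimes>\<^bsub>N\<^esub> n) \<otimes> \<gamma> m n"
    using mn a c by (subst ker_mult_kappa) (simp_all add: M.m_assoc)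
  also have "\<dots> = a \<otimes> \<kappa> m \<otimes> \<kappa> n"
    using mn c by (simp add: kappa_mult M.m_assoc)
  also have "\<dots> = (\<kappa> m \<otimes> \<phi> m a) \<otimes> (\<kappa> n \<otimes> \<one>)"
    using mn a c by (simp add: ker_mult_kappa)
  also have "\<dots> = \<kappa> (m \<otimes>\<^bsub>N\<^esub> n) \<otimes> (\<gamma> m n \<otimes> \<phi> n (\<phi> m a))"
    using mn k c by (subst normal_form_mult) (simp_all add: ker_one)
  finally have "\<gamma> m n \<otimes> \<phi> (m \<otimes>\<^bsub>N\<^esub> n) a = \<gamma> m n \<otimes> \<phi> n (\<phi> m a)"
    using mn k by (simp add: normal_form_eq_iff ker_mult ker_comm)
  then show "\<phi> (m \<otimes>\<^bsub>N\<^esub> n) a = \<phi> n (\<phi> m a)"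
    using mn c by (simp add: Units_ker_cancel factor_unit)
next
  fix a
  assume "a \<in> carrier A"
  then show "\<phi> \<one>\<^bsub>N\<^esub> a = a"
    by (auto simp: ker_monoid_simps kappa_one ker_closed intro!: act_unique)
qed

text \<open>The factor set as a function on pairs, extensional like every two-cocycle.\<close>

definition factor_set :: "'b \<times> 'b \<Rightarrow> 'a" where
  "factor_set = (\<lambda>(m, n)\<in>carrier N \<times> carrier N. \<gamma> m n)"

text \<open>The cocycle identity compares the normal forms of \<open>(\<kappa>(m)\<kappa>(n))\<kappa>(k)\<close> and \<open>\<kappa>(m)(\<kappa>(n)\<kappa>(k))\<close>.\<close>

lemma factor_set_cocycle: "factor_set \<in> reg_cocycles2 A N \<phi>"
  unfolding mem_reg_cocycles2
proof (intro conjI ballI)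
  show "factor_set \<in> extensional (carrier N \<times> carrier N)"
    by (simp add: factor_set_def)
  show "factor_set (m, n) \<in> Units A" if "m \<in> carrier N" "n \<in> carrier N" for m n
    using that by (simp add: factor_set_def factor_unit)
  show "factor_set (n, \<one>\<^bsub>N\<^esub>) = \<one>\<^bsub>A\<^esub>" if "n \<in> carrier N" for n
    using that by (auto simp: factor_set_def ker_monoid_simps ker_one kappa_one kappa_closed
        intro!: factor_unique)
  show "factor_set (\<one>\<^bsub>N\<^esub>, n) = \<one>\<^bsub>A\<^esub>" if "n \<in> carrier N" for n
    using that by (auto simp: factor_set_def ker_monoid_simps ker_one kappa_one kappa_closed
        intro!: factor_unique)
  fix m n k
  assume mnk: "m \<in> carrier N" "n \<in> carrier N" "k \<in> carrier N"
  have K: "\<gamma> m n \<in> K" "\<gamma> n k \<in> K" "\<gamma> (m \<otimes>\<^bsub>N\<^esub> n) k \<in> K" "\<gamma> m (n \<otimes>\<^bsub>N\<^esub> k) \<in> K" "\<phi> k (\<gamma> m n) \<in> K"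
    "\<phi> (n \<otimes>\<^bsub>N\<^esub> k) \<one> = \<one>"
    using mnk act_one[of "n \<otimes>\<^bsub>N\<^esub> k"] by (simp_all add: factor_ker act_ker ker_monoid_simps)
  have c: "\<kappa> m \<in> carrier M" "\<kappa> n \<in> carrier M" "\<kappa> k \<in> carrier M"
    using mnk by (simp_all add: kappa_closed)
  have "\<kappa> (m \<otimes>\<^bsub>N\<^esub> n \<otimes>\<^bsub>N\<^esub> k) \<otimes> (\<gamma> (m \<otimes>\<^bsub>N\<^esub> n) k \<otimes> \<phi> k (\<gamma> m n)) =
      (\<kappa> (m \<otimes>\<^bsub>N\<^esub> n) \<otimes> \<gamma> m n) \<otimes> (\<kappa> k \<otimes> \<one>)"
    using mnk K by (subst normal_form_mult) (simp_all add: ker_one ker_closed)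
  also have "\<dots> = (\<kappa> m \<otimes> \<one>) \<otimes> (\<kappa> n \<otimes> \<kappa> k)"
    using mnk c by (simp add: M.m_assoc flip: kappa_mult)
  also have "\<dots> = (\<kappa> m \<otimes> \<one>) \<otimes> (\<kappa> (n \<otimes>\<^bsub>N\<^esub> k) \<otimes> \<gamma> n k)"
    using mnk by (simp only: kappa_mult)
  also have "\<dots> = \<kappa> (m \<otimes>\<^bsub>N\<^esub> n \<otimes>\<^bsub>N\<^esub> k) \<otimes> (\<gamma> m (n \<otimes>\<^bsub>N\<^esub> k) \<otimes> \<gamma> n k)"
    using mnk K by (subst normal_form_mult) (simp_all add: ker_one ker_closed N.m_assoc)
  finally show "factor_set (m \<otimes>\<^bsub>N\<^esub> n, k) \<otimes>\<^bsub>A\<^esub> \<phi> k (factor_set (m, n)) =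
      factor_set (m, n \<otimes>\<^bsub>N\<^esub> k) \<otimes>\<^bsub>A\<^esub> factor_set (n, k)"
    using mnk K by (simp add: factor_set_def ker_monoid_simps normal_form_eq_iff ker_mult)
qed

section \<open>Automorphisms of a fibration in normal form\<close>

lemma ker_autoD:
  assumes "\<psi> \<in> ker_auto M N \<sigma>"
  shows ker_auto_auto: "\<psi> \<in> auto M"
    and ker_auto_ker: "a \<in> K \<Longrightarrow> \<psi> a \<in> K"
    and ker_auto_ker_surj: "b \<in> K \<Longrightarrow> \<exists>a\<in>K. b = \<psi> a"
    and ker_auto_Pcar: "x \<in> Pcar M N \<sigma> \<Longrightarrow> \<psi> x \<in> Pcar M N \<sigma>"
  using assms by (auto simp: ker_auto_def)

lemma theta_apply: "a \<in> K \<Longrightarrow> theta M N \<sigma> \<psi> a = \<psi> a"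
  by (simp add: theta_def)

lemma theta_in_auto:
  assumes "\<psi> \<in> ker_auto M N \<sigma>"
  shows "theta M N \<sigma> \<psi> \<in> auto A"
proof (rule autoI)
  note \<psi> = ker_autoD[OF assms]
  show "theta M N \<sigma> \<psi> \<in> extensional (carrier A)"
    by (simp add: theta_def ker_monoid_simps)
  have "inj_on \<psi> K"
    using auto_inj[OF \<psi>(1)] by (auto simp: inj_on_def ker_closed)
  moreover have "\<psi> ` K = K"
    using assms by (simp add: ker_auto_def)
  ultimately show "bij_betw (theta M N \<sigma> \<psi>) (carrier A) (carrier A)"
    by (simp add: ker_monoid_simps theta_def bij_betw_def inj_on_def)
  show "theta M N \<sigma> \<psi> (x \<otimes>\<^bsub>A\<^esub> y) = theta M N \<sigma> \<psi> x \<otimes>\<^bsub>A\<^esub> theta M N \<sigma> \<psi> y"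
    if "x \<in> carrier A" "y \<in> carrier A" for x y
    using that auto_mult[OF \<psi>(1)] by (simp add: ker_monoid_simps theta_apply ker_mult ker_closed)
qed

text \<open>Since \<open>\<sigma>\<close> is surjective and automorphisms of \<open>N\<close> are taken extensional, the induced map on \<open>N\<close> is
  determined by its defining equation.\<close>

lemma eta_eqI:
  assumes "\<eta> \<in> auto N" "\<And>x. x \<in> carrier M \<Longrightarrow> \<eta> (\<sigma> x) = \<sigma> (\<psi> x)"
  shows "eta M N \<sigma> \<psi> = \<eta>"
  unfolding eta_def
proof (rule the_equality)
  show "\<eta> \<in> auto N \<and> (\<forall>x\<in>carrier M. \<eta> (\<sigma> x) = \<sigma> (\<psi> x))"
    using assms by blast
  fix \<eta>'
  assume \<eta>': "\<eta>' \<in> auto N \<and> (\<forall>x\<in>carrier M. \<eta>' (\<sigma> x) = \<sigma> (\<psi> x))"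
  show "\<eta>' = \<eta>"
  proof (rule extensionalityI[of _ "carrier N"])
    show "\<eta>' n = \<eta> n" if "n \<in> carrier N" for n
      using assms(2)[of "\<kappa> n"] \<eta>' that by (metis kappa_closed sigma_kappa)
  qed (use \<eta>' assms(1) in \<open>auto intro: auto_extensional\<close>)
qed

text \<open>An automorphism that preserves the kernel maps fibres into fibres because a fibre is the
  translate of the kernel by a value of the cleavage; it separates fibres because the images of
  these values are again precartesian.\<close>

lemma eta_exists:
  assumes "\<psi> \<in> ker_auto M N \<sigma>"
  shows "\<exists>\<eta>\<in>auto N. \<forall>x\<in>carrier M. \<eta> (\<sigma> x) = \<sigma> (\<psi> x)"
proof (rule bexI)
  note \<psi> = ker_autoD[OF assms]
  note mult = auto_mult[OF \<psi>(1)] and closed = auto_closed[OF \<psi>(1)]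
  define \<eta> where "\<eta> = (\<lambda>n\<in>carrier N. \<sigma> (\<psi> (\<kappa> n)))"
  have \<eta>_sigma: "\<eta> (\<sigma> x) = \<sigma> (\<psi> x)" if x: "x \<in> carrier M" for x
  proof -
    obtain a where a: "a \<in> K" "x = \<kappa> (\<sigma> x) \<otimes> a"
      using normal_form[OF x] by blast
    have "\<sigma> (\<psi> (\<kappa> (\<sigma> x) \<otimes> a)) = \<sigma> (\<psi> (\<kappa> (\<sigma> x)))"
      using a(1) x \<psi>(2)[OF a(1)]
      by (simp add: mult sigma_closed kappa_closed ker_closed sigma_mult closed sigma_ker)
    then show ?thesis
      unfolding a(2)[symmetric] using x by (simp add: \<eta>_def sigma_closed)
  qed
  then show "\<forall>x\<in>carrier M. \<eta> (\<sigma> x) = \<sigma> (\<psi> x)"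
    by blast
  show "\<eta> \<in> auto N"
  proof (rule autoI)
    show "\<eta> \<in> extensional (carrier N)"
      by (simp add: \<eta>_def)
    show "\<eta> (m \<otimes>\<^bsub>N\<^esub> n) = \<eta> m \<otimes>\<^bsub>N\<^esub> \<eta> n" if "m \<in> carrier N" "n \<in> carrier N" for m n
      using \<eta>_sigma[of "\<kappa> m \<otimes> \<kappa> n"] that
      by (simp add: sigma_mult kappa_closed sigma_kappa mult closed \<eta>_def)
    show "bij_betw \<eta> (carrier N) (carrier N)"
      unfolding bij_betw_def
    proof (intro conjI equalityI subsetI inj_onI)
      fix m n
      assume mn: "m \<in> carrier N" "n \<in> carrier N" and eq: "\<eta> m = \<eta> n"
      have "\<sigma> (\<psi> (\<kappa> m)) = \<sigma> (\<psi> (\<kappa> n))"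
        using mn eq by (simp add: \<eta>_def)
      then obtain b where b: "b \<in> K" "\<psi> (\<kappa> m) = \<psi> (\<kappa> n) \<otimes> b"
        using Pcar_ex[OF \<psi>(4)[OF kappa_Pcar[OF mn(2)]]] closed[OF kappa_closed[OF mn(1)]] by blast
      obtain c where c: "c \<in> K" "b = \<psi> c"
        using \<psi>(3)[OF b(1)] by blast
      (* c comes from \<psi>(A) = A: thus \<kappa>(m) itself is a multiple of \<kappa>(n) by a kernel element *)
      have "\<psi> (\<kappa> m) = \<psi> (\<kappa> n \<otimes> c)"
        using b c mn by (simp add: mult kappa_closed ker_closed)
      then have "\<kappa> m \<otimes> \<one> = \<kappa> n \<otimes> c"
        using auto_inj[OF \<psi>(1)] mn c(1) by (simp add: kappa_closed ker_closed)
      then show "m = n"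
        using normal_form_eq_iff[OF mn ker_one c(1)] by blast
    next
      fix n
      assume "n \<in> \<eta> ` carrier N"
      then show "n \<in> carrier N"
        by (auto simp: \<eta>_def sigma_closed closed kappa_closed)
    next
      fix n
      assume n: "n \<in> carrier N"
      obtain x where "x \<in> carrier M" "\<kappa> n = \<psi> x"
        using auto_surj[OF \<psi>(1) kappa_closed[OF n]] by blast
      then have "\<eta> (\<sigma> x) = n" "\<sigma> x \<in> carrier N"
        using \<eta>_sigma[of x] sigma_kappa[OF n] by (simp_all add: sigma_closed)
      then show "n \<in> \<eta> ` carrier N"
        by blast
    qed
  qed
qed

lemma
  assumes "\<psi> \<in> ker_auto M N \<sigma>"
  shows eta_in_auto: "eta M N \<sigma> \<psi> \<in> auto N"
    and eta_sigma: "x \<in> carrier M \<Longrightarrow> eta M N \<sigma> \<psi> (\<sigma> x) = \<sigma> (\<psi> x)"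
proof -
  obtain \<eta> where "\<eta> \<in> auto N" "\<forall>x\<in>carrier M. \<eta> (\<sigma> x) = \<sigma> (\<psi> x)"
    using eta_exists[OF assms] by blast
  then show "eta M N \<sigma> \<psi> \<in> auto N" "x \<in> carrier M \<Longrightarrow> eta M N \<sigma> \<psi> (\<sigma> x) = \<sigma> (\<psi> x)"
    using eta_eqI[of \<eta> \<psi>] by auto
qed

text \<open>The data describing an automorphism \<open>\<kappa>(n)a \<mapsto> \<kappa>(\<eta>(n))\<beta>(n)\<theta>(a)\<close>: with the multiplication
  of normal forms, the last condition says that this map is multiplicative on products \<open>\<kappa>(m)\<kappa>(n)\<close>,
  and equivariance says that it respects the relations \<open>a\<kappa>(n) = \<kappa>(n)\<phi>\<^sub>n(a)\<close>.\<close>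

definition twist_data :: "('a \<Rightarrow> 'a) \<Rightarrow> ('b \<Rightarrow> 'b) \<Rightarrow> ('b \<Rightarrow> 'a) \<Rightarrow> bool" where
  "twist_data \<theta> \<eta> \<beta> \<longleftrightarrow> \<theta> \<in> auto A \<and> \<eta> \<in> auto N \<and>
     (\<forall>n\<in>carrier N. \<forall>a\<in>K. \<phi> (\<eta> n) (\<theta> a) = \<theta> (\<phi> n a)) \<and>
     (\<forall>n\<in>carrier N. \<beta> n \<in> Units A) \<and> \<beta> \<one>\<^bsub>N\<^esub> = \<one> \<and>
     (\<forall>m\<in>carrier N. \<forall>n\<in>carrier N.
        \<beta> (m \<otimes>\<^bsub>N\<^esub> n) \<otimes> \<theta> (\<gamma> m n) = \<gamma> (\<eta> m) (\<eta> n) \<otimes> (\<phi> (\<eta> n) (\<beta> m) \<otimes> \<beta> n))"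

definition coordinate :: "'a \<Rightarrow> 'a" where
  "coordinate x = (THE a. a \<in> K \<and> x = \<kappa> (\<sigma> x) \<otimes> a)"

lemma coordinate_normal_form:
  assumes "n \<in> carrier N" "a \<in> K"
  shows "coordinate (\<kappa> n \<otimes> a) = a"
  unfolding coordinate_def sigma_normal_form[OF assms]
  by (rule the_equality) (use assms normal_form_eq_iff[OF assms(1) assms(1)] in auto)

definition twist :: "('a \<Rightarrow> 'a) \<Rightarrow> ('b \<Rightarrow> 'b) \<Rightarrow> ('b \<Rightarrow> 'a) \<Rightarrow> 'a \<Rightarrow> 'a" where
  "twist \<theta> \<eta> \<beta> = (\<lambda>x\<in>carrier M. \<kappa> (\<eta> (\<sigma> x)) \<otimes> (\<beta> (\<sigma> x) \<otimes> \<theta> (coordinate x)))"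

lemma twist_normal_form:
  assumes "n \<in> carrier N" "a \<in> K"
  shows "twist \<theta> \<eta> \<beta> (\<kappa> n \<otimes> a) = \<kappa> (\<eta> n) \<otimes> (\<beta> n \<otimes> \<theta> a)"
  using assms by (simp add: twist_def normal_form_closed sigma_normal_form coordinate_normal_form)

lemma twist_eqI:
  assumes "\<psi> \<in> extensional (carrier M)"
    and "\<And>n a. n \<in> carrier N \<Longrightarrow> a \<in> K \<Longrightarrow> \<psi> (\<kappa> n \<otimes> a) = \<kappa> (\<eta> n) \<otimes> (\<beta> n \<otimes> \<theta> a)"
  shows "\<psi> = twist \<theta> \<eta> \<beta>"
proof (rule extensionalityI[OF assms(1)])
  show "twist \<theta> \<eta> \<beta> \<in> extensional (carrier M)"
    by (simp add: twist_def)
  show "\<psi> x = twist \<theta> \<eta> \<beta> x" if x: "x \<in> carrier M" for x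
  proof -
    obtain a where a: "a \<in> K" "x = \<kappa> (\<sigma> x) \<otimes> a"
      using normal_form[OF x] by blast
    have "\<psi> (\<kappa> (\<sigma> x) \<otimes> a) = twist \<theta> \<eta> \<beta> (\<kappa> (\<sigma> x) \<otimes> a)"
      using a(1) x by (simp add: assms(2) twist_normal_form sigma_closed)
    then show ?thesis
      unfolding a(2)[symmetric] .
  qed
qed

lemma twist_dataD:
  assumes "twist_data \<theta> \<eta> \<beta>"
  shows "\<theta> \<in> auto A" "\<eta> \<in> auto N"
    and "n \<in> carrier N \<Longrightarrow> a \<in> K \<Longrightarrow> \<phi> (\<eta> n) (\<theta> a) = \<theta> (\<phi> n a)"
    and "n \<in> carrier N \<Longrightarrow> \<beta> n \<in> Units A" "\<beta> \<one>\<^bsub>N\<^esub> = \<one>"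
    and "m \<in> carrier N \<Longrightarrow> n \<in> carrier N \<Longrightarrow>
      \<beta> (m \<otimes>\<^bsub>N\<^esub> n) \<otimes> \<theta> (\<gamma> m n) = \<gamma> (\<eta> m) (\<eta> n) \<otimes> (\<phi> (\<eta> n) (\<beta> m) \<otimes> \<beta> n)"
    and "n \<in> carrier N \<Longrightarrow> \<beta> n \<in> K" "n \<in> carrier N \<Longrightarrow> \<eta> n \<in> carrier N"
    and "a \<in> K \<Longrightarrow> \<theta> a \<in> K" "a \<in> K \<Longrightarrow> b \<in> K \<Longrightarrow> \<theta> (a \<otimes> b) = \<theta> a \<otimes> \<theta> b"
    and "\<theta> \<one> = \<one>" "\<eta> \<one>\<^bsub>N\<^esub> = \<one>\<^bsub>N\<^esub>"
proof -
  show \<theta>: "\<theta> \<in> auto A" and \<eta>: "\<eta> \<in> auto N"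
    using assms by (simp_all add: twist_data_def)
  show "n \<in> carrier N \<Longrightarrow> \<beta> n \<in> K"
    using assms by (simp add: twist_data_def Units_ker)
  show "n \<in> carrier N \<Longrightarrow> \<eta> n \<in> carrier N" "\<eta> \<one>\<^bsub>N\<^esub> = \<one>\<^bsub>N\<^esub>"
    using \<eta> by (simp_all add: auto_closed N.auto_one)
  show "a \<in> K \<Longrightarrow> \<theta> a \<in> K" "a \<in> K \<Longrightarrow> b \<in> K \<Longrightarrow> \<theta> (a \<otimes> b) = \<theta> a \<otimes> \<theta> b" "\<theta> \<one> = \<one>"
    using auto_closed[OF \<theta>] auto_mult[OF \<theta>] A.auto_one[OF \<theta>] by (simp_all add: ker_monoid_simps)
qed (use assms in \<open>simp_all add: twist_data_def\<close>)

text \<open>Multiplicativity is the comparison of two normal forms. The map is bijective because \<open>\<eta>\<close> is bijective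
  on the first coordinate and, over a fixed \<open>n\<close>, the second coordinate is changed by the bijection
  \<open>a \<mapsto> \<beta>(n)\<theta>(a)\<close>.\<close>

lemma twist_in_auto:
  assumes "twist_data \<theta> \<eta> \<beta>"
  shows "twist \<theta> \<eta> \<beta> \<in> auto M"
proof (rule autoI)
  note d = twist_dataD[OF assms]
  let ?t = "twist \<theta> \<eta> \<beta>"
  show "?t \<in> extensional (carrier M)"
    by (simp add: twist_def)
  have K: "\<beta> n \<otimes> \<theta> a \<in> K" if "n \<in> carrier N" "a \<in> K" for n a
    using that by (simp add: d ker_mult)
  show "?t (x \<otimes> y) = ?t x \<otimes> ?t y" if xy: "x \<in> carrier M" "y \<in> carrier M" for x y
  proof -
    obtain a b where a: "a \<in> K" "x = \<kappa> (\<sigma> x) \<otimes> a" and b: "b \<in> K" "y = \<kappa> (\<sigma> y) \<otimes> b"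
      using normal_form xy by metis
    define m n where mn: "m = \<sigma> x" "n = \<sigma> y"
    have mnN: "m \<in> carrier N" "n \<in> carrier N"
      using xy by (simp_all add: mn sigma_closed)
    have k: "\<gamma> m n \<in> K" "\<phi> n a \<in> K" "\<theta> (\<gamma> m n) \<in> K" "\<theta> (\<phi> n a) \<in> K" "\<theta> a \<in> K" "\<theta> b \<in> K"
      "\<beta> m \<in> K" "\<beta> n \<in> K" "\<beta> (m \<otimes>\<^bsub>N\<^esub> n) \<in> K" "\<phi> (\<eta> n) (\<beta> m) \<in> K" "\<gamma> (\<eta> m) (\<eta> n) \<in> K"
      using mnN a b by (simp_all add: factor_ker act_ker d)
    note cl = k[THEN ker_closed]
    have "?t ((\<kappa> m \<otimes> a) \<otimes> (\<kappa> n \<otimes> b)) =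
        \<kappa> (\<eta> (m \<otimes>\<^bsub>N\<^esub> n)) \<otimes> (\<beta> (m \<otimes>\<^bsub>N\<^esub> n) \<otimes> \<theta> (\<gamma> m n) \<otimes> (\<theta> (\<phi> n a) \<otimes> \<theta> b))"
      using mnN a(1) b(1) k cl
      by (subst normal_form_mult)
        (simp_all add: twist_normal_form ker_mult d(10) M.m_assoc)
    also have "\<dots> = \<kappa> (\<eta> m \<otimes>\<^bsub>N\<^esub> \<eta> n) \<otimes>
        (\<gamma> (\<eta> m) (\<eta> n) \<otimes> (\<phi> (\<eta> n) (\<beta> m \<otimes> \<theta> a) \<otimes> (\<beta> n \<otimes> \<theta> b)))"
    proof -
      have "\<phi> (\<eta> n) (\<beta> m \<otimes> \<theta> a) = \<phi> (\<eta> n) (\<beta> m) \<otimes> \<theta> (\<phi> n a)"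
        using act_mult[of "\<eta> n" "\<beta> m" "\<theta> a"] mnN a(1) k by (simp add: ker_monoid_simps d)
      then show ?thesis
        using mnN k cl by (simp add: d(6) auto_mult[OF d(2)] M.m_assoc ker_lcomm ker_mult)
    qed
    also have "\<dots> = ?t (\<kappa> m \<otimes> a) \<otimes> ?t (\<kappa> n \<otimes> b)"
      using mnN a(1) b(1) k by (simp add: twist_normal_form normal_form_mult ker_mult d(8))
    finally show ?thesis
      using a(2) b(2) by (simp add: mn)
  qed
  show "bij_betw ?t (carrier M) (carrier M)"
    unfolding bij_betw_def
  proof (intro conjI equalityI subsetI inj_onI)
    fix x y
    assume xy: "x \<in> carrier M" "y \<in> carrier M" and eq: "?t x = ?t y"
    obtain a b where a: "a \<in> K" "x = \<kappa> (\<sigma> x) \<otimes> a" and b: "b \<in> K" "y = \<kappa> (\<sigma> y) \<otimes> b"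
      using normal_form xy by metis
    define m n where mn: "m = \<sigma> x" "n = \<sigma> y"
    have mnN: "m \<in> carrier N" "n \<in> carrier N"
      using xy by (simp_all add: mn sigma_closed)
    have nf: "x = \<kappa> m \<otimes> a" "y = \<kappa> n \<otimes> b"
      unfolding mn by (fact a(2) b(2))+
    have "\<kappa> (\<eta> m) \<otimes> (\<beta> m \<otimes> \<theta> a) = \<kappa> (\<eta> n) \<otimes> (\<beta> n \<otimes> \<theta> b)"
      using eq mnN a(1) b(1) by (simp add: nf twist_normal_form)
    then have *: "\<eta> m = \<eta> n" "\<beta> m \<otimes> \<theta> a = \<beta> n \<otimes> \<theta> b"
      by (simp_all add: normal_form_eq_iff[OF d(8)[OF mnN(1)] d(8)[OF mnN(2)]
            K[OF mnN(1) a(1)] K[OF mnN(2) b(1)]])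
    then have "m = n"
      using auto_inj[OF d(2)] mnN by blast
    moreover from this * have "\<theta> a = \<theta> b"
      using Units_ker_cancel[OF d(4)[OF mnN(2)]] a(1) b(1) d(9) by (simp add: ker_closed)
    then have "a = b"
      using auto_inj[OF d(1)] a(1) b(1) by (simp add: ker_monoid_simps)
    ultimately show "x = y"
      by (simp add: nf)
  next
    fix y
    assume "y \<in> ?t ` carrier M"
    then obtain x where x: "x \<in> carrier M" "y = ?t x"
      by blast
    obtain a where a: "a \<in> K" "x = \<kappa> (\<sigma> x) \<otimes> a"
      using normal_form[OF x(1)] by blast
    have "y = ?t (\<kappa> (\<sigma> x) \<otimes> a)"
      by (rule trans[OF x(2) arg_cong[OF a(2), of ?t]])
    then have "y = \<kappa> (\<eta> (\<sigma> x)) \<otimes> (\<beta> (\<sigma> x) \<otimes> \<theta> a)"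
      using a(1) x(1) by (simp add: twist_normal_form sigma_closed)
    then show "y \<in> carrier M"
      using K a(1) x(1) by (simp add: normal_form_closed sigma_closed d(8))
  next
    fix y
    assume y: "y \<in> carrier M"
    obtain b where b: "b \<in> K" "y = \<kappa> (\<sigma> y) \<otimes> b"
      using normal_form[OF y] by blast
    obtain n where n: "n \<in> carrier N" "\<sigma> y = \<eta> n"
      using auto_surj[OF d(2) sigma_closed[OF y]] by blast
    obtain v where v: "v \<in> K" "\<beta> n \<otimes> v = \<one>"
      using d(4)[OF n(1)] by (auto simp: mem_Units_ker)
    obtain a where a: "a \<in> K" "v \<otimes> b = \<theta> a"
      using auto_surj[OF d(1), of "v \<otimes> b"] v b(1) by (auto simp: ker_monoid_simps ker_mult)
    have "\<beta> n \<otimes> \<theta> a = b"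
      using v b(1) n(1) by (simp add: ker_closed d(7) flip: a(2) M.m_assoc)
    then have "?t (\<kappa> n \<otimes> a) = \<kappa> (\<sigma> y) \<otimes> b"
      by (simp add: twist_normal_form[OF n(1) a(1)] n(2))
    then have "?t (\<kappa> n \<otimes> a) = y"
      unfolding b(2)[symmetric] .
    then show "y \<in> ?t ` carrier M"
      using normal_form_closed[OF n(1) a(1)] by blast
  qed
qed

lemma
  assumes "twist_data \<theta> \<eta> \<beta>"
  shows twist_in_ker_auto: "twist \<theta> \<eta> \<beta> \<in> ker_auto M N \<sigma>"
    and theta_twist: "theta M N \<sigma> (twist \<theta> \<eta> \<beta>) = \<theta>"
    and eta_twist: "eta M N \<sigma> (twist \<theta> \<eta> \<beta>) = \<eta>"
proof -
  note d = twist_dataD[OF assms]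
  let ?t = "twist \<theta> \<eta> \<beta>"
  have t_ker: "?t a = \<theta> a" if "a \<in> K" for a
    using twist_normal_form[OF N.one_closed that, of \<theta> \<eta> \<beta>] that
    by (simp add: kappa_one d ker_closed)
  have "\<theta> ` K = K"
    using auto_bij[OF d(1)] by (simp add: ker_monoid_simps bij_betw_def)
  then have "?t ` K = K"
    by (simp add: t_ker)
  moreover have "?t ` Pcar M N \<sigma> \<subseteq> Pcar M N \<sigma>"
  proof
    fix y
    assume "y \<in> ?t ` Pcar M N \<sigma>"
    then obtain x where x: "x \<in> Pcar M N \<sigma>" "y = ?t x"
      by blast
    obtain u where u: "u \<in> Units A" "x = \<kappa> (\<sigma> x) \<otimes> u"
      using Pcar_normal_form[OF x(1)] by blast
    note N = sigma_closed[OF Pcar_closed[OF x(1)]]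
    have "y = ?t (\<kappa> (\<sigma> x) \<otimes> u)"
      by (rule trans[OF x(2) arg_cong[OF u(2), of ?t]])
    then have "y = \<kappa> (\<eta> (\<sigma> x)) \<otimes> (\<beta> (\<sigma> x) \<otimes> \<theta> u)"
      by (simp add: twist_normal_form N Units_ker[OF u(1)])
    moreover have "\<beta> (\<sigma> x) \<otimes> \<theta> u \<in> Units A"
      using A.Units_m_closed[OF d(4)[OF N] auto_Units[OF d(1) u(1)]] by (simp add: ker_monoid_simps)
    ultimately show "y \<in> Pcar M N \<sigma>"
      by (simp add: Pcar_mult_unit kappa_Pcar d(8) N)
  qed
  ultimately show "?t \<in> ker_auto M N \<sigma>"
    by (simp add: ker_auto_def twist_in_auto[OF assms])
  show "theta M N \<sigma> ?t = \<theta>"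
    using auto_extensional[OF d(1)]
    by (auto simp: theta_def t_ker ker_monoid_simps fun_eq_iff extensional_def)
  show "eta M N \<sigma> ?t = \<eta>"
  proof (rule eta_eqI[OF d(2)])
    fix x
    assume x: "x \<in> carrier M"
    obtain a where a: "a \<in> K" "x = \<kappa> (\<sigma> x) \<otimes> a"
      using normal_form[OF x] by blast
    have "\<sigma> (?t (\<kappa> (\<sigma> x) \<otimes> a)) = \<eta> (\<sigma> x)"
      using a(1) x
      by (simp add: twist_normal_form sigma_closed sigma_normal_form ker_mult d(7-9))
    then show "\<eta> (\<sigma> x) = \<sigma> (?t x)"
      unfolding a(2)[symmetric] by (rule sym)
  qed
qed

text \<open>Every automorphism in question is a twist: \<open>\<psi>(\<kappa>(n))\<close> and \<open>\<kappa>(\<eta>(n))\<close> are precartesian over the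
  same element, and \<open>\<beta>(n)\<close> is the unit by which they differ.\<close>

lemma ker_auto_is_twist:
  assumes "\<psi> \<in> ker_auto M N \<sigma>"
  obtains \<beta> where "twist_data (theta M N \<sigma> \<psi>) (eta M N \<sigma> \<psi>) \<beta>"
    and "\<psi> = twist (theta M N \<sigma> \<psi>) (eta M N \<sigma> \<psi>) \<beta>"
proof -
  define \<theta> \<eta> where \<theta>\<eta>: "\<theta> = theta M N \<sigma> \<psi>" "\<eta> = eta M N \<sigma> \<psi>"
  note \<psi> = ker_autoD[OF assms]
  note mult = auto_mult[OF \<psi>(1)]
  have \<theta>: "\<theta> \<in> auto A" "\<And>a. a \<in> K \<Longrightarrow> \<psi> a = \<theta> a" "\<And>a. a \<in> K \<Longrightarrow> \<theta> a \<in> K"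
    using theta_in_auto[OF assms] \<psi>(2) by (simp_all add: \<theta>\<eta> theta_apply)
  have \<eta>: "\<eta> \<in> auto N" "\<And>x. x \<in> carrier M \<Longrightarrow> \<eta> (\<sigma> x) = \<sigma> (\<psi> x)"
    using eta_in_auto[OF assms] eta_sigma[OF assms] by (simp_all add: \<theta>\<eta>)
  have \<eta>N: "\<eta> n \<in> carrier N" if "n \<in> carrier N" for n
    using that \<eta>(1) by (simp add: auto_closed)
  have "\<exists>u\<in>Units A. \<psi> (\<kappa> n) = \<kappa> (\<eta> n) \<otimes> u" if "n \<in> carrier N" for n
  proof (rule Pcar_differ_by_unit[OF kappa_Pcar \<psi>(4)[OF kappa_Pcar]])
    show "\<sigma> (\<kappa> (\<eta> n)) = \<sigma> (\<psi> (\<kappa> n))"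
      using \<eta>(2)[OF kappa_closed[OF that]] sigma_kappa[OF that] sigma_kappa[OF \<eta>N[OF that]] by simp
  qed (use that \<eta>N in auto)
  then obtain \<beta> where \<beta>: "\<And>n. n \<in> carrier N \<Longrightarrow> \<beta> n \<in> Units A"
    "\<And>n. n \<in> carrier N \<Longrightarrow> \<psi> (\<kappa> n) = \<kappa> (\<eta> n) \<otimes> \<beta> n"
    by metis
  note \<beta>K = Units_ker[OF \<beta>(1)]
  have nf: "\<psi> (\<kappa> n \<otimes> a) = \<kappa> (\<eta> n) \<otimes> (\<beta> n \<otimes> \<theta> a)" if "n \<in> carrier N" "a \<in> K" for n a
    using that \<theta>(3)[OF that(2)]
    by (simp add: mult kappa_closed ker_closed \<beta>(2) \<theta>(2) M.m_assoc \<eta>N \<beta>K)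
  have "twist_data \<theta> \<eta> \<beta>"
    unfolding twist_data_def
  proof (intro conjI ballI)
    show "\<theta> \<in> auto A" "\<eta> \<in> auto N"
      by (fact \<theta> \<eta>)+
    show "\<beta> n \<in> Units A" if "n \<in> carrier N" for n
      by (fact \<beta>(1)[OF that])
    show "\<beta> \<one>\<^bsub>N\<^esub> = \<one>"
      using \<beta>(2)[OF N.one_closed] \<beta>K[OF N.one_closed] M.auto_one[OF \<psi>(1)]
      by (simp add: kappa_one N.auto_one[OF \<eta>(1)] ker_closed)
    show "\<phi> (\<eta> n) (\<theta> a) = \<theta> (\<phi> n a)" if n: "n \<in> carrier N" and a: "a \<in> K" for n a
    proof -
      have k: "\<theta> a \<in> K" "\<phi> n a \<in> K" "\<theta> (\<phi> n a) \<in> K" "\<phi> (\<eta> n) (\<theta> a) \<in> K" "\<beta> n \<in> K"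
        using n a by (simp_all add: \<theta>(3) act_ker \<eta>N \<beta>K)
      note cl = k[THEN ker_closed] kappa_closed[OF n] kappa_closed[OF \<eta>N[OF n]]
      (* apply \<psi> to both sides of a \<kappa>(n) = \<kappa>(n) \<phi>_n(a) *)
      have "\<kappa> (\<eta> n) \<otimes> (\<beta> n \<otimes> \<theta> (\<phi> n a)) = \<psi> (a \<otimes> \<kappa> n)"
        using n a k by (simp add: nf ker_mult_kappa)
      also have "\<dots> = \<theta> a \<otimes> \<kappa> (\<eta> n) \<otimes> \<beta> n"
        using n a cl by (simp add: mult kappa_closed ker_closed \<theta>(2) \<beta>(2) M.m_assoc)
      also have "\<dots> = \<kappa> (\<eta> n) \<otimes> (\<phi> (\<eta> n) (\<theta> a) \<otimes> \<beta> n)"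
        using n k cl by (simp add: ker_mult_kappa \<eta>N M.m_assoc)
      finally have "\<beta> n \<otimes> \<theta> (\<phi> n a) = \<beta> n \<otimes> \<phi> (\<eta> n) (\<theta> a)"
        using n k by (simp add: normal_form_eq_iff \<eta>N ker_mult ker_comm)
      then show ?thesis
        using Units_ker_cancel[OF \<beta>(1)[OF n]] cl by simp
    qed
    show "\<beta> (m \<otimes>\<^bsub>N\<^esub> n) \<otimes> \<theta> (\<gamma> m n) = \<gamma> (\<eta> m) (\<eta> n) \<otimes> (\<phi> (\<eta> n) (\<beta> m) \<otimes> \<beta> n)"
      if mn: "m \<in> carrier N" "n \<in> carrier N" for m n
    proof -
      have k: "\<theta> (\<gamma> m n) \<in> K" "\<gamma> (\<eta> m) (\<eta> n) \<in> K" "\<phi> (\<eta> n) (\<beta> m) \<in> K" "\<beta> n \<in> K"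
        "\<beta> (m \<otimes>\<^bsub>N\<^esub> n) \<in> K"
        using mn by (simp_all add: \<theta>(3) factor_ker act_ker \<eta>N \<beta>K)
      (* apply \<psi> to both sides of \<kappa>(m) \<kappa>(n) = \<kappa>(mn) \<gamma>(m,n) *)
      have "\<kappa> (\<eta> (m \<otimes>\<^bsub>N\<^esub> n)) \<otimes> (\<beta> (m \<otimes>\<^bsub>N\<^esub> n) \<otimes> \<theta> (\<gamma> m n)) = \<psi> (\<kappa> m \<otimes> \<kappa> n)"
        using mn by (simp add: kappa_mult nf factor_ker)
      also have "\<dots> = (\<kappa> (\<eta> m) \<otimes> \<beta> m) \<otimes> (\<kappa> (\<eta> n) \<otimes> \<beta> n)"
        using mn by (simp add: mult kappa_closed \<beta>(2))
      also have "\<dots> = \<kappa> (\<eta> (m \<otimes>\<^bsub>N\<^esub> n)) \<otimes> (\<gamma> (\<eta> m) (\<eta> n) \<otimes> (\<phi> (\<eta> n) (\<beta> m) \<otimes> \<beta> n))"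
        using mn by (simp add: normal_form_mult \<eta>N \<beta>K auto_mult[OF \<eta>(1)])
      finally show ?thesis
        using mn k by (simp add: normal_form_eq_iff \<eta>N ker_mult)
    qed
  qed
  moreover have "\<psi> = twist \<theta> \<eta> \<beta>"
    by (rule twist_eqI[OF auto_extensional[OF \<psi>(1)] nf])
  ultimately show thesis
    using that[folded \<theta>\<eta>] by blast
qed

section \<open>The groups of automorphisms\<close>

lemma id_in_ker_auto: "(\<lambda>x\<in>carrier M. x) \<in> ker_auto M N \<sigma>"
  by (auto simp: ker_auto_def M.auto_id ker_closed Pcar_closed image_iff)

lemma compose_in_ker_auto:
  assumes "f \<in> ker_auto M N \<sigma>" "g \<in> ker_auto M N \<sigma>"
  shows "compose (carrier M) f g \<in> ker_auto M N \<sigma>"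
proof -
  note f = ker_autoD[OF assms(1)] and g = ker_autoD[OF assms(2)]
  have "compose (carrier M) f g a = f (g a)" if "a \<in> K" for a
    using that by (simp add: compose_eq ker_closed)
  then have "compose (carrier M) f g ` K = f ` g ` K"
    unfolding image_image by (intro image_cong) auto
  then have "compose (carrier M) f g ` K = K"
    using assms by (simp add: ker_auto_def)
  moreover have "compose (carrier M) f g x \<in> Pcar M N \<sigma>" if "x \<in> Pcar M N \<sigma>" for x
    using that by (simp add: compose_eq Pcar_closed f(4) g(4))
  ultimately show ?thesis
    using M.auto_compose[OF f(1) g(1)] by (auto simp: ker_auto_def)
qed

text \<open>Only the inclusion \<open>\<psi>(Pcar) \<subseteq> Pcar\<close> is built into \<^const>\<open>ker_auto\<close>. The inverse inherits it:
  compare \<open>x \<in> Pcar\<close> with the precartesian element \<open>\<psi>(\<kappa>(n))\<close>, where \<open>n\<close> lies below \<open>\<psi>\<^sup>-\<^sup>1(x)\<close>; the two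
  differ by a unit of the kernel, and so do their preimages.\<close>

lemma inv_in_ker_auto:
  assumes "\<psi> \<in> ker_auto M N \<sigma>"
  shows "auto_inv M \<psi> \<in> ker_auto M N \<sigma>"
proof -
  note \<psi> = ker_autoD[OF assms]
  have "auto_inv M \<psi> ` K = K"
  proof (intro equalityI subsetI)
    fix a
    assume "a \<in> auto_inv M \<psi> ` K"
    then obtain b where "b \<in> K" "a = auto_inv M \<psi> b"
      by blast
    moreover obtain c where "c \<in> K" "b = \<psi> c"
      using \<psi>(3)[OF \<open>b \<in> K\<close>] by blast
    ultimately show "a \<in> K"
      using auto_inv_auto[OF \<psi>(1)] by (simp add: ker_closed)
  next
    fix a
    assume "a \<in> K"
    then show "a \<in> auto_inv M \<psi> ` K"
      using auto_inv_auto[OF \<psi>(1), of a] \<psi>(2)[of a]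
      by (intro image_eqI[of _ _ "\<psi> a"]) (simp_all add: ker_closed)
  qed
  moreover have "auto_inv M \<psi> x \<in> Pcar M N \<sigma>" if x: "x \<in> Pcar M N \<sigma>" for x
  proof -
    define w n where w: "w = auto_inv M \<psi> x" and n: "n = \<sigma> w"
    note xM = Pcar_closed[OF x]
    have wM: "w \<in> carrier M" "\<psi> w = x"
      using auto_inv_apply[OF \<psi>(1) xM] by (simp_all add: w)
    have nN: "n \<in> carrier N"
      by (simp add: n sigma_closed wM)
    have "\<sigma> (\<psi> (\<kappa> n)) = \<sigma> x"
      using eta_sigma[OF assms wM(1)] eta_sigma[OF assms kappa_closed[OF nN]]
      by (simp add: sigma_kappa nN wM(2) flip: n)
    then obtain u where u: "u \<in> Units A" "x = \<psi> (\<kappa> n) \<otimes> u"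
      using Pcar_differ_by_unit[OF \<psi>(4)[OF kappa_Pcar[OF nN]] x] by blast
    define v where "v = auto_inv A (theta M N \<sigma> \<psi>) u"
    have v: "v \<in> Units A"
      using auto_Units[OF A.auto_inv_in_auto[OF theta_in_auto[OF assms]] u(1)] by (simp add: v_def)
    have "\<psi> v = u"
      using auto_auto_inv[OF theta_in_auto[OF assms] A.Units_closed[OF u(1)]] Units_ker[OF v]
      by (simp add: v_def theta_apply)
    then have "\<psi> (\<kappa> n \<otimes> v) = \<psi> w"
      using u(2) wM(2) nN Units_ker[OF v] by (simp add: auto_mult[OF \<psi>(1)] kappa_closed ker_closed)
    then have "w = \<kappa> n \<otimes> v"
      using auto_inj[OF \<psi>(1)] wM(1) normal_form_closed[OF nN Units_ker[OF v]] by blast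
    then show ?thesis
      using Pcar_mult_unit[OF kappa_Pcar[OF nN] v] by (simp add: w)
  qed
  ultimately show ?thesis
    using M.auto_inv_in_auto[OF \<psi>(1)] by (auto simp: ker_auto_def)
qed

lemma theta_compose:
  assumes "g \<in> ker_auto M N \<sigma>"
  shows "theta M N \<sigma> (compose (carrier M) f g) = compose (carrier A) (theta M N \<sigma> f) (theta M N \<sigma> g)"
  using ker_auto_ker[OF assms]
  by (auto simp: theta_def compose_def ker_monoid_simps fun_eq_iff ker_closed)

lemma eta_compose:
  assumes "f \<in> ker_auto M N \<sigma>" "g \<in> ker_auto M N \<sigma>"
  shows "eta M N \<sigma> (compose (carrier M) f g) = compose (carrier N) (eta M N \<sigma> f) (eta M N \<sigma> g)"
proof (rule eta_eqI)
  show "compose (carrier N) (eta M N \<sigma> f) (eta M N \<sigma> g) \<in> auto N"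
    by (rule N.auto_compose[OF eta_in_auto[OF assms(1)] eta_in_auto[OF assms(2)]])
  show "compose (carrier N) (eta M N \<sigma> f) (eta M N \<sigma> g) (\<sigma> x) = \<sigma> (compose (carrier M) f g x)"
    if "x \<in> carrier M" for x
    using that auto_closed[OF ker_auto_auto[OF assms(2)]]
    by (simp add: compose_eq sigma_closed eta_sigma[OF assms(1)] eta_sigma[OF assms(2)])
qed

lemma eta_id: "eta M N \<sigma> (\<lambda>x\<in>carrier M. x) = (\<lambda>n\<in>carrier N. n)"
  by (rule eta_eqI) (simp_all add: N.auto_id sigma_closed)

lemma theta_id: "theta M N \<sigma> (\<lambda>x\<in>carrier M. x) = (\<lambda>a\<in>K. a)"
  by (auto simp: theta_def fun_eq_iff ker_closed)

lemma eta_inv: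
  assumes "\<psi> \<in> ker_auto M N \<sigma>" "eta M N \<sigma> \<psi> = (\<lambda>n\<in>carrier N. n)"
  shows "eta M N \<sigma> (auto_inv M \<psi>) = (\<lambda>n\<in>carrier N. n)"
proof -
  have "compose (carrier N) (eta M N \<sigma> (auto_inv M \<psi>)) (\<lambda>n\<in>carrier N. n) = (\<lambda>n\<in>carrier N. n)"
    using eta_compose[OF inv_in_ker_auto[OF assms(1)] assms(1)]
    by (simp add: auto_inv_compose[OF ker_auto_auto[OF assms(1)]] eta_id assms(2))
  moreover note auto = eta_in_auto[OF inv_in_ker_auto[OF assms(1)]]
  have "eta M N \<sigma> (auto_inv M \<psi>) \<in> carrier N \<rightarrow> carrier N"
    using auto_closed[OF auto] by blast
  ultimately show ?thesis
    using auto_extensional[OF auto] by simp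
qed

lemma theta_inv:
  assumes "\<psi> \<in> ker_auto M N \<sigma>" "theta M N \<sigma> \<psi> = (\<lambda>a\<in>K. a)"
  shows "theta M N \<sigma> (auto_inv M \<psi>) = (\<lambda>a\<in>K. a)"
proof -
  have "compose K (theta M N \<sigma> (auto_inv M \<psi>)) (\<lambda>a\<in>K. a) = (\<lambda>a\<in>K. a)"
    using theta_compose[OF assms(1), of "auto_inv M \<psi>"]
    by (simp add: auto_inv_compose[OF ker_auto_auto[OF assms(1)]] theta_id assms(2) ker_monoid_simps)
  moreover have "theta M N \<sigma> (auto_inv M \<psi>) \<in> K \<rightarrow> K"
    using ker_auto_ker[OF inv_in_ker_auto[OF assms(1)]] by (simp add: theta_def)
  moreover have "theta M N \<sigma> (auto_inv M \<psi>) \<in> extensional K"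
    by (simp add: theta_def)
  ultimately show ?thesis
    by simp
qed

lemma group_AutN: "group (AutN M N \<sigma>)"
  unfolding AutN_def
  by (rule M.group_of_automorphisms)
    (auto simp: ker_auto_auto id_in_ker_auto compose_in_ker_auto inv_in_ker_auto
      eta_id eta_compose eta_inv)

lemma group_AutA: "group (AutA M N \<sigma>)"
  unfolding AutA_def
  by (rule M.group_of_automorphisms)
    (auto simp: ker_auto_auto id_in_ker_auto compose_in_ker_auto inv_in_ker_auto
      theta_id theta_compose theta_inv ker_monoid_simps)

lemma group_AutAN: "group (AutAN M N \<sigma>)"
  unfolding AutAN_def
  by (rule M.group_of_automorphisms)
    (auto simp: ker_auto_auto id_in_ker_auto compose_in_ker_auto inv_in_ker_auto
      theta_id theta_compose theta_inv eta_id eta_compose eta_inv ker_monoid_simps)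

section \<open>Crossed homomorphisms as automorphisms\<close>

text \<open>For trivial \<open>\<theta>\<close> and \<open>\<eta>\<close> the unit \<open>\<gamma>\<^sub>m\<^sub>,\<^sub>n\<close> occurs on both sides of the condition on \<open>\<beta>\<close> and cancels; what is
  left is the identity of a one-cocycle.\<close>

lemma twist_data_id_iff:
  "twist_data (\<lambda>a\<in>K. a) (\<lambda>n\<in>carrier N. n) \<beta> \<longleftrightarrow> restrict \<beta> (carrier N) \<in> carrier (Z1 A N \<phi>)"
proof -
  have mult: "\<beta> (m \<otimes>\<^bsub>N\<^esub> n) \<otimes> \<gamma> m n = \<gamma> m n \<otimes> (\<phi> n (\<beta> m) \<otimes> \<beta> n) \<longleftrightarrow>
      \<beta> (m \<otimes>\<^bsub>N\<^esub> n) = \<phi> n (\<beta> m) \<otimes> \<beta> n"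
    if u: "\<forall>n\<in>carrier N. \<beta> n \<in> Units A" and mn: "m \<in> carrier N" "n \<in> carrier N" for m n
  proof -
    have "\<beta> (m \<otimes>\<^bsub>N\<^esub> n) \<otimes> \<gamma> m n = \<gamma> m n \<otimes> \<beta> (m \<otimes>\<^bsub>N\<^esub> n)"
      using u mn by (intro ker_comm) (simp_all add: Units_ker factor_ker)
    moreover have "\<beta> (m \<otimes>\<^bsub>N\<^esub> n) \<in> carrier M" "\<phi> n (\<beta> m) \<otimes> \<beta> n \<in> carrier M"
      using u mn by (simp_all add: Units_ker act_ker ker_closed)
    ultimately show ?thesis
      using Units_ker_cancel[OF factor_unit[OF mn]] by simp
  qed
  have id: "(\<lambda>a\<in>K. a) \<in> auto A"
    using A.auto_id by (simp add: ker_monoid_simps)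
  show ?thesis
  proof
    assume d: "twist_data (\<lambda>a\<in>K. a) (\<lambda>n\<in>carrier N. n) \<beta>"
    note d' = twist_dataD[OF d]
    show "restrict \<beta> (carrier N) \<in> carrier (Z1 A N \<phi>)"
      unfolding mem_Z1
    proof (intro conjI ballI)
      fix m n
      assume mn: "m \<in> carrier N" "n \<in> carrier N"
      have "\<beta> (m \<otimes>\<^bsub>N\<^esub> n) = \<phi> n (\<beta> m) \<otimes> \<beta> n"
        using mult[of m n] mn d'(6)[OF mn] by (simp add: d'(4) factor_ker)
      then show "restrict \<beta> (carrier N) (m \<otimes>\<^bsub>N\<^esub> n) =
          \<phi> n (restrict \<beta> (carrier N) m) \<otimes>\<^bsub>A\<^esub> restrict \<beta> (carrier N) n"
        using mn by (simp add: ker_monoid_simps)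
    qed (simp_all add: d'(4))
  next
    assume z: "restrict \<beta> (carrier N) \<in> carrier (Z1 A N \<phi>)"
    have u: "\<forall>n\<in>carrier N. \<beta> n \<in> Units A" and
      eq: "\<And>m n. m \<in> carrier N \<Longrightarrow> n \<in> carrier N \<Longrightarrow> \<beta> (m \<otimes>\<^bsub>N\<^esub> n) = \<phi> n (\<beta> m) \<otimes> \<beta> n"
      using z by (simp_all add: mem_Z1 ker_monoid_simps)
    show "twist_data (\<lambda>a\<in>K. a) (\<lambda>n\<in>carrier N. n) \<beta>"
      unfolding twist_data_def
    proof (intro conjI ballI)
      show "\<beta> \<one>\<^bsub>N\<^esub> = \<one>"
        using Z1_one[OF z] by (simp add: ker_monoid_simps)
      fix m n
      assume mn: "m \<in> carrier N" "n \<in> carrier N"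
      have "\<beta> (m \<otimes>\<^bsub>N\<^esub> n) \<otimes> \<gamma> m n = \<gamma> m n \<otimes> (\<phi> n (\<beta> m) \<otimes> \<beta> n)"
        using mult[OF u mn] eq[OF mn] by blast
      then show "\<beta> (m \<otimes>\<^bsub>N\<^esub> n) \<otimes> (\<lambda>a\<in>K. a) (\<gamma> m n) =
          \<gamma> ((\<lambda>n\<in>carrier N. n) m) ((\<lambda>n\<in>carrier N. n) n) \<otimes> (\<phi> ((\<lambda>n\<in>carrier N. n) n) (\<beta> m) \<otimes> \<beta> n)"
        using mn by (simp add: factor_ker)
    qed (use u in \<open>simp_all add: id N.auto_id act_ker\<close>)
  qed
qed

lemma twist_id_eq:
  assumes "\<And>n. n \<in> carrier N \<Longrightarrow> \<xi> n \<in> K"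
  shows "(\<lambda>x\<in>carrier M. x \<otimes> \<xi> (\<sigma> x)) = twist (\<lambda>a\<in>K. a) (\<lambda>n\<in>carrier N. n) \<xi>"
  by (rule twist_eqI)
    (simp_all add: assms normal_form_closed sigma_normal_form M.m_assoc kappa_closed ker_closed ker_comm)

lemma Z1_ker: "\<xi> \<in> carrier (Z1 A N \<phi>) \<Longrightarrow> n \<in> carrier N \<Longrightarrow> \<xi> n \<in> K"
  by (simp add: mem_Z1 Units_ker)

lemma mem_AutAN:
  "\<psi> \<in> carrier (AutAN M N \<sigma>) \<longleftrightarrow> \<psi> \<in> ker_auto M N \<sigma> \<and>
    theta M N \<sigma> \<psi> = (\<lambda>a\<in>K. a) \<and> eta M N \<sigma> \<psi> = (\<lambda>n\<in>carrier N. n)"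
  by (simp add: AutAN_def)

lemma Z1_map_closed:
  assumes "\<xi> \<in> carrier (Z1 A N \<phi>)"
  shows "(\<lambda>x\<in>carrier M. x \<otimes> \<xi> (\<sigma> x)) \<in> carrier (AutAN M N \<sigma>)"
proof -
  have "restrict \<xi> (carrier N) = \<xi>"
    using assms by (auto simp: mem_Z1 intro: extensional_restrict)
  then have "twist_data (\<lambda>a\<in>K. a) (\<lambda>n\<in>carrier N. n) \<xi>"
    using assms by (simp add: twist_data_id_iff)
  then show ?thesis
    by (simp add: twist_id_eq Z1_ker[OF assms] mem_AutAN twist_in_ker_auto theta_twist eta_twist)
qed

lemma Z1_iso_AutAN:
  "(\<lambda>\<xi>. \<lambda>x\<in>carrier M. x \<otimes> \<xi> (\<sigma> x)) \<in> iso (Z1 A N \<phi>) (AutAN M N \<sigma>)"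
proof (rule isoI)
  let ?F = "\<lambda>\<xi>. \<lambda>x\<in>carrier M. x \<otimes> \<xi> (\<sigma> x)"
  show "?F \<in> hom (Z1 A N \<phi>) (AutAN M N \<sigma>)"
  proof (rule homI)
    fix \<xi> \<zeta>
    assume z: "\<xi> \<in> carrier (Z1 A N \<phi>)" "\<zeta> \<in> carrier (Z1 A N \<phi>)"
    then have auto: "?F \<xi> \<in> auto M" "?F \<zeta> \<in> auto M"
      using Z1_map_closed by (auto simp: mem_AutAN ker_auto_auto)
    have "?F (\<xi> \<otimes>\<^bsub>Z1 A N \<phi>\<^esub> \<zeta>) = compose (carrier M) (?F \<xi>) (?F \<zeta>)"
    proof (rule extensionalityI[of _ "carrier M"])
      fix x
      assume x: "x \<in> carrier M"
      have k: "\<xi> (\<sigma> x) \<in> K" "\<zeta> (\<sigma> x) \<in> K"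
        using z x by (simp_all add: Z1_ker sigma_closed)
      then have "\<sigma> (x \<otimes> \<zeta> (\<sigma> x)) = \<sigma> x"
        using x by (simp add: sigma_mult ker_closed sigma_ker sigma_closed)
      then show "?F (\<xi> \<otimes>\<^bsub>Z1 A N \<phi>\<^esub> \<zeta>) x = compose (carrier M) (?F \<xi>) (?F \<zeta>) x"
        using x k by (simp add: compose_eq Z1_def ker_monoid_simps sigma_closed ker_closed
            M.m_assoc ker_comm)
    qed (simp_all add: compose_def)
    then show "?F (\<xi> \<otimes>\<^bsub>Z1 A N \<phi>\<^esub> \<zeta>) = ?F \<xi> \<otimes>\<^bsub>AutAN M N \<sigma>\<^esub> ?F \<zeta>"
      using auto by (simp add: AutAN_def mult_AutoGroup)
  qed (rule Z1_map_closed)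
  show "bij_betw ?F (carrier (Z1 A N \<phi>)) (carrier (AutAN M N \<sigma>))"
    unfolding bij_betw_def
  proof (intro conjI equalityI subsetI inj_onI)
    fix \<xi> \<zeta>
    assume z: "\<xi> \<in> carrier (Z1 A N \<phi>)" "\<zeta> \<in> carrier (Z1 A N \<phi>)" and eq: "?F \<xi> = ?F \<zeta>"
    show "\<xi> = \<zeta>"
    proof (rule extensionalityI[of _ "carrier N"])
      fix n
      assume n: "n \<in> carrier N"
      have "\<kappa> n \<otimes> \<xi> n = \<kappa> n \<otimes> \<zeta> n"
        using fun_cong[OF eq, of "\<kappa> n"] n by (simp add: kappa_closed sigma_kappa)
      then show "\<xi> n = \<zeta> n"
        using normal_form_eq_iff[OF n n Z1_ker[OF z(1) n] Z1_ker[OF z(2) n]] by blast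
    qed (use z in \<open>simp_all add: mem_Z1\<close>)
  next
    fix \<psi>
    assume "\<psi> \<in> ?F ` carrier (Z1 A N \<phi>)"
    then show "\<psi> \<in> carrier (AutAN M N \<sigma>)"
      using Z1_map_closed by auto
  next
    fix \<psi>
    assume "\<psi> \<in> carrier (AutAN M N \<sigma>)"
    then obtain \<beta> where \<beta>: "twist_data (\<lambda>a\<in>K. a) (\<lambda>n\<in>carrier N. n) \<beta>"
      "\<psi> = twist (\<lambda>a\<in>K. a) (\<lambda>n\<in>carrier N. n) \<beta>"
      using ker_auto_is_twist by (metis mem_AutAN)
    have "?F (restrict \<beta> (carrier N)) = ?F \<beta>"
      by (auto simp: fun_eq_iff sigma_closed)
    then have "\<psi> = ?F (restrict \<beta> (carrier N))"
      using \<beta>(2) twist_id_eq[of \<beta>] twist_dataD(7)[OF \<beta>(1)] by simp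
    then show "\<psi> \<in> ?F ` carrier (Z1 A N \<phi>)"
      using \<beta>(1) unfolding twist_data_id_iff by blast
  qed
qed

section \<open>The obstruction maps and exactness\<close>

text \<open>The obstruction cocycle of \<open>\<theta>\<close> is the factor set divided by its push-forward along \<open>\<theta>\<close>; that of \<open>\<eta>\<close>
  is the pull-back of the factor set along \<open>\<eta>\<close> divided by the factor set.\<close>

lemma cocycle1_eq:
  "cocycle1 A N \<gamma> \<theta> = (\<lambda>p\<in>carrier N \<times> carrier N. factor_set p \<otimes>\<^bsub>A\<^esub>
     inv\<^bsub>A\<^esub> (\<lambda>p\<in>carrier N \<times> carrier N. \<theta> (factor_set p)) p)"
  by (auto simp: cocycle1_def factor_set_def fun_eq_iff)

lemma cocycle2_eq:
  assumes "\<eta> \<in> auto N"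
  shows "cocycle2 A N \<gamma> \<eta> = (\<lambda>p\<in>carrier N \<times> carrier N.
     (\<lambda>(m, n)\<in>carrier N \<times> carrier N. factor_set (\<eta> m, \<eta> n)) p \<otimes>\<^bsub>A\<^esub> inv\<^bsub>A\<^esub> factor_set p)"
  using auto_closed[OF assms] by (auto simp: cocycle2_def factor_set_def fun_eq_iff)

lemma cocycle1_closed:
  assumes "\<theta> \<in> carrier (C1 A N \<phi>)"
  shows "cocycle1 A N \<gamma> \<theta> \<in> reg_cocycles2 A N \<phi>"
  unfolding cocycle1_eq
  by (rule reg_cocycles2_divide[OF factor_set_cocycle reg_cocycles2_push[OF assms factor_set_cocycle]])

lemma cocycle2_closed:
  assumes "\<eta> \<in> carrier (C2 A N \<phi>)"
  shows "cocycle2 A N \<gamma> \<eta> \<in> reg_cocycles2 A N \<phi>"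
  using reg_cocycles2_divide[OF reg_cocycles2_pull[OF assms factor_set_cocycle] factor_set_cocycle] assms
  by (simp add: cocycle2_eq mem_C2)

lemma unit_eq_quotient_iff:
  assumes "a \<in> K" "c \<in> K" "d \<in> Units A" "s \<in> K" "t \<in> K"
  shows "a = (c \<otimes>\<^bsub>A\<^esub> inv\<^bsub>A\<^esub> d) \<otimes>\<^bsub>A\<^esub> t \<otimes>\<^bsub>A\<^esub> s \<longleftrightarrow> a \<otimes> d = c \<otimes> (s \<otimes> t)"
proof -
  have cA: "a \<in> carrier A" "c \<in> carrier A" "s \<in> carrier A" "t \<in> carrier A" "inv\<^bsub>A\<^esub> d \<in> carrier A"
    using assms by (simp_all add: ker_monoid_simps flip: carrier_ker_monoid)
  have quotient: "(c \<otimes>\<^bsub>A\<^esub> inv\<^bsub>A\<^esub> d) \<otimes>\<^bsub>A\<^esub> t \<otimes>\<^bsub>A\<^esub> s = (c \<otimes>\<^bsub>A\<^esub> (s \<otimes>\<^bsub>A\<^esub> t)) \<otimes>\<^bsub>A\<^esub> inv\<^bsub>A\<^esub> d"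
    using cA by (simp only: A.m_ac A.m_closed)
  have "a = (c \<otimes>\<^bsub>A\<^esub> inv\<^bsub>A\<^esub> d) \<otimes>\<^bsub>A\<^esub> t \<otimes>\<^bsub>A\<^esub> s \<longleftrightarrow> a \<otimes>\<^bsub>A\<^esub> d = c \<otimes>\<^bsub>A\<^esub> (s \<otimes>\<^bsub>A\<^esub> t)"
    unfolding quotient by (rule A.eq_divide_iff) (use cA assms(3) in auto)
  then show ?thesis
    by (simp add: ker_monoid_simps)
qed

text \<open>Dividing the condition \<open>\<beta>(mn)\<theta>(\<gamma>\<^sub>m\<^sub>,\<^sub>n) = \<gamma>\<^sub>m\<^sub>,\<^sub>n\<phi>\<^sub>n(\<beta>(m))\<beta>(n)\<close> by \<open>\<theta>(\<gamma>\<^sub>m\<^sub>,\<^sub>n)\<close> turns it into the statement that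
  \<open>\<beta>\<close> trivialises the obstruction cocycle, so \<open>\<theta>\<close> has trivial class exactly if it extends to a twist.\<close>

lemma lambda1_trivial_iff:
  assumes "\<theta> \<in> carrier (C1 A N \<phi>)"
  shows "lambda1 A N \<phi> \<gamma> \<theta> = \<one>\<^bsub>H2 A N \<phi>\<^esub> \<longleftrightarrow> (\<exists>\<beta>. twist_data \<theta> (\<lambda>n\<in>carrier N. n) \<beta>)"
proof -
  have \<theta>: "\<theta> \<in> auto A" "\<And>n a. n \<in> carrier N \<Longrightarrow> a \<in> K \<Longrightarrow> \<phi> n (\<theta> a) = \<theta> (\<phi> n a)"
    using assms by (auto simp: mem_C1 ker_monoid_simps)
  have "(\<forall>n\<in>carrier N. \<tau> n \<in> Units A) \<and> \<tau> \<one>\<^bsub>N\<^esub> = \<one>\<^bsub>A\<^esub> \<and> (\<forall>m\<in>carrier N. \<forall>n\<in>carrier N.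
        \<tau> (m \<otimes>\<^bsub>N\<^esub> n) = cocycle1 A N \<gamma> \<theta> (m, n) \<otimes>\<^bsub>A\<^esub> \<tau> n \<otimes>\<^bsub>A\<^esub> \<phi> n (\<tau> m)) \<longleftrightarrow>
      twist_data \<theta> (\<lambda>n\<in>carrier N. n) \<tau>" for \<tau>
  proof (cases "\<forall>n\<in>carrier N. \<tau> n \<in> Units A")
    case True
    have "\<tau> (m \<otimes>\<^bsub>N\<^esub> n) = cocycle1 A N \<gamma> \<theta> (m, n) \<otimes>\<^bsub>A\<^esub> \<tau> n \<otimes>\<^bsub>A\<^esub> \<phi> n (\<tau> m) \<longleftrightarrow>
        \<tau> (m \<otimes>\<^bsub>N\<^esub> n) \<otimes> \<theta> (\<gamma> m n) = \<gamma> m n \<otimes> (\<phi> n (\<tau> m) \<otimes> \<tau> n)"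
      if "m \<in> carrier N" "n \<in> carrier N" for m n
      using that True
      by (simp add: cocycle1_def unit_eq_quotient_iff Units_ker factor_ker act_ker auto_Units[OF \<theta>(1)]
          factor_unit)
    then show ?thesis
      using True \<theta> by (simp add: twist_data_def N.auto_id one_ker_monoid)
  qed (unfold twist_data_def, blast)
  then show ?thesis
    unfolding lambda1_def class_eq_one_H2_iff[OF cocycle1_closed[OF assms]] by simp
qed

text \<open>As for \<open>\<theta>\<close>, now dividing by \<open>\<gamma>\<^sub>m\<^sub>,\<^sub>n\<close>; that \<open>\<eta>\<close> fixes the action turns \<open>\<phi>\<close> at \<open>\<eta>(n)\<close> into \<open>\<phi>\<^sub>n\<close>.\<close>

lemma lambda2_trivial_iff:
  assumes "\<eta> \<in> carrier (C2 A N \<phi>)"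
  shows "lambda2 A N \<phi> \<gamma> \<eta> = \<one>\<^bsub>H2 A N \<phi>\<^esub> \<longleftrightarrow> (\<exists>\<beta>. twist_data (\<lambda>a\<in>K. a) \<eta> \<beta>)"
proof -
  have \<eta>: "\<eta> \<in> auto N" "\<And>n a. n \<in> carrier N \<Longrightarrow> a \<in> K \<Longrightarrow> \<phi> (\<eta> n) a = \<phi> n a"
    using assms by (auto simp: mem_C2 ker_monoid_simps)
  have \<eta>N: "\<eta> n \<in> carrier N" if "n \<in> carrier N" for n
    using that \<eta>(1) by (simp add: auto_closed)
  have id: "(\<lambda>a\<in>K. a) \<in> auto A"
    using A.auto_id by (simp add: ker_monoid_simps)
  have "(\<forall>n\<in>carrier N. \<tau> n \<in> Units A) \<and> \<tau> \<one>\<^bsub>N\<^esub> = \<one>\<^bsub>A\<^esub> \<and> (\<forall>m\<in>carrier N. \<forall>n\<in>carrier N.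
        \<tau> (m \<otimes>\<^bsub>N\<^esub> n) = cocycle2 A N \<gamma> \<eta> (m, n) \<otimes>\<^bsub>A\<^esub> \<tau> n \<otimes>\<^bsub>A\<^esub> \<phi> n (\<tau> m)) \<longleftrightarrow>
      twist_data (\<lambda>a\<in>K. a) \<eta> \<tau>" for \<tau>
  proof (cases "\<forall>n\<in>carrier N. \<tau> n \<in> Units A")
    case True
    have "\<tau> (m \<otimes>\<^bsub>N\<^esub> n) = cocycle2 A N \<gamma> \<eta> (m, n) \<otimes>\<^bsub>A\<^esub> \<tau> n \<otimes>\<^bsub>A\<^esub> \<phi> n (\<tau> m) \<longleftrightarrow>
        \<tau> (m \<otimes>\<^bsub>N\<^esub> n) \<otimes> (\<lambda>a\<in>K. a) (\<gamma> m n) = \<gamma> (\<eta> m) (\<eta> n) \<otimes> (\<phi> (\<eta> n) (\<tau> m) \<otimes> \<tau> n)"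
      if "m \<in> carrier N" "n \<in> carrier N" for m n
      using that True
      by (simp add: cocycle2_def unit_eq_quotient_iff Units_ker factor_ker act_ker \<eta>N factor_unit \<eta>(2))
    then show ?thesis
      using True \<eta> id by (simp add: twist_data_def act_ker one_ker_monoid)
  qed (unfold twist_data_def, blast)
  then show ?thesis
    unfolding lambda2_def class_eq_one_H2_iff[OF cocycle2_closed[OF assms]] by simp
qed

lemma exact_AutN:
  "exact_pointed (AutAN M N \<sigma>) (\<lambda>\<psi>. \<psi>) (AutN M N \<sigma>) (theta M N \<sigma>)
     (C1 A N \<phi>) (lambda1 A N \<phi> \<gamma>) (H2 A N \<phi>)"
  unfolding exact_pointed_def
proof (intro conjI)
  have AutN: "\<psi> \<in> carrier (AutN M N \<sigma>) \<longleftrightarrow> \<psi> \<in> ker_auto M N \<sigma> \<and>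
      eta M N \<sigma> \<psi> = (\<lambda>n\<in>carrier N. n)" for \<psi>
    by (simp add: AutN_def)
  have C1: "theta M N \<sigma> \<psi> \<in> carrier (C1 A N \<phi>)" if \<psi>: "\<psi> \<in> carrier (AutN M N \<sigma>)" for \<psi>
  proof -
    obtain \<beta> where "twist_data (theta M N \<sigma> \<psi>) (\<lambda>n\<in>carrier N. n) \<beta>"
      using \<psi> ker_auto_is_twist AutN by metis
    then show ?thesis
      unfolding mem_C1 using twist_dataD(1,3) by (fastforce simp: ker_monoid_simps)
  qed
  show "group (AutAN M N \<sigma>)" "group (AutN M N \<sigma>)" "group (C1 A N \<phi>)"
    by (rule group_AutAN group_AutN group_C1)+
  show "(\<lambda>\<psi>. \<psi>) \<in> mon (AutAN M N \<sigma>) (AutN M N \<sigma>)"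
    by (auto simp: mon_def hom_def AutAN_def AutN_def)
  show "theta M N \<sigma> \<in> hom (AutN M N \<sigma>) (C1 A N \<phi>)"
  proof (rule homI)
    fix f g
    assume fg: "f \<in> carrier (AutN M N \<sigma>)" "g \<in> carrier (AutN M N \<sigma>)"
    then show "theta M N \<sigma> (f \<otimes>\<^bsub>AutN M N \<sigma>\<^esub> g) =
        theta M N \<sigma> f \<otimes>\<^bsub>C1 A N \<phi>\<^esub> theta M N \<sigma> g"
      by (simp add: AutN_def C1_def mult_AutoGroup ker_auto_auto theta_in_auto theta_compose)
  qed (rule C1)
  show "kernel (AutN M N \<sigma>) (C1 A N \<phi>) (theta M N \<sigma>) = (\<lambda>\<psi>. \<psi>) ` carrier (AutAN M N \<sigma>)"
    by (auto simp: kernel_def AutN mem_AutAN C1_def one_AutoGroup ker_monoid_simps)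
  show "lambda1 A N \<phi> \<gamma> \<in> carrier (C1 A N \<phi>) \<rightarrow> carrier (H2 A N \<phi>)"
    using cocycle1_closed by (simp add: lambda1_def H2_def quotientI)
  show "\<one>\<^bsub>H2 A N \<phi>\<^esub> \<in> carrier (H2 A N \<phi>)"
    by (rule one_H2_closed)
  show "theta M N \<sigma> ` carrier (AutN M N \<sigma>) =
      {\<theta> \<in> carrier (C1 A N \<phi>). lambda1 A N \<phi> \<gamma> \<theta> = \<one>\<^bsub>H2 A N \<phi>\<^esub>}"
  proof (intro equalityI subsetI)
    fix \<theta>
    assume "\<theta> \<in> theta M N \<sigma> ` carrier (AutN M N \<sigma>)"
    then obtain \<psi> where \<psi>: "\<psi> \<in> carrier (AutN M N \<sigma>)" "\<theta> = theta M N \<sigma> \<psi>"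
      by blast
    then obtain \<beta> where "twist_data \<theta> (\<lambda>n\<in>carrier N. n) \<beta>"
      using ker_auto_is_twist AutN by metis
    then show "\<theta> \<in> {\<theta> \<in> carrier (C1 A N \<phi>). lambda1 A N \<phi> \<gamma> \<theta> = \<one>\<^bsub>H2 A N \<phi>\<^esub>}"
      using C1[OF \<psi>(1)] \<psi>(2) lambda1_trivial_iff by auto
  next
    fix \<theta>
    assume "\<theta> \<in> {\<theta> \<in> carrier (C1 A N \<phi>). lambda1 A N \<phi> \<gamma> \<theta> = \<one>\<^bsub>H2 A N \<phi>\<^esub>}"
    then obtain \<beta> where "twist_data \<theta> (\<lambda>n\<in>carrier N. n) \<beta>"
      using lambda1_trivial_iff by auto
    then show "\<theta> \<in> theta M N \<sigma> ` carrier (AutN M N \<sigma>)"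
      by (intro image_eqI[of _ _ "twist \<theta> (\<lambda>n\<in>carrier N. n) \<beta>"])
        (simp_all add: AutN twist_in_ker_auto theta_twist eta_twist)
  qed
qed

lemma exact_AutA:
  "exact_pointed (AutAN M N \<sigma>) (\<lambda>\<psi>. \<psi>) (AutA M N \<sigma>) (eta M N \<sigma>)
     (C2 A N \<phi>) (lambda2 A N \<phi> \<gamma>) (H2 A N \<phi>)"
  unfolding exact_pointed_def
proof (intro conjI)
  have AutA: "\<psi> \<in> carrier (AutA M N \<sigma>) \<longleftrightarrow> \<psi> \<in> ker_auto M N \<sigma> \<and>
      theta M N \<sigma> \<psi> = (\<lambda>a\<in>K. a)" for \<psi>
    by (simp add: AutA_def)
  have C2: "eta M N \<sigma> \<psi> \<in> carrier (C2 A N \<phi>)" if \<psi>: "\<psi> \<in> carrier (AutA M N \<sigma>)" for \<psi>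
  proof -
    obtain \<beta> where "twist_data (\<lambda>a\<in>K. a) (eta M N \<sigma> \<psi>) \<beta>"
      using \<psi> ker_auto_is_twist AutA by metis
    then show ?thesis
      unfolding mem_C2 using twist_dataD(2,3) by (fastforce simp: ker_monoid_simps act_ker)
  qed
  show "group (AutAN M N \<sigma>)" "group (AutA M N \<sigma>)" "group (C2 A N \<phi>)"
    by (rule group_AutAN group_AutA group_C2)+
  show "(\<lambda>\<psi>. \<psi>) \<in> mon (AutAN M N \<sigma>) (AutA M N \<sigma>)"
    by (auto simp: mon_def hom_def AutAN_def AutA_def)
  show "eta M N \<sigma> \<in> hom (AutA M N \<sigma>) (C2 A N \<phi>)"
  proof (rule homI)
    fix f g
    assume fg: "f \<in> carrier (AutA M N \<sigma>)" "g \<in> carrier (AutA M N \<sigma>)"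
    then show "eta M N \<sigma> (f \<otimes>\<^bsub>AutA M N \<sigma>\<^esub> g) =
        eta M N \<sigma> f \<otimes>\<^bsub>C2 A N \<phi>\<^esub> eta M N \<sigma> g"
      by (simp add: AutA_def C2_def mult_AutoGroup ker_auto_auto eta_in_auto eta_compose)
  qed (rule C2)
  show "kernel (AutA M N \<sigma>) (C2 A N \<phi>) (eta M N \<sigma>) = (\<lambda>\<psi>. \<psi>) ` carrier (AutAN M N \<sigma>)"
    by (auto simp: kernel_def AutA mem_AutAN C2_def one_AutoGroup)
  show "lambda2 A N \<phi> \<gamma> \<in> carrier (C2 A N \<phi>) \<rightarrow> carrier (H2 A N \<phi>)"
    using cocycle2_closed by (simp add: lambda2_def H2_def quotientI)
  show "\<one>\<^bsub>H2 A N \<phi>\<^esub> \<in> carrier (H2 A N \<phi>)"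
    by (rule one_H2_closed)
  show "eta M N \<sigma> ` carrier (AutA M N \<sigma>) =
      {\<eta> \<in> carrier (C2 A N \<phi>). lambda2 A N \<phi> \<gamma> \<eta> = \<one>\<^bsub>H2 A N \<phi>\<^esub>}"
  proof (intro equalityI subsetI)
    fix \<eta>
    assume "\<eta> \<in> eta M N \<sigma> ` carrier (AutA M N \<sigma>)"
    then obtain \<psi> where \<psi>: "\<psi> \<in> carrier (AutA M N \<sigma>)" "\<eta> = eta M N \<sigma> \<psi>"
      by blast
    then obtain \<beta> where "twist_data (\<lambda>a\<in>K. a) \<eta> \<beta>"
      using ker_auto_is_twist AutA by metis
    then show "\<eta> \<in> {\<eta> \<in> carrier (C2 A N \<phi>). lambda2 A N \<phi> \<gamma> \<eta> = \<one>\<^bsub>H2 A N \<phi>\<^esub>}"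
      using C2[OF \<psi>(1)] \<psi>(2) lambda2_trivial_iff by auto
  next
    fix \<eta>
    assume "\<eta> \<in> {\<eta> \<in> carrier (C2 A N \<phi>). lambda2 A N \<phi> \<gamma> \<eta> = \<one>\<^bsub>H2 A N \<phi>\<^esub>}"
    then obtain \<beta> where "twist_data (\<lambda>a\<in>K. a) \<eta> \<beta>"
      using lambda2_trivial_iff by auto
    then show "\<eta> \<in> eta M N \<sigma> ` carrier (AutA M N \<sigma>)"
      by (intro image_eqI[of _ _ "twist (\<lambda>a\<in>K. a) \<eta> \<beta>"])
        (simp_all add: AutA twist_in_ker_auto theta_twist eta_twist)
  qed
qed

section \<open>Independence of the cleavage\<close>

text \<open>Two cleavages differ by a map \<open>u\<close> into the units of \<open>A\<close>. As \<open>A\<close> is commutative, conjugation by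
  \<open>u(n)\<close> does not change the action, and \<open>u\<close> itself is the cochain making the two factor sets
  cohomologous.\<close>

lemma
  assumes "cleavage M N \<sigma> \<kappa>'"
  shows act_other_cleavage: "n \<in> carrier N \<Longrightarrow> a \<in> carrier A \<Longrightarrow>
      cleavage_action M N \<sigma> \<kappa>' n a = \<phi> n a"
    and factor_sets_cohomologous:
      "(cleaved_fibration.factor_set M N \<sigma> \<kappa>', factor_set) \<in> cohomologous A N \<phi>"
proof -
  interpret P: cleaved_fibration M N \<sigma> \<kappa>'
    by unfold_locales (rule assms)
  have "\<exists>u\<in>Units A. \<kappa>' n = \<kappa> n \<otimes> u" if "n \<in> carrier N" for n
    by (rule Pcar_differ_by_unit[OF kappa_Pcar P.kappa_Pcar])
      (simp_all add: that sigma_kappa P.sigma_kappa)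
  then obtain u where u: "\<And>n. n \<in> carrier N \<Longrightarrow> u n \<in> Units A"
    "\<And>n. n \<in> carrier N \<Longrightarrow> \<kappa>' n = \<kappa> n \<otimes> u n"
    by metis
  note uK = Units_ker[OF u(1)]
  show act: "P.\<phi> n a = \<phi> n a" if n: "n \<in> carrier N" and "a \<in> carrier A" for n a
  proof -
    have a: "a \<in> K"
      using that by (simp add: ker_monoid_simps)
    have c: "\<kappa> n \<in> carrier M" "u n \<in> carrier M" "a \<in> carrier M" "\<phi> n a \<in> carrier M"
      using n a by (simp_all add: kappa_closed ker_closed uK act_ker)
    have "a \<otimes> \<kappa>' n = a \<otimes> \<kappa> n \<otimes> u n"
      using c n by (simp add: u(2) M.m_assoc)
    also have "\<dots> = \<kappa> n \<otimes> (\<phi> n a \<otimes> u n)"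
      using c n a by (subst ker_mult_kappa) (simp_all add: M.m_assoc)
    also have "\<dots> = \<kappa>' n \<otimes> \<phi> n a"
      using c n a by (simp add: u(2) M.m_assoc ker_comm uK act_ker)
    finally show ?thesis
      using n a by (intro P.act_unique) (simp_all add: act_ker)
  qed
  show "(P.factor_set, factor_set) \<in> cohomologous A N \<phi>"
  proof (rule cohomologousI[where \<tau> = u])
    show "P.factor_set \<in> reg_cocycles2 A N \<phi>"
      using P.factor_set_cocycle
        cohomologous_cong[where A = A and N = N and \<phi> = P.\<phi> and \<phi>' = \<phi>, OF act]
      by simp
    have "\<kappa> \<one>\<^bsub>N\<^esub> \<otimes> u \<one>\<^bsub>N\<^esub> = \<kappa> \<one>\<^bsub>N\<^esub> \<otimes> \<one>"
      using u(2)[OF N.one_closed] by (simp add: kappa_one P.kappa_one)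
    then show "u \<one>\<^bsub>N\<^esub> = \<one>\<^bsub>A\<^esub>"
      using normal_form_eq_iff[OF N.one_closed N.one_closed uK[OF N.one_closed] ker_one]
      by (simp add: ker_monoid_simps)
    fix m n
    assume mn: "m \<in> carrier N" "n \<in> carrier N"
    have k: "P.\<gamma> m n \<in> K" "\<gamma> m n \<in> K" "u m \<in> K" "u n \<in> K" "u (m \<otimes>\<^bsub>N\<^esub> n) \<in> K" "\<phi> n (u m) \<in> K"
      using mn by (simp_all add: P.factor_ker factor_ker uK act_ker)
    have "\<kappa> (m \<otimes>\<^bsub>N\<^esub> n) \<otimes> (u (m \<otimes>\<^bsub>N\<^esub> n) \<otimes> P.\<gamma> m n) = \<kappa>' m \<otimes> \<kappa>' n"
      using mn k by (simp add: P.kappa_mult) (simp add: u(2) M.m_assoc kappa_closed ker_closed)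
    also have "\<dots> = \<kappa> (m \<otimes>\<^bsub>N\<^esub> n) \<otimes> (\<gamma> m n \<otimes> (\<phi> n (u m) \<otimes> u n))"
      using mn k by (simp add: u(2) normal_form_mult)
    finally have "u (m \<otimes>\<^bsub>N\<^esub> n) \<otimes> P.\<gamma> m n = \<gamma> m n \<otimes> (\<phi> n (u m) \<otimes> u n)"
      using mn k by (simp add: normal_form_eq_iff ker_mult)
    then show "P.factor_set (m, n) \<otimes>\<^bsub>A\<^esub> u (m \<otimes>\<^bsub>N\<^esub> n) =
        factor_set (m, n) \<otimes>\<^bsub>A\<^esub> u n \<otimes>\<^bsub>A\<^esub> \<phi> n (u m)"
      using mn k ker_comm[of "P.\<gamma> m n" "u (m \<otimes>\<^bsub>N\<^esub> n)"] ker_comm[of "\<phi> n (u m)" "u n"]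
      by (simp add: factor_set_def P.factor_set_def ker_monoid_simps M.m_assoc ker_closed)
  qed (use u factor_set_cocycle in auto)
qed

context
  fixes \<kappa>'
  assumes cleavage': "cleavage M N \<sigma> \<kappa>'"
begin

interpretation P: cleaved_fibration M N \<sigma> \<kappa>'
  by unfold_locales (rule cleavage')

lemma
  shows C1_other_cleavage: "C1 A N P.\<phi> = C1 A N \<phi>"
    and C2_other_cleavage: "C2 A N P.\<phi> = C2 A N \<phi>"
    and H2_other_cleavage: "H2 A N P.\<phi> = H2 A N \<phi>"
    and cohomologous_other_cleavage: "cohomologous A N P.\<phi> = cohomologous A N \<phi>"
  unfolding C1_def C2_def
  using compat_pairs_cong[where A = A and N = N and \<phi> = P.\<phi> and \<phi>' = \<phi>, OF act_other_cleavage[OF cleavage'] P.act_closed]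
    H2_cong[where A = A and N = N and \<phi> = P.\<phi> and \<phi>' = \<phi>, OF act_other_cleavage[OF cleavage']]
    cohomologous_cong[where A = A and N = N and \<phi> = P.\<phi> and \<phi>' = \<phi>, OF act_other_cleavage[OF cleavage']]
  by simp_all

lemma lambda1_other_cleavage:
  assumes "\<theta> \<in> carrier (C1 A N \<phi>)"
  shows "lambda1 A N P.\<phi> P.\<gamma> \<theta> = lambda1 A N \<phi> \<gamma> \<theta>"
  unfolding lambda1_def cohomologous_other_cleavage
  using factor_sets_cohomologous[OF cleavage']
  by (intro equiv_class_eq[OF equiv_cohomologous])
    (simp only: cocycle1_eq P.cocycle1_eq cohomologous_divide cohomologous_push[OF assms])

lemma lambda2_other_cleavage:
  assumes "\<eta> \<in> carrier (C2 A N \<phi>)"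
  shows "lambda2 A N P.\<phi> P.\<gamma> \<eta> = lambda2 A N \<phi> \<gamma> \<eta>"
proof -
  have \<eta>: "\<eta> \<in> auto N"
    using assms by (simp add: mem_C2)
  show ?thesis
    unfolding lambda2_def cohomologous_other_cleavage
    using factor_sets_cohomologous[OF cleavage']
    by (intro equiv_class_eq[OF equiv_cohomologous])
      (simp only: cocycle2_eq[OF \<eta>] P.cocycle2_eq[OF \<eta>] cohomologous_divide
        cohomologous_pull[OF assms])
qed

end

end

theorem theorem7p3:
  fixes M :: "('a, 'c) monoid_scheme" and N :: "('b, 'd) monoid_scheme"
    and \<sigma> :: "'a \<Rightarrow> 'b" and \<kappa> :: "'b \<Rightarrow> 'a"
  fixes A :: "('a, 'c) monoid_scheme"
    and \<phi> :: "('b \<Rightarrow> 'a) \<Rightarrow> 'b \<Rightarrow> 'a \<Rightarrow> 'a" and \<gamma> :: "('b \<Rightarrow> 'a) \<Rightarrow> 'b \<Rightarrow> 'b \<Rightarrow> 'a"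
  defines "A \<equiv> ker_monoid M N \<sigma>"
    and "\<phi> \<equiv> cleavage_action M N \<sigma>"
    and "\<gamma> \<equiv> cleavage_factor M N \<sigma>"
  assumes "monoid_fibration M N \<sigma>"
    and "comm_monoid A"
    and "cleavage M N \<sigma> \<kappa>"
  shows
    \<comment> \<open>(i)\<close>
    "((\<forall>\<xi>\<in>carrier (Z1 A N (\<phi> \<kappa>)).
         (\<lambda>x\<in>carrier M. x \<otimes>\<^bsub>M\<^esub> \<xi> (\<sigma> x)) \<in> carrier (AutAN M N \<sigma>)) \<and>
      group (Z1 A N (\<phi> \<kappa>)) \<and> group (AutAN M N \<sigma>) \<and>
      (\<lambda>\<xi>. \<lambda>x\<in>carrier M. x \<otimes>\<^bsub>M\<^esub> \<xi> (\<sigma> x)) \<in> iso (Z1 A N (\<phi> \<kappa>)) (AutAN M N \<sigma>)) \<and>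
    \<comment> \<open>(ii)\<close>
     ((\<forall>\<theta>\<in>carrier (C1 A N (\<phi> \<kappa>)). cocycle1 A N (\<gamma> \<kappa>) \<theta> \<in> reg_cocycles2 A N (\<phi> \<kappa>)) \<and>
      (\<forall>\<kappa>'. cleavage M N \<sigma> \<kappa>' \<longrightarrow>
         C1 A N (\<phi> \<kappa>') = C1 A N (\<phi> \<kappa>) \<and> H2 A N (\<phi> \<kappa>') = H2 A N (\<phi> \<kappa>) \<and>
         (\<forall>\<theta>\<in>carrier (C1 A N (\<phi> \<kappa>)).
            lambda1 A N (\<phi> \<kappa>') (\<gamma> \<kappa>') \<theta> = lambda1 A N (\<phi> \<kappa>) (\<gamma> \<kappa>) \<theta>))) \<and>
    \<comment> \<open>(iii)\<close>
     exact_pointed (AutAN M N \<sigma>) (\<lambda>\<psi>. \<psi>) (AutN M N \<sigma>) (theta M N \<sigma>)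
       (C1 A N (\<phi> \<kappa>)) (lambda1 A N (\<phi> \<kappa>) (\<gamma> \<kappa>)) (H2 A N (\<phi> \<kappa>)) \<and>
    \<comment> \<open>(iv)\<close>
     ((\<forall>\<eta>\<in>carrier (C2 A N (\<phi> \<kappa>)). cocycle2 A N (\<gamma> \<kappa>) \<eta> \<in> reg_cocycles2 A N (\<phi> \<kappa>)) \<and>
      (\<forall>\<kappa>'. cleavage M N \<sigma> \<kappa>' \<longrightarrow>
         C2 A N (\<phi> \<kappa>') = C2 A N (\<phi> \<kappa>) \<and> H2 A N (\<phi> \<kappa>') = H2 A N (\<phi> \<kappa>) \<and>
         (\<forall>\<eta>\<in>carrier (C2 A N (\<phi> \<kappa>)).
            lambda2 A N (\<phi> \<kappa>') (\<gamma> \<kappa>') \<eta> = lambda2 A N (\<phi> \<kappa>) (\<gamma> \<kappa>) \<eta>))) \<and>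
    \<comment> \<open>(v)\<close>
     exact_pointed (AutAN M N \<sigma>) (\<lambda>\<psi>. \<psi>) (AutA M N \<sigma>) (eta M N \<sigma>)
       (C2 A N (\<phi> \<kappa>)) (lambda2 A N (\<phi> \<kappa>) (\<gamma> \<kappa>)) (H2 A N (\<phi> \<kappa>))"
proof -
  interpret cleaved_fibration M N \<sigma> \<kappa>
    by (intro cleaved_fibration.intro comm_fibration.intro cleaved_fibration_axioms.intro)
      (use assms in simp_all)
  show ?thesis
    unfolding A_def \<phi>_def \<gamma>_def
    using Z1_map_closed group_Z1 group_AutAN Z1_iso_AutAN
      cocycle1_closed C1_other_cleavage H2_other_cleavage lambda1_other_cleavage exact_AutN
      cocycle2_closed C2_other_cleavage lambda2_other_cleavage exact_AutA
    by blast
qed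

end
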